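(* Let $R$ be a ring with $\mathrm{card}\,R\le\aleph_1$. Under the continuum hypothesis, $\mathrm{card}\,K(\mathrm{Proj}\text{-}R)^{\aleph_1}\le\aleph_1$.
   Context: $K(\mathrm{Proj}\text{-}R)$ is the homotopy category of (unbounded) complexes of projective right $R$-modules. The cardinal of an essentially small category is the cardinal of $\coprod_{x,y\in\mathcal S}\mathrm{Hom}(x,y)$, where $\mathcal S$ is a set of representatives of isomorphism classes of objects. For a regular cardinal $\alpha$ and a triangulated category $\mathcal T$ with coproducts, an object $S$ is $\alpha$-small if any morphism $S\to\coprod_{i\in I}X_i$ factors through $\coprod_{i\in I'}X_i$ for some $I'\subset I$ with $\mathrm{card}\,I'<\alpha$. $\mathcal T^\alpha$ is the unique maximal full subcategory formed by $\alpha$-small objects such that any morphism $S\to\coprod_{i\in I}X_i$ with $S\in\mathcal T^\alpha$ factors through a coproduct $\coprod_if_i\colon\coprod_iS_i\to\coprod_iX_i$ with all $S_i\in\mathcal T^\alpha$. *)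

theory Defs
  imports "HOL-Algebra.Ring" "HOL-Library.FuncSet"
begin

unbundle cardinal_syntax

text \<open>
  \<open>Comp C X Y Z g f\<close> is the composite of \<open>f : X \<rightarrow> Y\<close> followed by \<open>g : Y \<rightarrow> Z\<close>.  Hom-sets are not
  required to be disjoint.
\<close>

record ('o, 'm) cat =
  Obj :: "'o set"
  Hom :: "'o \<Rightarrow> 'o \<Rightarrow> 'm set"
  Comp :: "'o \<Rightarrow> 'o \<Rightarrow> 'o \<Rightarrow> 'm \<Rightarrow> 'm \<Rightarrow> 'm"
  Id :: "'o \<Rightarrow> 'm"

definition isomorphic :: "('o, 'm) cat \<Rightarrow> 'o \<Rightarrow> 'o \<Rightarrow> bool" where
  "isomorphic C X Y \<longleftrightarrow>
     (\<exists>f \<in> Hom C X Y. \<exists>g \<in> Hom C Y X. Comp C X Y X g f = Id C X \<and> Comp C Y X Y f g = Id C Y)"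

definition full_subcat :: "('o, 'm) cat \<Rightarrow> 'o set \<Rightarrow> ('o, 'm) cat" where
  "full_subcat C A = C\<lparr>Obj := A\<rparr>"

definition iso_representatives :: "('o, 'm) cat \<Rightarrow> 'o set \<Rightarrow> bool" where
  "iso_representatives C A \<longleftrightarrow> A \<subseteq> Obj C \<and> (\<forall>X \<in> Obj C. \<exists>!Y. Y \<in> A \<and> isomorphic C X Y)"

text \<open>The cardinal does not depend on the chosen representatives.\<close>

definition cat_card :: "('o, 'm) cat \<Rightarrow> (('o \<times> 'o) \<times> 'm) rel" where
  "cat_card C = (let A = (SOME A. iso_representatives C A) in
     |SIGMA p : A \<times> A. Hom C (fst p) (snd p)| )"

definition is_coproduct ::
  "('o, 'm) cat \<Rightarrow> 'i set \<Rightarrow> ('i \<Rightarrow> 'o) \<Rightarrow> 'o \<Rightarrow> ('i \<Rightarrow> 'm) \<Rightarrow> bool" where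
  "is_coproduct C I X P \<iota> \<longleftrightarrow>
     P \<in> Obj C \<and> (\<forall>i \<in> I. X i \<in> Obj C \<and> \<iota> i \<in> Hom C (X i) P) \<and>
     (\<forall>Y \<in> Obj C. \<forall>f. (\<forall>i \<in> I. f i \<in> Hom C (X i) Y) \<longrightarrow>
        (\<exists>!h. h \<in> Hom C P Y \<and> (\<forall>i \<in> I. Comp C (X i) P Y h (\<iota> i) = f i)))"

text \<open>
  In the following two definitions \<open>\<J>\<close> is the collection of sets that count as small index sets.
  The map \<open>j\<close> is the canonical map from the partial coproduct, and \<open>h\<close> in the
  second definition is \<open>\<Coprod>\<^sub>i f\<^sub>i\<close>.
\<close>

definition alpha_small ::
  "'i set set \<Rightarrow> 'a rel \<Rightarrow> ('o, 'm) cat \<Rightarrow> 'o \<Rightarrow> bool" where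
  "alpha_small \<J> \<alpha> C S \<longleftrightarrow> S \<in> Obj C \<and>
     (\<forall>I \<in> \<J>. \<forall>X P \<iota>. is_coproduct C I X P \<iota> \<longrightarrow> (\<forall>f \<in> Hom C S P.
        \<exists>I' \<subseteq> I. |I'| <o \<alpha> \<and>
          (\<exists>P' \<iota>'. is_coproduct C I' X P' \<iota>' \<and>
            (\<exists>j \<in> Hom C P' P. (\<forall>i \<in> I'. Comp C (X i) P' P j (\<iota>' i) = \<iota> i) \<and>
              (\<exists>g \<in> Hom C S P'. f = Comp C S P' P j g)))))"

definition coproduct_factoring :: "'i set set \<Rightarrow> ('o, 'm) cat \<Rightarrow> 'o set \<Rightarrow> bool" where
  "coproduct_factoring \<J> C A \<longleftrightarrow>
     (\<forall>S \<in> A. \<forall>I \<in> \<J>. \<forall>X P \<iota>. is_coproduct C I X P \<iota> \<longrightarrow> (\<forall>f \<in> Hom C S P.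
        \<exists>T t Q \<kappa>. (\<forall>i \<in> I. T i \<in> A \<and> t i \<in> Hom C (T i) (X i)) \<and> is_coproduct C I T Q \<kappa> \<and>
          (\<exists>h \<in> Hom C Q P.
            (\<forall>i \<in> I. Comp C (T i) Q P h (\<kappa> i) = Comp C (T i) (X i) P (\<iota> i) (t i)) \<and>
            (\<exists>g \<in> Hom C S Q. f = Comp C S Q P h g))))"

definition compact_objects :: "'i set set \<Rightarrow> 'a rel \<Rightarrow> ('o, 'm) cat \<Rightarrow> 'o set" where
  "compact_objects \<J> \<alpha> C =
     \<Union> {A. (\<forall>S \<in> A. alpha_small \<J> \<alpha> C S) \<and> coproduct_factoring \<J> C A}"

text \<open>
  The union is itself one of the classes over which it is taken, so it is the unique maximal one.
\<close>

lemma compact_objects_alpha_small: "S \<in> compact_objects \<J> \<alpha> C \<Longrightarrow> alpha_small \<J> \<alpha> C S"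
  unfolding compact_objects_def by blast

lemma compact_objects_factoring: "coproduct_factoring \<J> C (compact_objects \<J> \<alpha> C)"
  unfolding coproduct_factoring_def
proof (intro ballI allI impI)
  fix S I X P \<iota> f
  assume S: "S \<in> compact_objects \<J> \<alpha> C" and I: "I \<in> \<J>" and P: "is_coproduct C I X P \<iota>"
    and f: "f \<in> Hom C S P"
  from S obtain A where A: "S \<in> A" "\<forall>S \<in> A. alpha_small \<J> \<alpha> C S" "coproduct_factoring \<J> C A"
    unfolding compact_objects_def by blast
  then have sub: "A \<subseteq> compact_objects \<J> \<alpha> C"
    unfolding compact_objects_def by blast
  from A(3)[unfolded coproduct_factoring_def, rule_format, OF A(1) I P f]
  obtain T t Q \<kappa> where "\<forall>i \<in> I. T i \<in> A \<and> t i \<in> Hom C (T i) (X i)"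
    and *: "is_coproduct C I T Q \<kappa>"
      "\<exists>h \<in> Hom C Q P.
        (\<forall>i \<in> I. Comp C (T i) Q P h (\<kappa> i) = Comp C (T i) (X i) P (\<iota> i) (t i)) \<and>
        (\<exists>g \<in> Hom C S Q. f = Comp C S Q P h g)"
    by blast
  then have "\<forall>i \<in> I. T i \<in> compact_objects \<J> \<alpha> C \<and> t i \<in> Hom C (T i) (X i)"
    using sub by blast
  with * show "\<exists>T t Q \<kappa>. (\<forall>i \<in> I. T i \<in> compact_objects \<J> \<alpha> C \<and> t i \<in> Hom C (T i) (X i)) \<and>
      is_coproduct C I T Q \<kappa> \<and>
      (\<exists>h \<in> Hom C Q P.
        (\<forall>i \<in> I. Comp C (T i) Q P h (\<kappa> i) = Comp C (T i) (X i) P (\<iota> i) (t i)) \<and>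
        (\<exists>g \<in> Hom C S Q. f = Comp C S Q P h g))"
    by blast
qed

lemma compact_objects_maximal:
  assumes "\<forall>S \<in> A. alpha_small \<J> \<alpha> C S" and "coproduct_factoring \<J> C A"
  shows "A \<subseteq> compact_objects \<J> \<alpha> C"
  using assms unfolding compact_objects_def by blast

definition compact_part :: "'i set set \<Rightarrow> 'a rel \<Rightarrow> ('o, 'm) cat \<Rightarrow> ('o, 'm) cat" where
  "compact_part \<J> \<alpha> C = full_subcat C (compact_objects \<J> \<alpha> C)"

text \<open>
  The type \<open>'u\<close> plays the role of a universe: the small sets are the subsets of \<open>'u\<close> of cardinality
  less than that of \<open>'u\<close>.  If the cardinal of \<open>'u\<close> is strongly inaccessible, they
  are, up to bijection, the elements of a Grothendieck universe.  For the constructions used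
  here (small coproducts, free modules, mapping cones) it is enough that this cardinal is regular,
  uncountable and greater than the cardinal of the base ring.
\<close>

definition small_sets :: "'u set set" where
  "small_sets = {A. |A| <o |UNIV :: 'u set| }"

text \<open>
  As in the library's modules over commutative rings, the multiplicative fields inherited from
  \<open>ring\<close> are ignored; only the additive part is used.
\<close>

record ('r, 'u) rmodule = "'u ring" +
  ract :: "'u \<Rightarrow> 'r \<Rightarrow> 'u"

definition right_module :: "('r, 'b) ring_scheme \<Rightarrow> ('r, 'u) rmodule \<Rightarrow> bool" where
  "right_module R M \<longleftrightarrow> ring R \<and> abelian_group M \<and>
     (\<forall>x \<in> carrier M. \<forall>r \<in> carrier R. ract M x r \<in> carrier M) \<and>
     (\<forall>x \<in> carrier M. \<forall>y \<in> carrier M. \<forall>r \<in> carrier R.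
        ract M (x \<oplus>\<^bsub>M\<^esub> y) r = ract M x r \<oplus>\<^bsub>M\<^esub> ract M y r) \<and>
     (\<forall>x \<in> carrier M. \<forall>r \<in> carrier R. \<forall>s \<in> carrier R.
        ract M x (r \<oplus>\<^bsub>R\<^esub> s) = ract M x r \<oplus>\<^bsub>M\<^esub> ract M x s) \<and>
     (\<forall>x \<in> carrier M. \<forall>r \<in> carrier R. \<forall>s \<in> carrier R.
        ract M x (r \<otimes>\<^bsub>R\<^esub> s) = ract M (ract M x r) s) \<and>
     (\<forall>x \<in> carrier M. ract M x \<one>\<^bsub>R\<^esub> = x)"

definition small_right_module :: "('r, 'b) ring_scheme \<Rightarrow> ('r, 'u) rmodule \<Rightarrow> bool" where
  "small_right_module R M \<longleftrightarrow> right_module R M \<and> carrier M \<in> small_sets"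

definition rhom ::
  "('r, 'b) ring_scheme \<Rightarrow> ('r, 'u) rmodule \<Rightarrow> ('r, 'u) rmodule \<Rightarrow> ('u \<Rightarrow> 'u) set" where
  "rhom R M N = {f \<in> carrier M \<rightarrow>\<^sub>E carrier N.
     (\<forall>x \<in> carrier M. \<forall>y \<in> carrier M. f (x \<oplus>\<^bsub>M\<^esub> y) = f x \<oplus>\<^bsub>N\<^esub> f y) \<and>
     (\<forall>x \<in> carrier M. \<forall>r \<in> carrier R. f (ract M x r) = ract N (f x) r)}"

definition projective :: "('r, 'b) ring_scheme \<Rightarrow> ('r, 'u) rmodule \<Rightarrow> bool" where
  "projective R P \<longleftrightarrow> small_right_module R P \<and>
     (\<forall>A B. small_right_module R A \<and> small_right_module R B \<longrightarrow>
        (\<forall>g \<in> rhom R A B. \<forall>f \<in> rhom R P B. g ` carrier A = carrier B \<longrightarrow>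
           (\<exists>h \<in> rhom R P A. \<forall>x \<in> carrier P. g (h x) = f x)))"

record ('r, 'u) chain_complex =
  cmodule :: "int \<Rightarrow> ('r, 'u) rmodule"
  cdiff :: "int \<Rightarrow> 'u \<Rightarrow> 'u"

definition projective_complexes :: "('r, 'b) ring_scheme \<Rightarrow> ('r, 'u) chain_complex set" where
  "projective_complexes R = {X. \<forall>n. projective R (cmodule X n) \<and>
     cdiff X n \<in> rhom R (cmodule X n) (cmodule X (n + 1)) \<and>
     (\<forall>x \<in> carrier (cmodule X n). cdiff X (n + 1) (cdiff X n x) = \<zero>\<^bsub>cmodule X (n + 1 + 1)\<^esub>)}"

type_synonym 'u graded_map = "int \<Rightarrow> 'u \<Rightarrow> 'u"

definition chain_maps ::
  "('r, 'b) ring_scheme \<Rightarrow> ('r, 'u) chain_complex \<Rightarrow> ('r, 'u) chain_complex \<Rightarrow> 'u graded_map set" where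
  "chain_maps R X Y = {f. \<forall>n. f n \<in> rhom R (cmodule X n) (cmodule Y n) \<and>
     (\<forall>x \<in> carrier (cmodule X n). f (n + 1) (cdiff X n x) = cdiff Y n (f n x))}"

definition homotopy_rel ::
  "('r, 'b) ring_scheme \<Rightarrow> ('r, 'u) chain_complex \<Rightarrow> ('r, 'u) chain_complex \<Rightarrow> 'u graded_map rel" where
  "homotopy_rel R X Y = {(f, g). f \<in> chain_maps R X Y \<and> g \<in> chain_maps R X Y \<and>
     (\<exists>s. (\<forall>n. s n \<in> rhom R (cmodule X n) (cmodule Y (n - 1))) \<and>
       (\<forall>n. \<forall>x \<in> carrier (cmodule X n).
          f n x \<ominus>\<^bsub>cmodule Y n\<^esub> g n x =
            cdiff Y (n - 1) (s n x) \<oplus>\<^bsub>cmodule Y n\<^esub> s (n + 1) (cdiff X n x)))}"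

definition chain_comp ::
  "('r, 'u) chain_complex \<Rightarrow> 'u graded_map \<Rightarrow> 'u graded_map \<Rightarrow> 'u graded_map" where
  "chain_comp X g f = (\<lambda>n. compose (carrier (cmodule X n)) (g n) (f n))"

definition chain_id :: "('r, 'u) chain_complex \<Rightarrow> 'u graded_map" where
  "chain_id X = (\<lambda>n. \<lambda>x \<in> carrier (cmodule X n). x)"

text \<open>
  Morphisms are homotopy classes of chain maps; a composite of classes is the class of the
  composites of representatives.
\<close>

definition K_Proj :: "('r, 'b) ring_scheme \<Rightarrow> (('r, 'u) chain_complex, 'u graded_map set) cat" where
  "K_Proj R = \<lparr>
     Obj = projective_complexes R,
     Hom = (\<lambda>X Y. chain_maps R X Y // homotopy_rel R X Y),
     Comp = (\<lambda>X Y Z G F. homotopy_rel R X Z `` {chain_comp X g f | g f. g \<in> G \<and> f \<in> F}),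
     Id = (\<lambda>X. homotopy_rel R X X `` {chain_id X})\<rparr>"

abbreviation aleph1 :: "nat set rel" where
  "aleph1 \<equiv> cardSuc natLeq"

definition continuum_hypothesis :: bool where
  "continuum_hypothesis \<longleftrightarrow> |UNIV :: nat set set| =o aleph1"

end

theory Submission
  imports Defs "HOL-Library.Countable_Set"
begin

text \<open>
  Under the continuum hypothesis there are, up to isomorphism, only \<open>\<aleph>\<^sub>1\<close> complexes of free modules of countable rank over \<open>R\<close> and
  only \<open>\<aleph>\<^sub>1\<close> chain maps between them, because each is given by countably many elements of \<open>R\<close> and
  \<open>\<aleph>\<^sub>1\<close> to the power \<open>\<aleph>\<^sub>0\<close> is \<open>\<aleph>\<^sub>1\<close>.  So it suffices that every \<open>\<aleph>\<^sub>1\<close>-compact object \<open>X\<close> is a retract in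
  \<open>K(Proj-R)\<close> of such a complex (\<open>countable_retract\<close>).  A retract is determined up to isomorphism by the
  idempotent on the ambient complex, and the maps between two retracts embed into the maps between
  the ambient complexes (\<open>retracts_isomorphic\<close>, \<open>retract_maps_eq\<close>), which gives the bound.

  To find the countable complex, let a \<^emph>\<open>based\<close> complex be a complex of free modules with chosen bases.
  Since a differential sends a basis element to a finite sum, every countable set of basis elements
  lies in a countable set that spans a subcomplex.  The aim is to embed \<open>X\<close> as a retract into a based
  complex \<open>T\<close> for which every map \<open>X \<rightarrow> T\<close> is homotopic to a map into a countable part of the basis;
  applied to the embedding of \<open>X\<close>, this makes \<open>X\<close> a retract of a countable complex.  Call a complex with this
  property for all compact \<open>X\<close> \<^emph>\<open>compressible\<close>.

  Compressibility passes to coproducts (\<open>compressible_coproduct\<close>): a map from \<open>X\<close> into a coproduct factors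
  through a coproduct of maps from compact objects, each of these is compressed separately, and \<open>X\<close>,
  being \<open>\<aleph>\<^sub>1\<close>-small, needs only countably many of the countable pieces.  In a form that is stable under
  countable quotients it also passes to extensions (\<open>hcompressible_extension\<close>), because homotopies lift
  along quotients that split along the basis.  Hence every complex with a finite filtration whose
  layers are coproducts of countable complexes is compressible, and so is every extension of two
  coproducts of such complexes.

  It remains to exhibit \<open>X\<close> as a retract of a complex of that last kind.  This is done in three steps.
  A complex of projectives is a retract of a based complex \<open>F\<close> (\<open>projective_complex_retract\<close>).  The
  countable subcomplexes of \<open>F\<close> cover it, and \<open>F\<close> is a retract of its Cech resolution \<open>Z\<close> with respect to
  a cover indexed by the basis itself; the length of the index list filters \<open>Z\<close> with layers that are
  coproducts of countable complexes, and the contraction of the augmented resolution exists because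
  the indices can be well-ordered.  Finally \<open>Z\<close>, an increasing union of its filtration stages \<open>Z\<^sub>k\<close>, is a
  retract of the mapping telescope, which is an extension of \<open>\<Coprod>\<^sub>k Z\<^sub>k\<close> by its shift.  The
  basis of each of these complexes consists of finite tuples over a countable set and the basis of \<open>F\<close>, so they all stay in the universe.
\<close>

section \<open>Linear maps and free modules\<close>

text \<open>
  Unlike \<open>rhom\<close>, the source and target may have different carrier types and values outside the carrier
  are not constrained, so that maps can be composed as plain functions.
\<close>

definition linear :: "('r, 'b) ring_scheme \<Rightarrow> ('r, 'm) rmodule \<Rightarrow> ('r, 'n) rmodule \<Rightarrow> ('m \<Rightarrow> 'n) \<Rightarrow> bool" where
  "linear R M N f \<longleftrightarrow> f \<in> carrier M \<rightarrow> carrier N \<and>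
     (\<forall>x \<in> carrier M. \<forall>y \<in> carrier M. f (x \<oplus>\<^bsub>M\<^esub> y) = f x \<oplus>\<^bsub>N\<^esub> f y) \<and>
     (\<forall>x \<in> carrier M. \<forall>r \<in> carrier R. f (ract M x r) = ract N (f x) r)"

lemma linearI:
  assumes "\<And>x. x \<in> carrier M \<Longrightarrow> f x \<in> carrier N"
    and "\<And>x y. x \<in> carrier M \<Longrightarrow> y \<in> carrier M \<Longrightarrow> f (x \<oplus>\<^bsub>M\<^esub> y) = f x \<oplus>\<^bsub>N\<^esub> f y"
    and "\<And>x r. x \<in> carrier M \<Longrightarrow> r \<in> carrier R \<Longrightarrow> f (ract M x r) = ract N (f x) r"
  shows "linear R M N f"
  using assms unfolding linear_def by auto

lemma lin_closed: "linear R M N f \<Longrightarrow> x \<in> carrier M \<Longrightarrow> f x \<in> carrier N"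
  unfolding linear_def by auto

lemma lin_add: "linear R M N f \<Longrightarrow> x \<in> carrier M \<Longrightarrow> y \<in> carrier M \<Longrightarrow> f (x \<oplus>\<^bsub>M\<^esub> y) = f x \<oplus>\<^bsub>N\<^esub> f y"
  unfolding linear_def by auto

lemma lin_ract: "linear R M N f \<Longrightarrow> x \<in> carrier M \<Longrightarrow> r \<in> carrier R \<Longrightarrow> f (ract M x r) = ract N (f x) r"
  unfolding linear_def by auto

lemma rhom_iff_lin: "f \<in> rhom R M N \<longleftrightarrow> linear R M N f \<and> f \<in> extensional (carrier M)"
  unfolding rhom_def linear_def PiE_def by auto

lemma right_module_abelian: "right_module R M \<Longrightarrow> abelian_group M"
  by (simp add: right_module_def)

lemma right_module_ract_closed:
  "right_module R M \<Longrightarrow> x \<in> carrier M \<Longrightarrow> r \<in> carrier R \<Longrightarrow> ract M x r \<in> carrier M"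
  by (simp add: right_module_def)

lemma right_module_ract_add:
  "right_module R M \<Longrightarrow> x \<in> carrier M \<Longrightarrow> y \<in> carrier M \<Longrightarrow> r \<in> carrier R \<Longrightarrow>
    ract M (x \<oplus>\<^bsub>M\<^esub> y) r = ract M x r \<oplus>\<^bsub>M\<^esub> ract M y r"
  by (simp add: right_module_def)

lemma lin_cong:
  assumes "right_module R M" and "linear R M N f" and "\<And>x. x \<in> carrier M \<Longrightarrow> g x = f x"
  shows "linear R M N g"
proof -
  interpret M: abelian_group M using assms(1) by (rule right_module_abelian)
  show ?thesis
    by (rule linearI) (use assms in \<open>auto simp: lin_closed lin_add lin_ract right_module_ract_closed\<close>)
qed

lemma lin_comp: "linear R M N f \<Longrightarrow> linear R N P g \<Longrightarrow> linear R M P (\<lambda>x. g (f x))"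
  unfolding linear_def Pi_iff by simp

lemma lin_zero:
  assumes "right_module R M" "right_module R N" "linear R M N f"
  shows "f \<zero>\<^bsub>M\<^esub> = \<zero>\<^bsub>N\<^esub>"
proof -
  interpret M: abelian_group M using assms(1) by (rule right_module_abelian)
  interpret N: abelian_group N using assms(2) by (rule right_module_abelian)
  have "f \<zero>\<^bsub>M\<^esub> \<oplus>\<^bsub>N\<^esub> f \<zero>\<^bsub>M\<^esub> = f \<zero>\<^bsub>M\<^esub>"
    using lin_add[OF assms(3), of "\<zero>\<^bsub>M\<^esub>" "\<zero>\<^bsub>M\<^esub>"] by simp
  then show ?thesis using lin_closed[OF assms(3), of "\<zero>\<^bsub>M\<^esub>"]
    by (metis M.zero_closed N.add.r_cancel_one')
qed

lemma lin_uminus: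
  assumes "right_module R M" "right_module R N" "linear R M N f" "x \<in> carrier M"
  shows "f (\<ominus>\<^bsub>M\<^esub> x) = \<ominus>\<^bsub>N\<^esub> f x"
proof -
  interpret M: abelian_group M using assms(1) by (rule right_module_abelian)
  interpret N: abelian_group N using assms(2) by (rule right_module_abelian)
  have "f (\<ominus>\<^bsub>M\<^esub> x) \<oplus>\<^bsub>N\<^esub> f x = \<zero>\<^bsub>N\<^esub>"
    using lin_add[OF assms(3), of "\<ominus>\<^bsub>M\<^esub> x" x] lin_zero[OF assms(1-3)] assms(4)
    by (simp add: M.l_neg)
  then show ?thesis using lin_closed[OF assms(3)] assms(4)
    by (metis M.a_inv_closed N.minus_equality)
qed

lemma ract_zero:
  assumes "right_module R M" "r \<in> carrier R" shows "ract M \<zero>\<^bsub>M\<^esub> r = \<zero>\<^bsub>M\<^esub>"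
proof -
  interpret M: abelian_group M using assms(1) by (rule right_module_abelian)
  have "ract M \<zero>\<^bsub>M\<^esub> r \<oplus>\<^bsub>M\<^esub> ract M \<zero>\<^bsub>M\<^esub> r = ract M \<zero>\<^bsub>M\<^esub> r"
    using right_module_ract_add[OF assms(1), of "\<zero>\<^bsub>M\<^esub>" "\<zero>\<^bsub>M\<^esub>" r] assms(2) by simp
  then show ?thesis
    by (metis M.add.r_cancel_one' M.zero_closed assms right_module_ract_closed)
qed

lemma ract_neg:
  assumes "right_module R M" "r \<in> carrier R" "x \<in> carrier M"
  shows "ract M (\<ominus>\<^bsub>M\<^esub> x) r = \<ominus>\<^bsub>M\<^esub> ract M x r"
proof -
  interpret M: abelian_group M using assms(1) by (rule right_module_abelian)
  have "ract M (\<ominus>\<^bsub>M\<^esub> x) r \<oplus>\<^bsub>M\<^esub> ract M x r = \<zero>\<^bsub>M\<^esub>"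
    using right_module_ract_add[OF assms(1), of "\<ominus>\<^bsub>M\<^esub> x" x r] assms
    by (simp add: M.l_neg ract_zero)
  then show ?thesis
    by (metis M.a_inv_closed M.minus_equality assms right_module_ract_closed)
qed

lemma ract_zero_right:
  assumes "right_module R M" "x \<in> carrier M" shows "ract M x \<zero>\<^bsub>R\<^esub> = \<zero>\<^bsub>M\<^esub>"
proof -
  interpret R: ring R using assms(1) by (simp add: right_module_def)
  interpret M: abelian_group M using assms(1) by (rule right_module_abelian)
  have "ract M x (\<zero>\<^bsub>R\<^esub> \<oplus>\<^bsub>R\<^esub> \<zero>\<^bsub>R\<^esub>) = ract M x \<zero>\<^bsub>R\<^esub> \<oplus>\<^bsub>M\<^esub> ract M x \<zero>\<^bsub>R\<^esub>"
    using assms unfolding right_module_def by blast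
  then show ?thesis
    by (metis M.add.r_cancel_one' R.r_zero R.zero_closed assms right_module_ract_closed)
qed

lemma lin_plus:
  assumes "right_module R N" "linear R M N f" "linear R M N g"
  shows "linear R M N (\<lambda>x. f x \<oplus>\<^bsub>N\<^esub> g x)"
proof -
  interpret N: abelian_group N using assms(1) by (rule right_module_abelian)
  show ?thesis
    by (rule linearI) (use assms in \<open>auto simp: lin_closed lin_add lin_ract right_module_ract_add N.a_ac\<close>)
qed

lemma lin_neg:
  assumes "right_module R N" "linear R M N f"
  shows "linear R M N (\<lambda>x. \<ominus>\<^bsub>N\<^esub> f x)"
proof -
  interpret N: abelian_group N using assms(1) by (rule right_module_abelian)
  show ?thesis
    by (rule linearI) (use assms in \<open>auto simp: lin_closed lin_add lin_ract ract_neg N.minus_add\<close>)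
qed

lemma lin_const_zero:
  assumes "right_module R N" shows "linear R M N (\<lambda>x. \<zero>\<^bsub>N\<^esub>)"
proof -
  interpret N: abelian_group N using assms(1) by (rule right_module_abelian)
  show ?thesis by (rule linearI) (use assms in \<open>auto simp: ract_zero\<close>)
qed

lemma ract_finsum:
  assumes N: "right_module R N" and r: "r \<in> carrier R" and "finite S" "g \<in> S \<rightarrow> carrier N"
  shows "finsum N (\<lambda>i. ract N (g i) r) S = ract N (finsum N g S) r"
proof -
  interpret N: abelian_group N using N by (rule right_module_abelian)
  show ?thesis using assms(3,4)
  proof (induction S rule: finite_induct)
    case empty
    then show ?case using ract_zero[OF N r] by simp
  next
    case (insert i S)
    then have g: "g i \<in> carrier N" "g \<in> S \<rightarrow> carrier N" by auto
    then have "(\<lambda>i. ract N (g i) r) \<in> S \<rightarrow> carrier N" "ract N (g i) r \<in> carrier N"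
      using right_module_ract_closed[OF N] r by auto
    then show ?case using insert g r right_module_ract_add[OF N, of "g i" "finsum N g S" r] by simp
  qed
qed

definition support :: "('r, 'b) ring_scheme \<Rightarrow> ('k \<Rightarrow> 'r) \<Rightarrow> 'k set" where
  "support R x = {b. x b \<noteq> \<zero>\<^bsub>R\<^esub>}"

definition fadd :: "('r, 'b) ring_scheme \<Rightarrow> ('k \<Rightarrow> 'r) \<Rightarrow> ('k \<Rightarrow> 'r) \<Rightarrow> 'k \<Rightarrow> 'r" where
  "fadd R x y = (\<lambda>b. x b \<oplus>\<^bsub>R\<^esub> y b)"

definition fneg :: "('r, 'b) ring_scheme \<Rightarrow> ('k \<Rightarrow> 'r) \<Rightarrow> 'k \<Rightarrow> 'r" where
  "fneg R x = (\<lambda>b. \<ominus>\<^bsub>R\<^esub> x b)"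

definition fzero :: "('r, 'b) ring_scheme \<Rightarrow> 'k \<Rightarrow> 'r" where
  "fzero R = (\<lambda>b. \<zero>\<^bsub>R\<^esub>)"

definition fract :: "('r, 'b) ring_scheme \<Rightarrow> ('k \<Rightarrow> 'r) \<Rightarrow> 'r \<Rightarrow> 'k \<Rightarrow> 'r" where
  "fract R x r = (\<lambda>b. x b \<otimes>\<^bsub>R\<^esub> r)"

text \<open>
  The free right module on the basis \<open>E\<close>, as finitely supported functions from the type of basis elements to \<open>R\<close>.
  For \<open>E' \<subseteq> E\<close> the module on \<open>E'\<close> is a submodule of the one on \<open>E\<close> with literally the same elements.
\<close>

definition free_mod :: "('r, 'b) ring_scheme \<Rightarrow> 'k set \<Rightarrow> ('r, 'k \<Rightarrow> 'r) rmodule" where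
  "free_mod R E = \<lparr>carrier = {x. x \<in> UNIV \<rightarrow> carrier R \<and> finite (support R x) \<and> support R x \<subseteq> E},
     mult = undefined, one = undefined, zero = fzero R, add = fadd R, ract = fract R\<rparr>"

abbreviation finsupp :: "('r, 'b) ring_scheme \<Rightarrow> 'k set \<Rightarrow> ('k \<Rightarrow> 'r) set" where
  "finsupp R E \<equiv> carrier (free_mod R E)"

definition basis_vec :: "('r, 'b) ring_scheme \<Rightarrow> 'k \<Rightarrow> 'k \<Rightarrow> 'r" where
  "basis_vec R b = (\<lambda>c. if c = b then \<one>\<^bsub>R\<^esub> else \<zero>\<^bsub>R\<^esub>)"

definition res :: "('r, 'b) ring_scheme \<Rightarrow> 'k set \<Rightarrow> ('k \<Rightarrow> 'r) \<Rightarrow> 'k \<Rightarrow> 'r" where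
  "res R E x = (\<lambda>b. if b \<in> E then x b else \<zero>\<^bsub>R\<^esub>)"

text \<open>
  The linear map that extends \<open>\<phi>\<close> from the basis.  The target \<open>N\<close> occurs because \<open>finsum\<close> depends on the carrier of the
  module; for maps between free modules the sum is always formed in the module on all basis elements.
\<close>

definition lift :: "('r, 'b) ring_scheme \<Rightarrow> ('r, 'm) rmodule \<Rightarrow> ('k \<Rightarrow> 'm) \<Rightarrow> ('k \<Rightarrow> 'r) \<Rightarrow> 'm" where
  "lift R N \<phi> x = finsum N (\<lambda>b. ract N (\<phi> b) (x b)) (support R x)"

abbreviation flift :: "('r, 'b) ring_scheme \<Rightarrow> ('k \<Rightarrow> 'l \<Rightarrow> 'r) \<Rightarrow> ('k \<Rightarrow> 'r) \<Rightarrow> 'l \<Rightarrow> 'r" where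
  "flift R \<equiv> lift R (free_mod R UNIV)"

lemma free_mod_simps [simp]:
  "zero (free_mod R E) = fzero R" "add (free_mod R E) = fadd R" "ract (free_mod R E) = fract R"
  by (simp_all add: free_mod_def)

lemma finsupp_iff: "x \<in> finsupp R E \<longleftrightarrow> (\<forall>b. x b \<in> carrier R) \<and> finite (support R x) \<and> support R x \<subseteq> E"
  by (auto simp: free_mod_def)

lemma finsupp_mono: "E \<subseteq> E' \<Longrightarrow> finsupp R E \<subseteq> finsupp R E'"
  unfolding finsupp_iff subset_iff by blast

lemma finsupp_monoD: "x \<in> finsupp R E \<Longrightarrow> E \<subseteq> E' \<Longrightarrow> x \<in> finsupp R E'"
  using finsupp_mono by blast

lemma finsupp_subset_supp: "x \<in> finsupp R E \<Longrightarrow> x \<in> finsupp R (support R x)"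
  by (auto simp: finsupp_iff)

lemma finsupp_coeff: "x \<in> finsupp R E \<Longrightarrow> x b \<in> carrier R"
  by (auto simp: finsupp_iff)

lemma finsupp_outside: "x \<in> finsupp R E \<Longrightarrow> b \<notin> E \<Longrightarrow> x b = \<zero>\<^bsub>R\<^esub>"
  by (auto simp: finsupp_iff support_def)

lemma finsuppI:
  assumes "x \<in> finsupp R E" and "\<And>b. b \<notin> E' \<Longrightarrow> x b = \<zero>\<^bsub>R\<^esub>" shows "x \<in> finsupp R E'"
  using assms by (auto simp: finsupp_iff support_def)

lemma finsupp_Int: "x \<in> finsupp R E \<Longrightarrow> x \<in> finsupp R E' \<Longrightarrow> x \<in> finsupp R (E \<inter> E')"
  by (auto simp: finsupp_iff)

context ring
begin

lemma fzero_closed [simp]: "fzero R \<in> finsupp R E"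
  by (auto simp: finsupp_iff fzero_def support_def)

lemma fadd_closed [simp]:
  assumes "x \<in> finsupp R E" "y \<in> finsupp R E" shows "fadd R x y \<in> finsupp R E"
proof -
  have "support R (fadd R x y) \<subseteq> support R x \<union> support R y"
    by (auto simp: support_def fadd_def)
  then show ?thesis using assms unfolding finsupp_iff
    by (auto simp: fadd_def intro: finite_subset)
qed

lemma fneg_closed [simp]:
  assumes "x \<in> finsupp R E" shows "fneg R x \<in> finsupp R E"
proof -
  have "support R (fneg R x) \<subseteq> support R x"
    by (auto simp: support_def fneg_def)
  then show ?thesis using assms unfolding finsupp_iff
    by (auto simp: fneg_def intro: finite_subset)
qed

lemma fract_closed [simp]:
  assumes "x \<in> finsupp R E" "r \<in> carrier R" shows "fract R x r \<in> finsupp R E"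
proof -
  have "support R (fract R x r) \<subseteq> support R x"
    using assms(2) by (auto simp: support_def fract_def)
  then show ?thesis using assms unfolding finsupp_iff
    by (auto simp: fract_def intro: finite_subset)
qed

lemma basis_vec_closed [simp]: "b \<in> E \<Longrightarrow> basis_vec R b \<in> finsupp R E"
  by (auto simp: finsupp_iff basis_vec_def support_def intro: finite_subset[of _ "{b}"])

lemma res_closed:
  assumes "x \<in> finsupp R E'" shows "res R E x \<in> finsupp R (E \<inter> E')"
proof -
  have "support R (res R E x) \<subseteq> support R x \<inter> E"
    by (auto simp: support_def res_def)
  then show ?thesis using assms unfolding finsupp_iff
    by (auto simp: res_def intro: finite_subset)
qed

lemma res_closed' [simp]: "x \<in> finsupp R E' \<Longrightarrow> res R E x \<in> finsupp R E"
  using res_closed[of x E' E] finsupp_mono[of "E \<inter> E'" E] by auto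

lemma res_ident: "x \<in> finsupp R E \<Longrightarrow> res R E x = x"
  unfolding res_def by (rule ext) (metis finsupp_outside)

lemma free_mod_group: "abelian_group (free_mod R E)"
proof (rule abelian_groupI)
  fix x assume x: "x \<in> finsupp R E"
  show "\<exists>y\<in>finsupp R E. y \<oplus>\<^bsub>free_mod R E\<^esub> x = \<zero>\<^bsub>free_mod R E\<^esub>"
  proof (rule bexI)
    show "fneg R x \<oplus>\<^bsub>free_mod R E\<^esub> x = \<zero>\<^bsub>free_mod R E\<^esub>"
      using x by (auto simp: fadd_def fneg_def fzero_def l_neg finsupp_coeff)
    show "fneg R x \<in> finsupp R E" using x by simp
  qed
next
  fix x y z assume "x \<in> finsupp R E" "y \<in> finsupp R E" "z \<in> finsupp R E"
  then show "x \<oplus>\<^bsub>free_mod R E\<^esub> y \<oplus>\<^bsub>free_mod R E\<^esub> z = x \<oplus>\<^bsub>free_mod R E\<^esub> (y \<oplus>\<^bsub>free_mod R E\<^esub> z)"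
    by (auto simp: fadd_def a_assoc finsupp_coeff)
next
  fix x y assume "x \<in> finsupp R E" "y \<in> finsupp R E"
  then show "x \<oplus>\<^bsub>free_mod R E\<^esub> y = y \<oplus>\<^bsub>free_mod R E\<^esub> x"
    by (auto simp: fadd_def a_comm finsupp_coeff)
next
  fix x assume "x \<in> finsupp R E"
  then show "\<zero>\<^bsub>free_mod R E\<^esub> \<oplus>\<^bsub>free_mod R E\<^esub> x = x"
    by (auto simp: fadd_def fzero_def finsupp_coeff)
qed simp_all

lemma free_mod_minus [simp]: "x \<in> finsupp R E \<Longrightarrow> a_inv (free_mod R E) x = fneg R x"
proof -
  interpret M: abelian_group "free_mod R E" by (rule free_mod_group)
  assume x: "x \<in> finsupp R E"
  have "fneg R x \<oplus>\<^bsub>free_mod R E\<^esub> x = \<zero>\<^bsub>free_mod R E\<^esub>"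
    using x by (auto simp: fadd_def fneg_def fzero_def l_neg finsupp_coeff)
  then show ?thesis using x fneg_closed[OF x] by (intro M.minus_equality) simp_all
qed

lemma free_mod_module: "right_module R (free_mod R E)"
  unfolding right_module_def
proof (intro conjI ballI ring_axioms free_mod_group)
  fix x r assume "x \<in> finsupp R E" "r \<in> carrier R"
  then show "ract (free_mod R E) x r \<in> finsupp R E" by simp
qed (auto simp: fract_def fadd_def fun_eq_iff l_distr r_distr m_assoc finsupp_coeff)

text \<open>
  Induction over the number of basis elements in the support.  It yields uniqueness of linear maps
  with given values on the basis, and bounds on the range of a linear map.
\<close>

lemma free_mod_induct [consumes 1, case_names zero base add]:
  assumes "x \<in> finsupp R E"
    and "P (fzero R)"
    and "\<And>b r. b \<in> E \<Longrightarrow> r \<in> carrier R \<Longrightarrow> P (fract R (basis_vec R b) r)"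
    and "\<And>x y. x \<in> finsupp R E \<Longrightarrow> y \<in> finsupp R E \<Longrightarrow> P x \<Longrightarrow> P y \<Longrightarrow> P (fadd R x y)"
  shows "P x"
proof -
  have "finite S \<Longrightarrow> x \<in> finsupp R E \<Longrightarrow> support R x \<subseteq> S \<Longrightarrow> P x" for S x
  proof (induction S arbitrary: x rule: finite_induct)
    case empty
    then have "x = fzero R" by (auto simp: support_def fzero_def)
    then show ?case using assms(2) by simp
  next
    case (insert b S)
    show ?case
    proof (cases "x b = \<zero>")
      case True
      then have "support R x \<subseteq> S" using insert.prems by (auto simp: support_def)
      then show ?thesis using insert by blast
    next
      case False
      then have b: "b \<in> E" using insert.prems(1) finsupp_outside by metis
      define y where "y = res R (- {b}) x"
      have y: "y \<in> finsupp R E"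
        unfolding y_def using insert.prems(1) by (rule finsupp_monoD[OF res_closed]) auto
      have "support R y \<subseteq> S" using insert.prems(2) by (auto simp: y_def res_def support_def)
      then have Py: "P y" using insert.IH y by blast
      have xb: "x b \<in> carrier R" using insert.prems(1) finsupp_coeff by metis
      have "x = fadd R y (fract R (basis_vec R b) (x b))"
        using insert.prems(1) by (auto simp: y_def fadd_def fract_def basis_vec_def res_def finsupp_coeff)
      moreover have "P (fadd R y (fract R (basis_vec R b) (x b)))"
        using Py assms(3)[OF b xb] y b xb by (intro assms(4)) auto
      ultimately show ?thesis by simp
    qed
  qed
  then show ?thesis using assms(1) by (auto simp: finsupp_iff)
qed

lemma lin_ext:
  assumes "right_module R N" "linear R (free_mod R E) N f" "linear R (free_mod R E) N g"
    and "\<And>b. b \<in> E \<Longrightarrow> f (basis_vec R b) = g (basis_vec R b)" and "x \<in> finsupp R E"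
  shows "f x = g x"
  using assms(5)
proof (induction x rule: free_mod_induct)
  case zero
  then show ?case using lin_zero[OF free_mod_module assms(1) assms(2)] lin_zero[OF free_mod_module assms(1) assms(3)]
    by simp
next
  case (base b r)
  then show ?case using lin_ract[OF assms(2), of "basis_vec R b" r] lin_ract[OF assms(3), of "basis_vec R b" r]
    by (simp add: assms(4))
next
  case (add x y)
  then show ?case using lin_add[OF assms(2), of x y] lin_add[OF assms(3), of x y] by simp
qed

lemma lin_range:
  assumes "linear R (free_mod R E) (free_mod R E') f" and "\<And>b. b \<in> E \<Longrightarrow> f (basis_vec R b) \<in> finsupp R E''"
  shows "linear R (free_mod R E) (free_mod R E'') f"
proof -
  have "f x \<in> finsupp R E''" if "x \<in> finsupp R E" for x
    using that
  proof (induction x rule: free_mod_induct)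
    case zero
    then show ?case using lin_zero[OF free_mod_module free_mod_module assms(1)] by simp
  next
    case (base b r)
    then show ?case using lin_ract[OF assms(1), of "basis_vec R b" r] assms(2) by simp
  next
    case (add x y)
    then show ?case using lin_add[OF assms(1), of x y] by simp
  qed
  then show ?thesis using assms(1) unfolding linear_def by auto
qed

lemma lin_sub: "linear R (free_mod R E) N f \<Longrightarrow> E' \<subseteq> E \<Longrightarrow> linear R (free_mod R E') N f"
  unfolding linear_def using finsupp_mono[of E' E R] by (auto simp: subset_iff Pi_iff)

lemma lin_weaken: "linear R M (free_mod R E) f \<Longrightarrow> E \<subseteq> E' \<Longrightarrow> linear R M (free_mod R E') f"
  unfolding linear_def using finsupp_mono[of E E' R] by (auto simp: subset_iff Pi_iff)

lemma lin_strengthen: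
  "linear R M (free_mod R E) f \<Longrightarrow> (\<And>x. x \<in> carrier M \<Longrightarrow> f x \<in> finsupp R E') \<Longrightarrow> linear R M (free_mod R E') f"
  unfolding linear_def by auto

lemma lin_res: "linear R (free_mod R E) (free_mod R (E \<inter> E')) (res R E')"
proof (rule linearI)
  fix x r assume "x \<in> finsupp R E" "r \<in> carrier R"
  then show "res R E' (ract (free_mod R E) x r) = ract (free_mod R (E \<inter> E')) (res R E' x) r"
    by (auto simp: res_def fract_def)
next
  fix x y assume "x \<in> finsupp R E" "y \<in> finsupp R E"
  then show "res R E' (x \<oplus>\<^bsub>free_mod R E\<^esub> y) = res R E' x \<oplus>\<^bsub>free_mod R (E \<inter> E')\<^esub> res R E' y"
    by (auto simp: res_def fadd_def)
next
  fix x assume "x \<in> finsupp R E"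
  then show "res R E' x \<in> finsupp R (E \<inter> E')"
    using res_closed[of x E E'] by (simp add: Int_commute)
qed

text \<open>
  Additivity of \<open>lift\<close> needs sums over a common index set, while the supports of two elements and of their sum differ.
\<close>

lemma lift_superset:
  assumes N: "right_module R N" and x: "x \<in> finsupp R E" and \<phi>: "\<phi> \<in> E \<rightarrow> carrier N"
    and S: "finite S" "support R x \<subseteq> S" "S \<subseteq> E"
  shows "lift R N \<phi> x = finsum N (\<lambda>b. ract N (\<phi> b) (x b)) S"
proof -
  interpret N: abelian_group N using N by (rule right_module_abelian)
  have cl: "ract N (\<phi> b) (x b) \<in> carrier N" if "b \<in> S" for b
    using that x \<phi> S by (intro right_module_ract_closed[OF N]) (auto simp: finsupp_iff)
  show ?thesis unfolding lift_def
  proof (rule N.add.finprod_mono_neutral_cong_left[OF S(1,2)])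
    fix b assume "b \<in> S - support R x"
    then show "ract N (\<phi> b) (x b) = \<zero>\<^bsub>N\<^esub>"
      using \<phi> S ract_zero_right[OF N, of "\<phi> b"] by (auto simp: support_def)
  qed (use cl in auto)
qed

lemma lift_lin:
  assumes N: "right_module R N" and \<phi>: "\<phi> \<in> E \<rightarrow> carrier N"
  shows "linear R (free_mod R E) N (lift R N \<phi>)"
proof -
  interpret N: abelian_group N using N by (rule right_module_abelian)
  have cl: "ract N (\<phi> b) r \<in> carrier N" if "b \<in> E" "r \<in> carrier R" for b r
    using that \<phi> by (intro right_module_ract_closed[OF N]) auto
  show ?thesis
  proof (rule linearI)
    fix x assume x: "x \<in> finsupp R E"
    show "lift R N \<phi> x \<in> carrier N" unfolding lift_def
      using x cl by (intro N.finsum_closed) (auto simp: finsupp_iff)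
  next
    fix x y assume x: "x \<in> finsupp R E" and y: "y \<in> finsupp R E"
    let ?S = "support R x \<union> support R y"
    have S: "finite ?S" "?S \<subseteq> E" using x y by (auto simp: finsupp_iff)
    have xy: "fadd R x y \<in> finsupp R E" using x y by simp
    have "support R (fadd R x y) \<subseteq> ?S" by (auto simp: support_def fadd_def)
    then have "lift R N \<phi> (fadd R x y) = finsum N (\<lambda>b. ract N (\<phi> b) (fadd R x y b)) ?S"
      by (rule lift_superset[OF N xy \<phi> S(1) _ S(2)])
    also have "\<dots> = finsum N (\<lambda>b. ract N (\<phi> b) (x b) \<oplus>\<^bsub>N\<^esub> ract N (\<phi> b) (y b)) ?S"
    proof (rule N.finsum_cong')
      fix b assume "b \<in> ?S"
      then have "\<phi> b \<in> carrier N" "x b \<in> carrier R" "y b \<in> carrier R"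
        using S \<phi> x y by (auto simp: finsupp_iff)
      then show "ract N (\<phi> b) (fadd R x y b) = ract N (\<phi> b) (x b) \<oplus>\<^bsub>N\<^esub> ract N (\<phi> b) (y b)"
        using N unfolding right_module_def fadd_def by blast
    next
      show "(\<lambda>b. ract N (\<phi> b) (x b) \<oplus>\<^bsub>N\<^esub> ract N (\<phi> b) (y b)) \<in> ?S \<rightarrow> carrier N"
        using x y S cl unfolding finsupp_iff by blast
    qed simp
    also have "\<dots> = finsum N (\<lambda>b. ract N (\<phi> b) (x b)) ?S \<oplus>\<^bsub>N\<^esub> finsum N (\<lambda>b. ract N (\<phi> b) (y b)) ?S"
      using x y S cl unfolding finsupp_iff by (intro N.finsum_addf) blast+
    also have "\<dots> = lift R N \<phi> x \<oplus>\<^bsub>N\<^esub> lift R N \<phi> y"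
      using lift_superset[OF N x \<phi> S(1) _ S(2)] lift_superset[OF N y \<phi> S(1) _ S(2)] by simp
    finally show "lift R N \<phi> (x \<oplus>\<^bsub>free_mod R E\<^esub> y) = lift R N \<phi> x \<oplus>\<^bsub>N\<^esub> lift R N \<phi> y" by simp
  next
    fix x r assume x: "x \<in> finsupp R E" and r: "r \<in> carrier R"
    let ?S = "support R x"
    have S: "finite ?S" "?S \<subseteq> E" using x by (auto simp: finsupp_iff)
    have xr: "fract R x r \<in> finsupp R E" using x r by simp
    have "support R (fract R x r) \<subseteq> ?S" using r by (auto simp: support_def fract_def)
    then have "lift R N \<phi> (fract R x r) = finsum N (\<lambda>b. ract N (\<phi> b) (fract R x r b)) ?S"
      by (rule lift_superset[OF N xr \<phi> S(1) _ S(2)])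
    also have "\<dots> = finsum N (\<lambda>b. ract N (ract N (\<phi> b) (x b)) r) ?S"
    proof (rule N.finsum_cong')
      fix b assume "b \<in> ?S"
      then have "\<phi> b \<in> carrier N" "x b \<in> carrier R"
        using S \<phi> x by (auto simp: finsupp_iff)
      then show "ract N (\<phi> b) (fract R x r b) = ract N (ract N (\<phi> b) (x b)) r"
        using N r unfolding right_module_def fract_def by blast
    next
      show "(\<lambda>b. ract N (ract N (\<phi> b) (x b)) r) \<in> ?S \<rightarrow> carrier N"
        using x r S cl right_module_ract_closed[OF N] unfolding finsupp_iff by blast
    qed simp
    also have "\<dots> = ract N (finsum N (\<lambda>b. ract N (\<phi> b) (x b)) ?S) r"
      using x S cl unfolding finsupp_iff by (intro ract_finsum[OF N r S(1)]) blast
    finally show "lift R N \<phi> (ract (free_mod R E) x r) = ract N (lift R N \<phi> x) r"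
      by (simp add: lift_def)
  qed
qed

lemma lift_be:
  assumes N: "right_module R N" and y: "\<phi> b \<in> carrier N"
  shows "lift R N \<phi> (basis_vec R b) = \<phi> b"
proof -
  interpret N: abelian_group N using N by (rule right_module_abelian)
  have "lift R N \<phi> (basis_vec R b) = finsum N (\<lambda>c. ract N (\<phi> c) (basis_vec R b c)) {b}"
    using y by (intro lift_superset[OF N, where E = "{b}"] basis_vec_closed) (auto simp: support_def basis_vec_def)
  also have "\<dots> = \<phi> b"
    using y N by (simp add: basis_vec_def right_module_def)
  finally show ?thesis .
qed

lemma lift_eq:
  assumes N: "right_module R N" and f: "linear R (free_mod R E) N f"
    and "\<And>b. b \<in> E \<Longrightarrow> f (basis_vec R b) = \<phi> b" and x: "x \<in> finsupp R E"
  shows "lift R N \<phi> x = f x"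
proof -
  have \<phi>: "\<phi> b \<in> carrier N" if "b \<in> E" for b
    using that lin_closed[OF f, of "basis_vec R b"] assms(3) by simp
  show ?thesis
  proof (rule lin_ext[OF N lift_lin[OF N] f _ x])
    show "lift R N \<phi> (basis_vec R b) = f (basis_vec R b)" if "b \<in> E" for b
      using that \<phi> assms(3) lift_be[where \<phi> = \<phi> and b = b, OF N] by simp
  qed (use \<phi> in auto)
qed

lemma flift_lin:
  assumes "\<And>b. b \<in> E \<Longrightarrow> \<phi> b \<in> finsupp R E'"
  shows "linear R (free_mod R E) (free_mod R E') (flift R \<phi>)"
proof (rule lin_range)
  show "linear R (free_mod R E) (free_mod R UNIV) (flift R \<phi>)"
    by (rule lift_lin[OF free_mod_module]) (use assms finsupp_monoD[of _ R E' UNIV] in auto)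
  show "flift R \<phi> (basis_vec R b) \<in> finsupp R E'" if "b \<in> E" for b
    using assms[OF that] finsupp_monoD[of "\<phi> b" R E' UNIV] lift_be[OF free_mod_module, of \<phi> b UNIV] by simp
qed

lemma flift_be: "\<phi> b \<in> finsupp R E \<Longrightarrow> flift R \<phi> (basis_vec R b) = \<phi> b"
  by (rule lift_be[OF free_mod_module finsupp_monoD[of _ R E]]) simp_all

end

section \<open>Chain maps up to homotopy\<close>

definition is_complex :: "('r, 'b) ring_scheme \<Rightarrow> ('r, 'm) chain_complex \<Rightarrow> bool" where
  "is_complex R X \<longleftrightarrow> (\<forall>n. right_module R (cmodule X n) \<and>
     linear R (cmodule X n) (cmodule X (n + 1)) (cdiff X n) \<and>
     (\<forall>x \<in> carrier (cmodule X n). cdiff X (n + 1) (cdiff X n x) = \<zero>\<^bsub>cmodule X (n + 1 + 1)\<^esub>))"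

definition chain_map :: "('r, 'b) ring_scheme \<Rightarrow> ('r, 'm) chain_complex \<Rightarrow> ('r, 'n) chain_complex \<Rightarrow>
    (int \<Rightarrow> 'm \<Rightarrow> 'n) \<Rightarrow> bool" where
  "chain_map R X Y f \<longleftrightarrow> (\<forall>n. linear R (cmodule X n) (cmodule Y n) (f n) \<and>
     (\<forall>x \<in> carrier (cmodule X n). f (n + 1) (cdiff X n x) = cdiff Y n (f n x)))"

definition homotopic :: "('r, 'b) ring_scheme \<Rightarrow> ('r, 'm) chain_complex \<Rightarrow> ('r, 'n) chain_complex \<Rightarrow>
    (int \<Rightarrow> 'm \<Rightarrow> 'n) \<Rightarrow> (int \<Rightarrow> 'm \<Rightarrow> 'n) \<Rightarrow> bool" where
  "homotopic R X Y f g \<longleftrightarrow> (\<exists>s. (\<forall>n. linear R (cmodule X n) (cmodule Y (n - 1)) (s n)) \<and>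
     (\<forall>n. \<forall>x \<in> carrier (cmodule X n).
        f n x = g n x \<oplus>\<^bsub>cmodule Y n\<^esub> (cdiff Y (n - 1) (s n x) \<oplus>\<^bsub>cmodule Y n\<^esub> s (n + 1) (cdiff X n x))))"

lemma is_complex_module: "is_complex R X \<Longrightarrow> right_module R (cmodule X n)"
  and is_complex_diff: "is_complex R X \<Longrightarrow> linear R (cmodule X n) (cmodule X (n + 1)) (cdiff X n)"
  and is_complex_sq: "is_complex R X \<Longrightarrow> x \<in> carrier (cmodule X n) \<Longrightarrow>
      cdiff X (n + 1) (cdiff X n x) = \<zero>\<^bsub>cmodule X (n + 1 + 1)\<^esub>"
  by (auto simp: is_complex_def)

lemma is_complex_diff': "is_complex R X \<Longrightarrow> linear R (cmodule X (n - 1)) (cmodule X n) (cdiff X (n - 1))"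
  using is_complex_diff[of R X "n - 1"] by simp

lemma chain_map_lin: "chain_map R X Y f \<Longrightarrow> linear R (cmodule X n) (cmodule Y n) (f n)"
  and chain_map_comm: "chain_map R X Y f \<Longrightarrow> x \<in> carrier (cmodule X n) \<Longrightarrow> f (n + 1) (cdiff X n x) = cdiff Y n (f n x)"
  by (auto simp: chain_map_def)

lemma chain_map_closed: "chain_map R X Y f \<Longrightarrow> x \<in> carrier (cmodule X n) \<Longrightarrow> f n x \<in> carrier (cmodule Y n)"
  using chain_map_lin lin_closed by metis

lemma chain_map_id: "is_complex R X \<Longrightarrow> chain_map R X X (\<lambda>n x. x)"
  unfolding chain_map_def linear_def by auto

lemma chain_map_comp: "chain_map R X Y f \<Longrightarrow> chain_map R Y Z g \<Longrightarrow> chain_map R X Z (\<lambda>n x. g n (f n x))"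
  unfolding chain_map_def using lin_comp lin_closed by metis

lemma chain_map_cong:
  assumes "is_complex R X" "chain_map R X Y f" "\<And>n x. x \<in> carrier (cmodule X n) \<Longrightarrow> g n x = f n x"
  shows "chain_map R X Y g"
  unfolding chain_map_def
  using lin_cong[OF is_complex_module[OF assms(1)] chain_map_lin[OF assms(2)]] assms(3)
    lin_closed[OF is_complex_diff[OF assms(1)]] chain_map_comm[OF assms(2)] by simp

lemma homotopicI:
  assumes "\<And>n. linear R (cmodule X n) (cmodule Y (n - 1)) (s n)"
    and "\<And>n x. x \<in> carrier (cmodule X n) \<Longrightarrow>
      f n x = g n x \<oplus>\<^bsub>cmodule Y n\<^esub> (cdiff Y (n - 1) (s n x) \<oplus>\<^bsub>cmodule Y n\<^esub> s (n + 1) (cdiff X n x))"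
  shows "homotopic R X Y f g"
  unfolding homotopic_def using assms by blast

lemma homotopic_eqI:
  assumes "is_complex R X" "is_complex R Y" "chain_map R X Y f" "\<And>n x. x \<in> carrier (cmodule X n) \<Longrightarrow> f n x = g n x"
  shows "homotopic R X Y f g"
proof (rule homotopicI[where s = "\<lambda>n x. \<zero>\<^bsub>cmodule Y (n - 1)\<^esub>"])
  fix n show "linear R (cmodule X n) (cmodule Y (n - 1)) (\<lambda>x. \<zero>\<^bsub>cmodule Y (n - 1)\<^esub>)"
    by (rule lin_const_zero[OF is_complex_module[OF assms(2)]])
next
  fix n x assume x: "x \<in> carrier (cmodule X n)"
  interpret Y: abelian_group "cmodule Y n" using is_complex_module[OF assms(2)] by (rule right_module_abelian)
  have "cdiff Y (n - 1) \<zero>\<^bsub>cmodule Y (n - 1)\<^esub> = \<zero>\<^bsub>cmodule Y n\<^esub>"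
    by (rule lin_zero[OF is_complex_module[OF assms(2)] is_complex_module[OF assms(2)] is_complex_diff'[OF assms(2)]])
  then show "f n x = g n x \<oplus>\<^bsub>cmodule Y n\<^esub> (cdiff Y (n - 1) \<zero>\<^bsub>cmodule Y (n - 1)\<^esub> \<oplus>\<^bsub>cmodule Y n\<^esub>
      \<zero>\<^bsub>cmodule Y (n + 1 - 1)\<^esub>)"
    using assms(4)[OF x] chain_map_closed[OF assms(3) x] by simp
qed

lemma homotopic_refl: "is_complex R X \<Longrightarrow> is_complex R Y \<Longrightarrow> chain_map R X Y f \<Longrightarrow> homotopic R X Y f f"
  by (rule homotopic_eqI) simp_all

lemma homotopic_sym:
  assumes "is_complex R X" "is_complex R Y" "chain_map R X Y f" "chain_map R X Y g" "homotopic R X Y f g"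
  shows "homotopic R X Y g f"
proof -
  obtain s where s: "\<And>n. linear R (cmodule X n) (cmodule Y (n - 1)) (s n)"
    and eq: "\<And>n x. x \<in> carrier (cmodule X n) \<Longrightarrow>
      f n x = g n x \<oplus>\<^bsub>cmodule Y n\<^esub> (cdiff Y (n - 1) (s n x) \<oplus>\<^bsub>cmodule Y n\<^esub> s (n + 1) (cdiff X n x))"
    using assms(5) unfolding homotopic_def by blast
  show ?thesis
  proof (rule homotopicI[where s = "\<lambda>n x. \<ominus>\<^bsub>cmodule Y (n - 1)\<^esub> s n x"])
    fix n show "linear R (cmodule X n) (cmodule Y (n - 1)) (\<lambda>x. \<ominus>\<^bsub>cmodule Y (n - 1)\<^esub> s n x)"
      by (rule lin_neg[OF is_complex_module[OF assms(2)] s])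
  next
    fix n x assume x: "x \<in> carrier (cmodule X n)"
    interpret Y: abelian_group "cmodule Y n" using is_complex_module[OF assms(2)] by (rule right_module_abelian)
    have 1: "cdiff Y (n - 1) (\<ominus>\<^bsub>cmodule Y (n - 1)\<^esub> s n x) = \<ominus>\<^bsub>cmodule Y n\<^esub> cdiff Y (n - 1) (s n x)"
      by (rule lin_uminus[OF is_complex_module[OF assms(2)] is_complex_module[OF assms(2)] is_complex_diff'[OF assms(2)]])
        (rule lin_closed[OF s x])
    have 2: "s (n + 1) (cdiff X n x) \<in> carrier (cmodule Y n)"
      using lin_closed[OF s[of "n + 1"] lin_closed[OF is_complex_diff[OF assms(1)] x]] by simp
    have 3: "cdiff Y (n - 1) (s n x) \<in> carrier (cmodule Y n)"
      using lin_closed[OF is_complex_diff'[OF assms(2)] lin_closed[OF s x]] .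
    show "g n x = f n x \<oplus>\<^bsub>cmodule Y n\<^esub> (cdiff Y (n - 1) (\<ominus>\<^bsub>cmodule Y (n - 1)\<^esub> s n x) \<oplus>\<^bsub>cmodule Y n\<^esub>
        \<ominus>\<^bsub>cmodule Y (n + 1 - 1)\<^esub> s (n + 1) (cdiff X n x))"
      unfolding eq[OF x] 1 using 2 3 chain_map_closed[OF assms(4) x]
      by (simp add: Y.minus_add[symmetric] Y.a_assoc Y.r_neg)
  qed
qed

lemma homotopic_trans:
  assumes "is_complex R X" "is_complex R Y" "chain_map R X Y h" "homotopic R X Y f g" "homotopic R X Y g h"
  shows "homotopic R X Y f h"
proof -
  obtain s where s: "\<And>n. linear R (cmodule X n) (cmodule Y (n - 1)) (s n)"
    and eq: "\<And>n x. x \<in> carrier (cmodule X n) \<Longrightarrow>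
      f n x = g n x \<oplus>\<^bsub>cmodule Y n\<^esub> (cdiff Y (n - 1) (s n x) \<oplus>\<^bsub>cmodule Y n\<^esub> s (n + 1) (cdiff X n x))"
    using assms(4) unfolding homotopic_def by blast
  obtain t where t: "\<And>n. linear R (cmodule X n) (cmodule Y (n - 1)) (t n)"
    and eq': "\<And>n x. x \<in> carrier (cmodule X n) \<Longrightarrow>
      g n x = h n x \<oplus>\<^bsub>cmodule Y n\<^esub> (cdiff Y (n - 1) (t n x) \<oplus>\<^bsub>cmodule Y n\<^esub> t (n + 1) (cdiff X n x))"
    using assms(5) unfolding homotopic_def by blast
  show ?thesis
  proof (rule homotopicI[where s = "\<lambda>n x. t n x \<oplus>\<^bsub>cmodule Y (n - 1)\<^esub> s n x"])
    fix n show "linear R (cmodule X n) (cmodule Y (n - 1)) (\<lambda>x. t n x \<oplus>\<^bsub>cmodule Y (n - 1)\<^esub> s n x)"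
      by (rule lin_plus[OF is_complex_module[OF assms(2)] t s])
  next
    fix n x assume x: "x \<in> carrier (cmodule X n)"
    interpret Y: abelian_group "cmodule Y n" using is_complex_module[OF assms(2)] by (rule right_module_abelian)
    have 1: "cdiff Y (n - 1) (t n x \<oplus>\<^bsub>cmodule Y (n - 1)\<^esub> s n x) =
        cdiff Y (n - 1) (t n x) \<oplus>\<^bsub>cmodule Y n\<^esub> cdiff Y (n - 1) (s n x)"
      by (rule lin_add[OF is_complex_diff'[OF assms(2)] lin_closed[OF t x] lin_closed[OF s x]])
    have 2: "s (n + 1) (cdiff X n x) \<in> carrier (cmodule Y n)" "t (n + 1) (cdiff X n x) \<in> carrier (cmodule Y n)"
      using lin_closed[OF s[of "n + 1"] lin_closed[OF is_complex_diff[OF assms(1)] x]]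
        lin_closed[OF t[of "n + 1"] lin_closed[OF is_complex_diff[OF assms(1)] x]] by simp_all
    have 3: "cdiff Y (n - 1) (s n x) \<in> carrier (cmodule Y n)" "cdiff Y (n - 1) (t n x) \<in> carrier (cmodule Y n)"
      using lin_closed[OF is_complex_diff'[OF assms(2)] lin_closed[OF s x]]
        lin_closed[OF is_complex_diff'[OF assms(2)] lin_closed[OF t x]] .
    show "f n x = h n x \<oplus>\<^bsub>cmodule Y n\<^esub> (cdiff Y (n - 1) (t n x \<oplus>\<^bsub>cmodule Y (n - 1)\<^esub> s n x) \<oplus>\<^bsub>cmodule Y n\<^esub>
        (t (n + 1) (cdiff X n x) \<oplus>\<^bsub>cmodule Y (n + 1 - 1)\<^esub> s (n + 1) (cdiff X n x)))"
      unfolding eq[OF x] eq'[OF x] 1 using 2 3 chain_map_closed[OF assms(3) x]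
      by (simp add: Y.a_ac)
  qed
qed

lemma homotopic_comp_left:
  assumes "is_complex R X" "is_complex R Y" "is_complex R Z" "chain_map R X Y g" "chain_map R Y Z k" "homotopic R X Y f g"
  shows "homotopic R X Z (\<lambda>n x. k n (f n x)) (\<lambda>n x. k n (g n x))"
proof -
  obtain s where s: "\<And>n. linear R (cmodule X n) (cmodule Y (n - 1)) (s n)"
    and eq: "\<And>n x. x \<in> carrier (cmodule X n) \<Longrightarrow>
      f n x = g n x \<oplus>\<^bsub>cmodule Y n\<^esub> (cdiff Y (n - 1) (s n x) \<oplus>\<^bsub>cmodule Y n\<^esub> s (n + 1) (cdiff X n x))"
    using assms(6) unfolding homotopic_def by blast
  show ?thesis
  proof (rule homotopicI[where s = "\<lambda>n x. k (n - 1) (s n x)"])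
    fix n show "linear R (cmodule X n) (cmodule Z (n - 1)) (\<lambda>x. k (n - 1) (s n x))"
      by (rule lin_comp[OF s chain_map_lin[OF assms(5)]])
  next
    fix n x assume x: "x \<in> carrier (cmodule X n)"
    interpret Y: abelian_group "cmodule Y n" using is_complex_module[OF assms(2)] by (rule right_module_abelian)
    have 2: "s (n + 1) (cdiff X n x) \<in> carrier (cmodule Y n)"
      using lin_closed[OF s[of "n + 1"] lin_closed[OF is_complex_diff[OF assms(1)] x]] by simp
    have 3: "cdiff Y (n - 1) (s n x) \<in> carrier (cmodule Y n)"
      using lin_closed[OF is_complex_diff'[OF assms(2)] lin_closed[OF s x]] .
    have 4: "k n (cdiff Y (n - 1) (s n x)) = cdiff Z (n - 1) (k (n - 1) (s n x))"
      using chain_map_comm[OF assms(5), of "s n x" "n - 1"] lin_closed[OF s x] by simp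
    show "k n (f n x) = k n (g n x) \<oplus>\<^bsub>cmodule Z n\<^esub> (cdiff Z (n - 1) (k (n - 1) (s n x)) \<oplus>\<^bsub>cmodule Z n\<^esub>
        k (n + 1 - 1) (s (n + 1) (cdiff X n x)))"
      unfolding eq[OF x] 4[symmetric] using 2 3 chain_map_closed[OF assms(4) x]
      by (simp add: lin_add[OF chain_map_lin[OF assms(5)]])
  qed
qed

lemma homotopic_comp_right:
  assumes "chain_map R W X k" "homotopic R X Y f g"
  shows "homotopic R W Y (\<lambda>n x. f n (k n x)) (\<lambda>n x. g n (k n x))"
proof -
  obtain s where s: "\<And>n. linear R (cmodule X n) (cmodule Y (n - 1)) (s n)"
    and eq: "\<And>n x. x \<in> carrier (cmodule X n) \<Longrightarrow>
      f n x = g n x \<oplus>\<^bsub>cmodule Y n\<^esub> (cdiff Y (n - 1) (s n x) \<oplus>\<^bsub>cmodule Y n\<^esub> s (n + 1) (cdiff X n x))"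
    using assms(2) unfolding homotopic_def by blast
  show ?thesis
  proof (rule homotopicI[where s = "\<lambda>n x. s n (k n x)"])
    fix n show "linear R (cmodule W n) (cmodule Y (n - 1)) (\<lambda>x. s n (k n x))"
      by (rule lin_comp[OF chain_map_lin[OF assms(1)] s])
  next
    fix n x assume x: "x \<in> carrier (cmodule W n)"
    show "f n (k n x) = g n (k n x) \<oplus>\<^bsub>cmodule Y n\<^esub> (cdiff Y (n - 1) (s n (k n x)) \<oplus>\<^bsub>cmodule Y n\<^esub>
        s (n + 1) (k (n + 1) (cdiff W n x)))"
      using eq[OF chain_map_closed[OF assms(1) x]] chain_map_comm[OF assms(1) x] by simp
  qed
qed

lemma homotopic_comp:
  assumes "is_complex R X" "is_complex R Y" "is_complex R Z" "chain_map R X Y f" "chain_map R X Y f'" "chain_map R Y Z g" "chain_map R Y Z g'"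
    and "homotopic R X Y f f'" "homotopic R Y Z g g'"
  shows "homotopic R X Z (\<lambda>n x. g n (f n x)) (\<lambda>n x. g' n (f' n x))"
proof (rule homotopic_trans[OF assms(1,3)])
  show "chain_map R X Z (\<lambda>n x. g' n (f' n x))" by (rule chain_map_comp[OF assms(5,7)])
  show "homotopic R X Z (\<lambda>n x. g n (f n x)) (\<lambda>n x. g n (f' n x))"
    by (rule homotopic_comp_left[OF assms(1-3,5,6,8)])
  show "homotopic R X Z (\<lambda>n x. g n (f' n x)) (\<lambda>n x. g' n (f' n x))"
    by (rule homotopic_comp_right[OF assms(5,9)])
qed

section \<open>Morphisms of the homotopy category as classes of chain maps\<close>

definition restrict_maps :: "('r, 'u) chain_complex \<Rightarrow> 'u graded_map \<Rightarrow> 'u graded_map" where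
  "restrict_maps X f = (\<lambda>n. restrict (f n) (carrier (cmodule X n)))"

text \<open>
  Chain maps in \<open>K_Proj\<close> are extensional, those of this development are not; the restriction mediates.
  The three lemmas \<open>Hom_cases\<close>, \<open>htpy_class_eq_iff\<close> and \<open>Comp_cls\<close> reduce statements about morphisms to
  chain maps and homotopies.
\<close>

definition htpy_class :: "('r, 'b) ring_scheme \<Rightarrow> ('r, 'u) chain_complex \<Rightarrow> ('r, 'u) chain_complex \<Rightarrow>
    'u graded_map \<Rightarrow> 'u graded_map set" where
  "htpy_class R X Y f = homotopy_rel R X Y `` {restrict_maps X f}"

lemma projective_complexes_cplx: "X \<in> projective_complexes R \<Longrightarrow> is_complex R X"
  unfolding projective_complexes_def is_complex_def projective_def small_right_module_def rhom_iff_lin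
  by auto

lemma chain_maps_iff: "f \<in> chain_maps R X Y \<longleftrightarrow> chain_map R X Y f \<and> (\<forall>n. f n \<in> extensional (carrier (cmodule X n)))"
  unfolding chain_maps_def chain_map_def rhom_iff_lin by auto

lemma rst_chain_map:
  assumes "is_complex R X" "chain_map R X Y f" shows "restrict_maps X f \<in> chain_maps R X Y"
  unfolding chain_maps_iff
  using chain_map_cong[OF assms, of "restrict_maps X f"] by (simp add: restrict_maps_def)

lemma homotopic_cong:
  assumes "is_complex R X" "homotopic R X Y f g"
    and "\<And>n x. x \<in> carrier (cmodule X n) \<Longrightarrow> f' n x = f n x"
    and "\<And>n x. x \<in> carrier (cmodule X n) \<Longrightarrow> g' n x = g n x"
  shows "homotopic R X Y f' g'"
  using assms(2) unfolding homotopic_def by (simp add: assms(3,4))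

lemma homotopy_rel_iff:
  assumes X: "is_complex R X" and Y: "is_complex R Y"
  shows "(f, g) \<in> homotopy_rel R X Y \<longleftrightarrow>
    f \<in> chain_maps R X Y \<and> g \<in> chain_maps R X Y \<and> homotopic R X Y f g"
proof -
  have diff: "f n x \<ominus>\<^bsub>cmodule Y n\<^esub> g n x = z \<longleftrightarrow> f n x = g n x \<oplus>\<^bsub>cmodule Y n\<^esub> z"
    if "chain_map R X Y f" "chain_map R X Y g" "x \<in> carrier (cmodule X n)" "z \<in> carrier (cmodule Y n)" for n x z
  proof -
    interpret Y: abelian_group "cmodule Y n" using is_complex_module[OF Y] by (rule right_module_abelian)
    show ?thesis using chain_map_closed[OF that(1,3)] chain_map_closed[OF that(2,3)] that(4)
      by (metis Y.a_comm Y.minus_eq Y.add.inv_solve_right)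
  qed
  have cl: "cdiff Y (n - 1) (s n x) \<oplus>\<^bsub>cmodule Y n\<^esub> s (n + 1) (cdiff X n x) \<in> carrier (cmodule Y n)"
    if s: "\<And>n. linear R (cmodule X n) (cmodule Y (n - 1)) (s n)" and x: "x \<in> carrier (cmodule X n)" for s n x
  proof -
    interpret Y: abelian_group "cmodule Y n" using is_complex_module[OF Y] by (rule right_module_abelian)
    have "s (n + 1) (cdiff X n x) \<in> carrier (cmodule Y n)"
      using lin_closed[OF s[of "n + 1"] lin_closed[OF is_complex_diff[OF X] x]] by simp
    moreover have "cdiff Y (n - 1) (s n x) \<in> carrier (cmodule Y n)"
      using lin_closed[OF is_complex_diff'[OF Y] lin_closed[OF s x]] .
    ultimately show ?thesis by simp
  qed
  show ?thesis
  proof (intro iffI conjI)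
    assume h: "(f, g) \<in> homotopy_rel R X Y"
    then show fg: "f \<in> chain_maps R X Y" "g \<in> chain_maps R X Y" by (auto simp: homotopy_rel_def)
    from h obtain s where s: "\<And>n. s n \<in> rhom R (cmodule X n) (cmodule Y (n - 1))"
      and eq: "\<And>n x. x \<in> carrier (cmodule X n) \<Longrightarrow> f n x \<ominus>\<^bsub>cmodule Y n\<^esub> g n x =
            cdiff Y (n - 1) (s n x) \<oplus>\<^bsub>cmodule Y n\<^esub> s (n + 1) (cdiff X n x)"
      unfolding homotopy_rel_def by blast
    have s': "linear R (cmodule X n) (cmodule Y (n - 1)) (s n)" for n
      using s rhom_iff_lin by blast
    show "homotopic R X Y f g"
      by (rule homotopicI[OF s']) (use diff cl[OF s'] eq fg chain_maps_iff in blast)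
  next
    assume h: "f \<in> chain_maps R X Y \<and> g \<in> chain_maps R X Y \<and> homotopic R X Y f g"
    then obtain s where s: "\<And>n. linear R (cmodule X n) (cmodule Y (n - 1)) (s n)"
      and eq: "\<And>n x. x \<in> carrier (cmodule X n) \<Longrightarrow>
        f n x = g n x \<oplus>\<^bsub>cmodule Y n\<^esub> (cdiff Y (n - 1) (s n x) \<oplus>\<^bsub>cmodule Y n\<^esub> s (n + 1) (cdiff X n x))"
      unfolding homotopic_def by blast
    define t where "t = (\<lambda>n. restrict (s n) (carrier (cmodule X n)))"
    have t_eq: "t n x = s n x" if "x \<in> carrier (cmodule X n)" for n x using that by (simp add: t_def)
    have t: "linear R (cmodule X n) (cmodule Y (n - 1)) (t n)" for n
      by (rule lin_cong[OF is_complex_module[OF X] s t_eq])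
    have "t n \<in> rhom R (cmodule X n) (cmodule Y (n - 1))" for n
      using t by (simp add: rhom_iff_lin t_def)
    moreover have "f n x \<ominus>\<^bsub>cmodule Y n\<^esub> g n x =
            cdiff Y (n - 1) (t n x) \<oplus>\<^bsub>cmodule Y n\<^esub> t (n + 1) (cdiff X n x)"
      if x: "x \<in> carrier (cmodule X n)" for n x
      using diff[OF _ _ x cl[OF t x]] eq[OF x] h t_eq[OF x] t_eq[OF lin_closed[OF is_complex_diff[OF X] x]]
      by (simp add: chain_maps_iff)
    ultimately show "(f, g) \<in> homotopy_rel R X Y"
      unfolding homotopy_rel_def using h by blast
  qed
qed

lemma homotopy_rel_equiv:
  assumes X: "is_complex R X" and Y: "is_complex R Y"
  shows "equiv (chain_maps R X Y) (homotopy_rel R X Y)"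
proof (rule equivI)
  show "refl_on (chain_maps R X Y) (homotopy_rel R X Y)"
    by (rule refl_onI) (auto simp: homotopy_rel_iff[OF X Y] chain_maps_iff intro: homotopic_refl[OF X Y])
  show "sym (homotopy_rel R X Y)"
    by (rule symI) (auto simp: homotopy_rel_iff[OF X Y] chain_maps_iff intro: homotopic_sym[OF X Y])
  show "trans (homotopy_rel R X Y)"
    by (rule transI) (auto simp: homotopy_rel_iff[OF X Y] chain_maps_iff intro: homotopic_trans[OF X Y])
qed (auto simp: homotopy_rel_iff[OF X Y])

lemma Obj_K [simp]: "Obj (K_Proj R) = projective_complexes R"
  by (simp add: K_Proj_def)

lemma htpy_class_in_Hom:
  assumes "is_complex R X" "is_complex R Y" "chain_map R X Y f"
  shows "htpy_class R X Y f \<in> Hom (K_Proj R) X Y"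
  using rst_chain_map[OF assms(1,3)] by (auto simp: htpy_class_def K_Proj_def intro: quotientI)

lemma Hom_cases:
  assumes "is_complex R X" "is_complex R Y" "F \<in> Hom (K_Proj R) X Y"
  obtains f where "chain_map R X Y f" "F = htpy_class R X Y f"
proof -
  obtain f where f: "f \<in> chain_maps R X Y" "F = homotopy_rel R X Y `` {f}"
    using assms(3) by (auto simp: K_Proj_def elim: quotientE)
  then have "restrict_maps X f = f"
    unfolding chain_maps_iff restrict_maps_def by (auto simp: extensional_restrict)
  then show ?thesis using f that[of f] by (simp add: htpy_class_def chain_maps_iff)
qed

lemma htpy_class_eq_iff:
  assumes "is_complex R X" "is_complex R Y" "chain_map R X Y f" "chain_map R X Y g"
  shows "htpy_class R X Y f = htpy_class R X Y g \<longleftrightarrow> homotopic R X Y f g"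
proof -
  have "htpy_class R X Y f = htpy_class R X Y g \<longleftrightarrow> homotopic R X Y (restrict_maps X f) (restrict_maps X g)"
    unfolding htpy_class_def
    using eq_equiv_class_iff[OF homotopy_rel_equiv[OF assms(1,2)] rst_chain_map[OF assms(1,3)] rst_chain_map[OF assms(1,4)]]
      homotopy_rel_iff[OF assms(1,2)] rst_chain_map[OF assms(1,3)] rst_chain_map[OF assms(1,4)] by blast
  also have "\<dots> \<longleftrightarrow> homotopic R X Y f g"
    using homotopic_cong[OF assms(1), of Y "restrict_maps X f" "restrict_maps X g" f g] homotopic_cong[OF assms(1), of Y f g "restrict_maps X f" "restrict_maps X g"]
    by (auto simp: restrict_maps_def)
  finally show ?thesis .
qed

text \<open>
  Homotopy is compatible with composition, so all composites of representatives lie in one class.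
\<close>

lemma Comp_cls:
  assumes X: "is_complex R X" and Y: "is_complex R Y" and Z: "is_complex R Z" and f: "chain_map R X Y f" and g: "chain_map R Y Z g"
  shows "Comp (K_Proj R) X Y Z (htpy_class R Y Z g) (htpy_class R X Y f) = htpy_class R X Z (\<lambda>n x. g n (f n x))"
proof -
  have *: "(chain_comp X (restrict_maps Y g) (restrict_maps X f)) = restrict_maps X (\<lambda>n x. g n (f n x))"
    using chain_map_closed[OF f] by (auto simp: chain_comp_def restrict_maps_def compose_def fun_eq_iff)
  have gf: "chain_map R X Z (\<lambda>n x. g n (f n x))" by (rule chain_map_comp[OF f g])
  have "homotopy_rel R X Z `` {chain_comp X g' f'} = htpy_class R X Z (\<lambda>n x. g n (f n x))"
    if "g' \<in> htpy_class R Y Z g" "f' \<in> htpy_class R X Y f" for f' g'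
  proof -
    have f': "chain_map R X Y f'" "homotopic R X Y (restrict_maps X f) f'" and g': "chain_map R Y Z g'" "homotopic R Y Z (restrict_maps Y g) g'"
      using that by (auto simp: htpy_class_def homotopy_rel_iff X Y Z chain_maps_iff)
    have fr: "chain_map R X Y (restrict_maps X f)" and gr: "chain_map R Y Z (restrict_maps Y g)"
      using rst_chain_map[OF X f] rst_chain_map[OF Y g] by (auto simp: chain_maps_iff)
    have "homotopic R X Z (\<lambda>n x. restrict_maps Y g n (restrict_maps X f n x)) (\<lambda>n x. g' n (f' n x))"
      by (rule homotopic_comp[OF X Y Z fr f'(1) gr g'(1) f'(2) g'(2)])
    then have "homotopic R X Z (\<lambda>n x. g n (f n x)) (\<lambda>n x. g' n (f' n x))"
      by (rule homotopic_cong[OF X]) (use chain_map_closed[OF f] in \<open>auto simp: restrict_maps_def\<close>)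
    then have "htpy_class R X Z (\<lambda>n x. g n (f n x)) = htpy_class R X Z (\<lambda>n x. g' n (f' n x))"
      using htpy_class_eq_iff[OF X Z gf chain_map_comp[OF f'(1) g'(1)]] by simp
    moreover have "chain_comp X g' f' = restrict_maps X (\<lambda>n x. g' n (f' n x))"
      by (auto simp: chain_comp_def restrict_maps_def compose_def fun_eq_iff)
    ultimately show ?thesis by (simp add: htpy_class_def)
  qed
  moreover have "restrict_maps X f \<in> htpy_class R X Y f" "restrict_maps Y g \<in> htpy_class R Y Z g"
    unfolding htpy_class_def
    by (rule equiv_class_self[OF homotopy_rel_equiv[OF X Y] rst_chain_map[OF X f]],
        rule equiv_class_self[OF homotopy_rel_equiv[OF Y Z] rst_chain_map[OF Y g]])
  ultimately have "homotopy_rel R X Z `` {chain_comp X g' f' | g' f'. g' \<in> htpy_class R Y Z g \<and> f' \<in> htpy_class R X Y f} =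
      htpy_class R X Z (\<lambda>n x. g n (f n x))"
    by blast
  then show ?thesis by (simp add: K_Proj_def)
qed

lemma Id_cls: "Id (K_Proj R) X = htpy_class R X X (\<lambda>n x. x)"
  by (simp add: K_Proj_def htpy_class_def chain_id_def restrict_maps_def)

section \<open>Complexes of free modules with chosen bases\<close>

text \<open>
  The differential is given by its values \<open>D b\<close> on basis elements; \<open>flift R D\<close> is its linear extension.
\<close>

definition based_complex :: "('r, 'b) ring_scheme \<Rightarrow> 'k set \<Rightarrow> ('k \<Rightarrow> int) \<Rightarrow> ('k \<Rightarrow> 'k \<Rightarrow> 'r) \<Rightarrow> bool" where
  "based_complex R B deg D \<longleftrightarrow>
     (\<forall>b \<in> B. D b \<in> finsupp R {c \<in> B. deg c = deg b + 1} \<and> flift R D (D b) = fzero R)"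

text \<open>
  The basis elements in \<open>C\<close> span a subcomplex.
\<close>

definition closed_in :: "('r, 'b) ring_scheme \<Rightarrow> 'k set \<Rightarrow> ('k \<Rightarrow> 'k \<Rightarrow> 'r) \<Rightarrow> 'k set \<Rightarrow> bool" where
  "closed_in R B D C \<longleftrightarrow> C \<subseteq> B \<and> (\<forall>b \<in> C. D b \<in> finsupp R C)"

text \<open>
  Differences of closed sets span subquotients; the grading and the basis are inherited.
\<close>

definition loc_closed :: "('r, 'b) ring_scheme \<Rightarrow> 'k set \<Rightarrow> ('k \<Rightarrow> 'k \<Rightarrow> 'r) \<Rightarrow> 'k set \<Rightarrow> bool" where
  "loc_closed R B D E \<longleftrightarrow> (\<exists>P Q. closed_in R B D P \<and> closed_in R B D Q \<and> E = P - Q)"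

definition subquot :: "('r, 'b) ring_scheme \<Rightarrow> ('k \<Rightarrow> int) \<Rightarrow> ('k \<Rightarrow> 'k \<Rightarrow> 'r) \<Rightarrow> 'k set \<Rightarrow> ('r, 'k \<Rightarrow> 'r) chain_complex" where
  "subquot R deg D E = \<lparr>cmodule = (\<lambda>n. free_mod R {b \<in> E. deg b = n}), cdiff = (\<lambda>n x. res R E (flift R D x))\<rparr>"

lemma subquot_simps [simp]:
  "cmodule (subquot R deg D E) n = free_mod R {b \<in> E. deg b = n}"
  "cdiff (subquot R deg D E) n = (\<lambda>x. res R E (flift R D x))"
  by (simp_all add: subquot_def)

lemma closed_in_Un: "closed_in R B D C \<Longrightarrow> closed_in R B D C' \<Longrightarrow> closed_in R B D (C \<union> C')"
  unfolding closed_in_def using finsupp_mono[of C "C \<union> C'" R] finsupp_mono[of C' "C \<union> C'" R] by auto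

lemma closed_in_Int: "closed_in R B D C \<Longrightarrow> closed_in R B D C' \<Longrightarrow> closed_in R B D (C \<inter> C')"
  unfolding closed_in_def using finsupp_Int[of _ R C C'] by auto

lemma loc_closed_Diff:
  assumes "loc_closed R B D E" "closed_in R B D K" shows "loc_closed R B D (E - K)"
proof -
  obtain P Q where "closed_in R B D P" "closed_in R B D Q" "E = P - Q"
    using assms(1) by (auto simp: loc_closed_def)
  then show ?thesis unfolding loc_closed_def
    using closed_in_Un[of R B D Q K] assms(2) by (intro exI[of _ P] exI[of _ "Q \<union> K"]) auto
qed

lemma loc_closed_subset: "loc_closed R B D E \<Longrightarrow> E \<subseteq> B"
  unfolding loc_closed_def closed_in_def by auto

text \<open>
  A family of degree \<open>-1\<close> maps has a boundary \<open>d s + s d\<close>, which is always a chain map; subtracting it does not change the class of \<open>f\<close>.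
\<close>

lemma homotopic_modification:
  assumes X: "is_complex R X" and Y: "is_complex R Y" and f: "chain_map R X Y f"
    and s: "\<And>n. linear R (cmodule X n) (cmodule Y (n - 1)) (s n)"
  obtains f' where "chain_map R X Y f'" "homotopic R X Y f f'"
    "\<And>n x. x \<in> carrier (cmodule X n) \<Longrightarrow> f n x = f' n x \<oplus>\<^bsub>cmodule Y n\<^esub>
       (cdiff Y (n - 1) (s n x) \<oplus>\<^bsub>cmodule Y n\<^esub> s (n + 1) (cdiff X n x))"
proof -
  define b where "b = (\<lambda>n x. cdiff Y (n - 1) (s n x) \<oplus>\<^bsub>cmodule Y n\<^esub> s (n + 1) (cdiff X n x))"
  define f' where "f' = (\<lambda>n x. f n x \<oplus>\<^bsub>cmodule Y n\<^esub> (\<ominus>\<^bsub>cmodule Y n\<^esub> b n x))"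
  have s1: "linear R (cmodule X (n + 1)) (cmodule Y n) (s (n + 1))" for n
    using s[of "n + 1"] by simp
  have b: "linear R (cmodule X n) (cmodule Y n) (b n)" for n
    unfolding b_def
    by (rule lin_plus[OF is_complex_module[OF Y] lin_comp[OF s is_complex_diff'[OF Y]] lin_comp[OF is_complex_diff[OF X] s1]])
  have f': "linear R (cmodule X n) (cmodule Y n) (f' n)" for n
    unfolding f'_def
    by (rule lin_plus[OF is_complex_module[OF Y] chain_map_lin[OF f] lin_neg[OF is_complex_module[OF Y] b]])
  have bc: "b (n + 1) (cdiff X n x) = cdiff Y n (b n x)" if x: "x \<in> carrier (cmodule X n)" for n x
  proof -
    interpret Y: abelian_group "cmodule Y (n + 1)" using is_complex_module[OF Y] by (rule right_module_abelian)
    have sd: "s (n + 1) (cdiff X n x) \<in> carrier (cmodule Y n)"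
      by (rule lin_closed[OF s1 lin_closed[OF is_complex_diff[OF X] x]])
    have d1: "cdiff Y n (cdiff Y (n - 1) (s n x)) = \<zero>\<^bsub>cmodule Y (n + 1)\<^esub>"
      using is_complex_sq[OF Y, of "s n x" "n - 1"] lin_closed[OF s x] by simp
    have d2: "s (n + 1 + 1) (cdiff X (n + 1) (cdiff X n x)) = \<zero>\<^bsub>cmodule Y (n + 1)\<^esub>"
      using is_complex_sq[OF X x] lin_zero[OF is_complex_module[OF X] is_complex_module[OF Y] s1[of "n + 1"]] by simp
    have "cdiff Y n (b n x) = cdiff Y n (cdiff Y (n - 1) (s n x)) \<oplus>\<^bsub>cmodule Y (n + 1)\<^esub>
        cdiff Y n (s (n + 1) (cdiff X n x))"
      unfolding b_def
      by (rule lin_add[OF is_complex_diff[OF Y] lin_closed[OF is_complex_diff'[OF Y] lin_closed[OF s x]] sd])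
    also have "\<dots> = b (n + 1) (cdiff X n x)"
      using d1 d2 lin_closed[OF is_complex_diff[OF Y] sd] by (simp add: b_def)
    finally show ?thesis by simp
  qed
  have "chain_map R X Y f'" unfolding chain_map_def
  proof (intro allI conjI ballI f')
    fix n x assume x: "x \<in> carrier (cmodule X n)"
    have "cdiff Y n (f' n x) = cdiff Y n (f n x) \<oplus>\<^bsub>cmodule Y (n + 1)\<^esub> (\<ominus>\<^bsub>cmodule Y (n + 1)\<^esub> cdiff Y n (b n x))"
    proof -
      interpret Y: abelian_group "cmodule Y n" using is_complex_module[OF Y] by (rule right_module_abelian)
      show ?thesis unfolding f'_def
        using lin_add[OF is_complex_diff[OF Y] chain_map_closed[OF f x] Y.a_inv_closed[OF lin_closed[OF b x]]]
          lin_uminus[OF is_complex_module[OF Y] is_complex_module[OF Y] is_complex_diff[OF Y] lin_closed[OF b x]] by simp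
    qed
    then show "f' (n + 1) (cdiff X n x) = cdiff Y n (f' n x)"
      unfolding f'_def bc[OF x] chain_map_comm[OF f x] by simp
  qed
  moreover have eq: "f n x = f' n x \<oplus>\<^bsub>cmodule Y n\<^esub> b n x" if x: "x \<in> carrier (cmodule X n)" for n x
  proof -
    interpret Y: abelian_group "cmodule Y n" using is_complex_module[OF Y] by (rule right_module_abelian)
    show ?thesis unfolding f'_def
      using chain_map_closed[OF f x] lin_closed[OF b x] by (simp add: Y.a_assoc Y.l_neg)
  qed
  moreover have "homotopic R X Y f f'"
    by (rule homotopicI[OF s]) (use eq b_def in auto)
  ultimately show ?thesis using that[of f'] unfolding b_def by blast
qed

locale based_cplx = ring R for R (structure) +
  fixes B :: "'k set" and deg :: "'k \<Rightarrow> int" and D :: "'k \<Rightarrow> 'k \<Rightarrow> 'a"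
  assumes based: "based_complex R B deg D"
begin

abbreviation "bd \<equiv> flift R D"
abbreviation "closed \<equiv> closed_in R B D"
abbreviation "lc \<equiv> loc_closed R B D"
abbreviation "Sq \<equiv> subquot R deg D"

lemma D_deg: "b \<in> B \<Longrightarrow> D b \<in> finsupp R {c \<in> B. deg c = deg b + 1}"
  using based by (auto simp: based_complex_def)

lemma D_closed: "b \<in> B \<Longrightarrow> D b \<in> finsupp R B"
  using D_deg finsupp_mono[of "{c \<in> B. deg c = deg b + 1}" B R] by auto

lemma bd_be: "b \<in> B \<Longrightarrow> bd (basis_vec R b) = D b"
  using flift_be D_closed by metis

lemma bd_lin: "linear R (free_mod R B) (free_mod R B) bd"
  by (rule flift_lin) (rule D_closed)

lemma bd_closed: "x \<in> finsupp R B \<Longrightarrow> bd x \<in> finsupp R B"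
  using lin_closed[OF bd_lin] .

lemma bd_deg: "linear R (free_mod R {b \<in> B. deg b = n}) (free_mod R {b \<in> B. deg b = n + 1}) bd"
  using D_deg by (intro flift_lin) auto

lemma bd_bd: "x \<in> finsupp R B \<Longrightarrow> bd (bd x) = fzero R"
proof (rule lin_ext[OF free_mod_module lin_comp[OF bd_lin bd_lin]])
  show "linear R (free_mod R B) (free_mod R B) (\<lambda>x. fzero R)"
    using lin_const_zero[OF free_mod_module, of "free_mod R B" B] by simp
  show "bd (bd (basis_vec R b)) = fzero R" if "b \<in> B" for b
    using that based bd_be[OF that] by (simp add: based_complex_def)
qed

lemma B_closed: "closed B"
  unfolding closed_in_def using D_closed by auto

lemma closed_lc: "closed C \<Longrightarrow> lc C"
  unfolding loc_closed_def by (rule exI[of _ C], rule exI[of _ "{}"]) (auto simp: closed_in_def)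

lemma closed_bd: "closed C \<Longrightarrow> linear R (free_mod R C) (free_mod R C) bd"
  by (rule flift_lin) (auto simp: closed_in_def)

text \<open>
  Write \<open>x\<close> as its part on \<open>P - Q\<close> plus its part on \<open>Q\<close>; the boundary of the latter stays in \<open>Q\<close>.
  From this follow that the differential of a subquotient squares to zero and that the quotient maps are chain maps.
\<close>

lemma res_bd_res:
  assumes P: "closed P" and Q: "closed Q" and x: "x \<in> finsupp R P"
  shows "res R (P - Q) (bd (res R (P - Q) x)) = res R (P - Q) (bd x)"
proof -
  have eq: "x = fadd R (res R (P - Q) x) (res R Q x)"
    using finsupp_outside[OF x] finsupp_coeff[OF x] by (auto simp: fadd_def res_def fun_eq_iff)
  have PB: "P \<subseteq> B" and QB: "Q \<subseteq> B" using P Q by (auto simp: closed_in_def)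
  have c1: "res R (P - Q) x \<in> finsupp R B" and c2: "res R Q x \<in> finsupp R B"
    using x PB QB finsupp_monoD[of "res R (P - Q) x" R "P - Q" B] finsupp_monoD[of "res R Q x" R Q B] by auto
  have "bd x = fadd R (bd (res R (P - Q) x)) (bd (res R Q x))"
    using lin_add[OF bd_lin c1 c2] eq by simp
  moreover have "bd (res R Q x) \<in> finsupp R Q"
    using lin_closed[OF closed_bd[OF Q], of "res R Q x"] x by simp
  ultimately show ?thesis
    using finsupp_outside[of "bd (res R Q x)" R Q] finsupp_coeff[OF bd_closed[OF c1]]
    by (auto simp: res_def fadd_def fun_eq_iff)
qed

lemma subquot_lin:
  assumes "E \<subseteq> B"
  shows "linear R (free_mod R {b \<in> E. deg b = n}) (free_mod R {b \<in> E. deg b = n + 1}) (\<lambda>x. res R E (bd x))"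
proof -
  have "linear R (free_mod R {b \<in> E. deg b = n}) (free_mod R {b \<in> B. deg b = n + 1}) bd"
    using assms by (intro lin_sub[OF bd_deg]) auto
  moreover have "linear R (free_mod R {b \<in> B. deg b = n + 1}) (free_mod R {b \<in> E. deg b = n + 1}) (res R E)"
    by (rule lin_weaken[OF lin_res]) auto
  ultimately show ?thesis by (rule lin_comp)
qed

lemma subquot_cplx:
  assumes "lc E" shows "is_complex R (Sq E)"
proof -
  obtain P Q where P: "closed P" and Q: "closed Q" and E: "E = P - Q"
    using assms by (auto simp: loc_closed_def)
  have EB: "E \<subseteq> B" by (rule loc_closed_subset[OF assms])
  have "res R E (bd (res R E (bd x))) = fzero R" if "x \<in> finsupp R {b \<in> E. deg b = n}" for x n
  proof -
    have xP: "x \<in> finsupp R P" using that by (rule finsupp_monoD) (auto simp: E)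
    have xB: "x \<in> finsupp R B" using that by (rule finsupp_monoD) (use EB in auto)
    have "res R E (bd (res R E (bd x))) = res R E (bd (bd x))"
      unfolding E by (rule res_bd_res[OF P Q lin_closed[OF closed_bd[OF P] xP]])
    also have "\<dots> = fzero R" by (simp add: bd_bd[OF xB] res_def fzero_def)
    finally show ?thesis .
  qed
  then show ?thesis
    unfolding is_complex_def using subquot_lin[OF EB] by (auto simp: free_mod_module)
qed

lemma chain_map_quotient:
  assumes "lc E" "closed K"
  shows "chain_map R (Sq E) (Sq (E - K)) (\<lambda>n. res R (E - K))"
  unfolding chain_map_def
proof (intro allI conjI ballI)
  fix n
  show "linear R (cmodule (Sq E) n) (cmodule (Sq (E - K)) n) (res R (E - K))"
    unfolding subquot_simps by (rule lin_weaken[OF lin_res]) auto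
  fix x assume x: "x \<in> carrier (cmodule (Sq E) n)"
  obtain P Q where P: "closed P" and Q: "closed Q" and E: "E = P - Q"
    using assms by (auto simp: loc_closed_def)
  have EK: "E - K = P - (Q \<union> K)" using E by auto
  have xP: "x \<in> finsupp R P" using x unfolding subquot_simps by (rule finsupp_monoD) (auto simp: E)
  have "res R (E - K) (bd (res R (E - K) x)) = res R (E - K) (bd x)"
    unfolding EK by (rule res_bd_res[OF P closed_in_Un[OF Q assms(2)] xP])
  then show "res R (E - K) (cdiff (Sq E) n x) = cdiff (Sq (E - K)) n (res R (E - K) x)"
    by (auto simp: res_def)
qed

text \<open>
  \<open>E'\<close> spans a subcomplex of the subquotient on \<open>E\<close>: the differential may leave \<open>E'\<close> only by leaving \<open>E\<close>,
  where it is cut off.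
\<close>

definition rel_closed :: "'k set \<Rightarrow> 'k set \<Rightarrow> bool" where
  "rel_closed E' E \<longleftrightarrow> E' \<subseteq> E \<and> (\<forall>b \<in> E'. D b \<in> finsupp R (E' \<union> - E))"

lemma rel_closed_bd:
  assumes "rel_closed E' E" "E \<subseteq> B" "x \<in> finsupp R E'"
  shows "res R E (bd x) = res R E' (bd x)"
proof -
  have "linear R (free_mod R E') (free_mod R (E' \<union> - E)) bd"
    using assms(1) by (intro flift_lin) (auto simp: rel_closed_def)
  then have "bd x \<in> finsupp R (E' \<union> - E)" using assms(3) by (rule lin_closed)
  then show ?thesis using finsupp_outside[of "bd x" R "E' \<union> - E"] assms(1)
    by (auto simp: res_def fun_eq_iff rel_closed_def)
qed

lemma chain_map_into_sub:
  assumes "rel_closed E' E" "E \<subseteq> B" "chain_map R X (Sq E) f"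
    and "\<And>n x. x \<in> carrier (cmodule X n) \<Longrightarrow> f n x \<in> finsupp R E'"
  shows "chain_map R X (Sq E') f"
  unfolding chain_map_def
proof (intro allI conjI ballI)
  fix n
  have "f n x \<in> finsupp R {b \<in> E'. deg b = n}" if "x \<in> carrier (cmodule X n)" for x
    using finsupp_Int[OF assms(4)[OF that] chain_map_closed[OF assms(3) that, unfolded subquot_simps]]
    by (rule finsupp_monoD) auto
  then show "linear R (cmodule X n) (cmodule (Sq E') n) (f n)"
    using lin_strengthen[OF chain_map_lin[OF assms(3), unfolded subquot_simps]] by simp
  fix x assume x: "x \<in> carrier (cmodule X n)"
  show "f (n + 1) (cdiff X n x) = cdiff (Sq E') n (f n x)"
    using chain_map_comm[OF assms(3) x] rel_closed_bd[OF assms(1,2) assms(4)[OF x]] by simp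
qed

lemma chain_map_inclusion:
  assumes "rel_closed E' E" "E \<subseteq> B"
  shows "chain_map R (Sq E') (Sq E) (\<lambda>n x. x)"
  unfolding chain_map_def
proof (intro allI conjI ballI)
  fix n
  have "{b \<in> E'. deg b = n} \<subseteq> {b \<in> E. deg b = n}" using assms(1) by (auto simp: rel_closed_def)
  then show "linear R (cmodule (Sq E') n) (cmodule (Sq E) n) (\<lambda>x. x)"
    using finsupp_mono[of "{b \<in> E'. deg b = n}" "{b \<in> E. deg b = n}" R] by (auto simp: linear_def)
  fix x assume "x \<in> carrier (cmodule (Sq E') n)"
  then have "x \<in> finsupp R E'" unfolding subquot_simps by (rule finsupp_monoD) auto
  then show "cdiff (Sq E') n x = cdiff (Sq E) n x"
    using rel_closed_bd[OF assms] by simp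
qed

text \<open>
  The graded modules split along the basis, so a homotopy modulo the subcomplex \<open>K\<close> can be read as a family of maps
  into \<open>E\<close>.  Subtracting its boundary moves \<open>f\<close> into \<open>S\<close> modulo \<open>K\<close>.
\<close>

lemma lift_homotopy:
  assumes X: "is_complex R X" and E: "lc E" and K: "closed K" and f: "chain_map R X (Sq E) f"
    and g: "homotopic R X (Sq (E - K)) (\<lambda>n x. res R (E - K) (f n x)) g"
    and gS: "\<And>n x. x \<in> carrier (cmodule X n) \<Longrightarrow> g n x \<in> finsupp R S"
    and gc: "\<And>n x. x \<in> carrier (cmodule X n) \<Longrightarrow> g n x \<in> finsupp R {b \<in> E - K. deg b = n}"
  shows "\<exists>f'. chain_map R X (Sq E) f' \<and> homotopic R X (Sq E) f f' \<and>
    (\<forall>n. \<forall>x \<in> carrier (cmodule X n). f' n x \<in> finsupp R (S \<union> (E \<inter> K)))"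
proof -
  obtain s where s: "\<And>n. linear R (cmodule X n) (free_mod R {b \<in> E - K. deg b = n - 1}) (s n)"
    and eq: "\<And>n x. x \<in> carrier (cmodule X n) \<Longrightarrow> res R (E - K) (f n x) =
        fadd R (g n x) (fadd R (res R (E - K) (bd (s n x))) (s (n + 1) (cdiff X n x)))"
    using g unfolding homotopic_def subquot_simps free_mod_simps by blast
  have s': "linear R (cmodule X n) (cmodule (Sq E) (n - 1)) (s n)" for n
    unfolding subquot_simps by (rule lin_weaken[OF s]) auto
  obtain f' where f': "chain_map R X (Sq E) f'" "homotopic R X (Sq E) f f'"
    and eq': "\<And>n x. x \<in> carrier (cmodule X n) \<Longrightarrow> f n x = fadd R (f' n x)
       (fadd R (res R E (bd (s n x))) (s (n + 1) (cdiff X n x)))"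
    using homotopic_modification[OF X subquot_cplx[OF E] f s'] unfolding subquot_simps free_mod_simps by blast
  have "f' n x \<in> finsupp R (S \<union> (E \<inter> K))" if x: "x \<in> carrier (cmodule X n)" for n x
  proof (rule finsuppI)
    show f'E: "f' n x \<in> finsupp R {b \<in> E. deg b = n}" using chain_map_closed[OF f'(1) x] by simp
    fix b assume b: "b \<notin> S \<union> E \<inter> K"
    have sE: "s n x \<in> finsupp R B"
      using lin_closed[OF s x] loc_closed_subset[OF E] by (elim finsupp_monoD) auto
    have s1: "s (n + 1) (cdiff X n x) \<in> finsupp R {b \<in> E - K. deg b = n + 1 - 1}"
      by (rule lin_closed[OF s lin_closed[OF is_complex_diff[OF X] x]])
    show "f' n x b = \<zero>"
    proof (cases "b \<in> E")
      case True
      then have bEK: "b \<in> E - K" using b by auto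
      have g0: "g n x b = \<zero>" using finsupp_outside[OF gS[OF x]] b by auto
      define u where "u = bd (s n x) b \<oplus> s (n + 1) (cdiff X n x) b"
      have u: "u \<in> carrier R"
        unfolding u_def using finsupp_coeff[OF bd_closed[OF sE]] finsupp_coeff[OF s1] by simp
      have 1: "f n x b = \<zero> \<oplus> u"
        using fun_cong[OF eq[OF x], of b] bEK g0 by (simp add: res_def fadd_def u_def)
      have 2: "f n x b = f' n x b \<oplus> u"
        using fun_cong[OF eq'[OF x], of b] bEK by (simp add: res_def fadd_def u_def)
      show ?thesis using 1 2 u finsupp_coeff[OF f'E, of b] by (metis add.right_cancel zero_closed)
    next
      case False
      then show ?thesis using finsupp_outside[OF f'E] by auto
    qed
  qed
  then show ?thesis using f' by (intro exI[of _ f'] conjI allI ballI)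
qed

text \<open>
  The differential of a basis element involves finitely many basis elements, so closing up \<open>S\<close> takes countably
  many steps that each preserve countability.
\<close>

lemma countable_closure:
  assumes "countable S" "S \<subseteq> B"
  obtains C where "countable C" "S \<subseteq> C" "closed C"
proof -
  define F where "F = rec_nat S (\<lambda>_ T. T \<union> (\<Union>b\<in>T. support R (D b)))"
  have F: "F 0 = S" "\<And>n. F (Suc n) = F n \<union> (\<Union>b\<in>F n. support R (D b))" by (auto simp: F_def)
  have FB: "F n \<subseteq> B" for n
    by (induction n) (use assms(2) D_closed in \<open>auto simp: F finsupp_iff\<close>)
  have "countable (F n)" for n
  proof (induction n)
    case (Suc n)
    have "finite (support R (D b))" if "b \<in> F n" for b
      using FB that D_closed by (auto simp: finsupp_iff)
    with Suc show ?case by (auto simp: F countable_finite)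
  qed (simp add: F assms(1))
  then have "countable (\<Union>n. F n)" by auto
  moreover have "closed (\<Union>n. F n)"
    unfolding closed_in_def
  proof (intro conjI ballI)
    show "(\<Union>n. F n) \<subseteq> B" using FB by auto
    fix b assume "b \<in> (\<Union>n. F n)"
    then obtain n where n: "b \<in> F n" by auto
    then have "support R (D b) \<subseteq> F (Suc n)" by (auto simp: F)
    then show "D b \<in> finsupp R (\<Union>n. F n)" using D_closed[of b] FB n by (auto simp: finsupp_iff)
  qed
  moreover have "S \<subseteq> (\<Union>n. F n)" using F(1) by blast
  ultimately show ?thesis using that by blast
qed

section \<open>Compressing maps into countable subcomplexes\<close>

text \<open>
  Every map from an object of \<open>A\<close> to the subquotient on \<open>E\<close> is homotopic to one with values in the span of a countable set.
\<close>

definition compressible :: "('a, 'u) chain_complex set \<Rightarrow> 'k set \<Rightarrow> bool" where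
  "compressible A E \<longleftrightarrow> (\<forall>X \<in> A. \<forall>f. chain_map R X (Sq E) f \<longrightarrow>
     (\<exists>f' S. countable S \<and> chain_map R X (Sq E) f' \<and> homotopic R X (Sq E) f f' \<and>
        (\<forall>n. \<forall>x \<in> carrier (cmodule X n). f' n x \<in> finsupp R S)))"

text \<open>
  Compressibility of all quotients by countable subcomplexes.  This is the form that survives extensions:
  there a map is first compressed modulo a subcomplex, and the countable set obtained has then to be divided out.
\<close>

definition hcompressible :: "('a, 'u) chain_complex set \<Rightarrow> 'k set \<Rightarrow> bool" where
  "hcompressible A E \<longleftrightarrow> (\<forall>K. closed K \<longrightarrow> countable K \<longrightarrow> compressible A (E - K))"

lemma compressibleE:
  assumes "compressible A E" "X \<in> A" "chain_map R X (Sq E) f"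
  obtains f' S where "countable S" "chain_map R X (Sq E) f'" "homotopic R X (Sq E) f f'"
    "\<And>n x. x \<in> carrier (cmodule X n) \<Longrightarrow> f' n x \<in> finsupp R S"
  using assms unfolding compressible_def by metis

lemma compressibleI:
  assumes "\<And>X f. X \<in> A \<Longrightarrow> chain_map R X (Sq E) f \<Longrightarrow> \<exists>f' S. countable S \<and> chain_map R X (Sq E) f' \<and>
     homotopic R X (Sq E) f f' \<and> (\<forall>n. \<forall>x \<in> carrier (cmodule X n). f' n x \<in> finsupp R S)"
  shows "compressible A E"
  using assms unfolding compressible_def by simp

lemma rel_closed_decomp:
  assumes E: "lc E" and E1: "rel_closed E1 E"
  obtains C where "closed C" "E \<inter> C = E1" "E - C = E - E1"
proof -
  obtain P Q where P: "closed P" and Q: "closed Q" and EPQ: "E = P - Q"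
    using E by (auto simp: loc_closed_def)
  have E1E: "E1 \<subseteq> E" using E1 by (auto simp: rel_closed_def)
  have "closed (E1 \<union> Q)" unfolding closed_in_def
  proof (intro conjI ballI)
    show "E1 \<union> Q \<subseteq> B" using E1E P Q EPQ by (auto simp: closed_in_def)
    fix b assume "b \<in> E1 \<union> Q"
    then show "D b \<in> finsupp R (E1 \<union> Q)"
    proof
      assume b: "b \<in> E1"
      then have "D b \<in> finsupp R P" using E1E EPQ P by (auto simp: closed_in_def)
      moreover have "D b \<in> finsupp R (E1 \<union> - E)" using E1 b by (auto simp: rel_closed_def)
      ultimately have "D b \<in> finsupp R (P \<inter> (E1 \<union> - E))" by (rule finsupp_Int)
      then show ?thesis by (rule finsupp_monoD) (auto simp: EPQ)
    next
      assume "b \<in> Q"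
      then have "D b \<in> finsupp R Q" using Q by (auto simp: closed_in_def)
      then show ?thesis by (rule finsupp_monoD) auto
    qed
  qed
  then show ?thesis using that[of "E1 \<union> Q"] E1E EPQ by blast
qed

lemma rel_closed_lc:
  assumes "lc E" "rel_closed E1 E" shows "lc E1" "lc (E - E1)"
proof -
  obtain P Q where P: "closed P" and Q: "closed Q" and EPQ: "E = P - Q"
    using assms(1) by (auto simp: loc_closed_def)
  obtain C where C: "closed C" "E \<inter> C = E1" "E - C = E - E1"
    by (rule rel_closed_decomp[OF assms])
  show "lc (E - E1)" using loc_closed_Diff[OF assms(1) C(1)] C(3) by simp
  have "E1 = (P \<inter> C) - Q" using C(2) EPQ by auto
  then show "lc E1" unfolding loc_closed_def using closed_in_Int[OF P C(1)] Q by blast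
qed

text \<open>
  First compress the map into the quotient \<open>E - E1\<close>.  The lifted homotopy moves the map into \<open>E1\<close> together with a countable set;
  modulo the countable closure \<open>K0\<close> of that set it is a map into a quotient of \<open>E1\<close>, so it can be compressed once more.
\<close>

lemma hcompressible_extension:
  assumes A: "\<And>X. X \<in> A \<Longrightarrow> is_complex R X" and E: "lc E" and E1: "rel_closed E1 E"
    and h1: "hcompressible A E1" and h2: "hcompressible A (E - E1)"
  shows "hcompressible A E"
  unfolding hcompressible_def
proof (intro allI impI compressibleI)
  fix K X f assume K: "closed K" "countable K" and X: "X \<in> A" and f: "chain_map R X (Sq (E - K)) f"
  note Xc = A[OF X]
  obtain C where C: "closed C" "E \<inter> C = E1" "E - C = E - E1" by (rule rel_closed_decomp[OF E E1])
  have EK: "lc (E - K)" by (rule loc_closed_Diff[OF E K(1)])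
  have eq1: "E - K - C = E - E1 - K" using C by auto
  have "chain_map R X (Sq (E - E1 - K)) (\<lambda>n x. res R (E - K - C) (f n x))"
    using chain_map_comp[OF f chain_map_quotient[OF EK C(1)]] eq1 by simp
  then obtain g S2 where g: "countable S2" "chain_map R X (Sq (E - E1 - K)) g"
      "homotopic R X (Sq (E - E1 - K)) (\<lambda>n x. res R (E - K - C) (f n x)) g"
      "\<And>n x. x \<in> carrier (cmodule X n) \<Longrightarrow> g n x \<in> finsupp R S2"
    using compressibleE[OF h2[unfolded hcompressible_def, rule_format, OF K] X] by metis
  have gc: "g n x \<in> finsupp R {b \<in> E - K - C. deg b = n}" if "x \<in> carrier (cmodule X n)" for n x
    using chain_map_closed[OF g(2) that] eq1 by simp
  obtain f' where f': "chain_map R X (Sq (E - K)) f'" "homotopic R X (Sq (E - K)) f f'"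
    "\<And>n x. x \<in> carrier (cmodule X n) \<Longrightarrow> f' n x \<in> finsupp R (S2 \<union> ((E - K) \<inter> C))"
    using lift_homotopy[OF Xc EK C(1) f g(3)[folded eq1] g(4) gc] by metis
  have KB: "K \<subseteq> B" using K by (auto simp: closed_in_def)
  have "countable (K \<union> (S2 \<inter> B))" "K \<union> (S2 \<inter> B) \<subseteq> B" using K g KB by auto
  then obtain K0 where K0: "countable K0" "K \<union> (S2 \<inter> B) \<subseteq> K0" "closed K0"
    by (rule countable_closure)
  have eq2: "E - K - K0 = E - K0" using K0 by auto
  have EK0: "lc (E - K0)" by (rule loc_closed_Diff[OF E K0(3)])
  have rel: "rel_closed (E1 - K0) (E - K0)"
    using E1 finsupp_mono[of "E1 \<union> - E" "E1 - K0 \<union> - (E - K0)" R] unfolding rel_closed_def by blast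
  have EK0B: "E - K0 \<subseteq> B" using loc_closed_subset[OF EK0] .
  define h where "h = (\<lambda>n x. res R (E - K0) (f' n x))"
  have h0: "chain_map R X (Sq (E - K0)) h"
    using chain_map_comp[OF f'(1) chain_map_quotient[OF EK K0(3)]] eq2 by (simp add: h_def)
  have hland: "h n x \<in> finsupp R (E1 - K0)" if x: "x \<in> carrier (cmodule X n)" for n x
  proof -
    have "h n x \<in> finsupp R ((E - K0) \<inter> (S2 \<union> ((E - K) \<inter> C)))"
      unfolding h_def by (rule res_closed[OF f'(3)[OF x]])
    then show ?thesis
      by (rule finsupp_monoD) (use K0 C loc_closed_subset[OF E] in auto)
  qed
  have "chain_map R X (Sq (E1 - K0)) h" by (rule chain_map_into_sub[OF rel EK0B h0 hland])
  then obtain h' S1 where h': "countable S1" "chain_map R X (Sq (E1 - K0)) h'"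
      "homotopic R X (Sq (E1 - K0)) h h'"
      "\<And>n x. x \<in> carrier (cmodule X n) \<Longrightarrow> h' n x \<in> finsupp R S1"
    using compressibleE[OF h1[unfolded hcompressible_def, rule_format, OF K0(3,1)] X] by metis
  have lcE1: "lc (E1 - K0)" by (rule rel_closed_lc[OF EK0 rel])
  have inc: "chain_map R (Sq (E1 - K0)) (Sq (E - K0)) (\<lambda>n x. x)" by (rule chain_map_inclusion[OF rel EK0B])
  have hh: "homotopic R X (Sq (E - K - K0)) (\<lambda>n x. res R (E - K - K0) (f' n x)) h'"
    using homotopic_comp_left[OF Xc subquot_cplx[OF lcE1] subquot_cplx[OF EK0] h'(2) inc h'(3)] eq2
    by (simp add: h_def)
  have h'c: "h' n x \<in> finsupp R {b \<in> E - K - K0. deg b = n}" if x: "x \<in> carrier (cmodule X n)" for n x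
    using chain_map_closed[OF chain_map_comp[OF h'(2) inc] x] eq2 by simp
  obtain f'' where f'': "chain_map R X (Sq (E - K)) f''" "homotopic R X (Sq (E - K)) f' f''"
    "\<And>n x. x \<in> carrier (cmodule X n) \<Longrightarrow> f'' n x \<in> finsupp R (S1 \<union> ((E - K) \<inter> K0))"
    using lift_homotopy[OF Xc EK K0(3) f'(1) hh h'(4) h'c] by metis
  have "homotopic R X (Sq (E - K)) f f''"
    by (rule homotopic_trans[OF Xc subquot_cplx[OF EK] f''(1) f'(2) f''(2)])
  moreover have "countable (S1 \<union> ((E - K) \<inter> K0))" using h' K0 by auto
  ultimately show "\<exists>f' S. countable S \<and> chain_map R X (Sq (E - K)) f' \<and> homotopic R X (Sq (E - K)) f f' \<and>
      (\<forall>n. \<forall>x\<in>carrier (cmodule X n). f' n x \<in> finsupp R S)"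
    using f''(1,3) by (intro exI[of _ f''] exI[of _ "S1 \<union> ((E - K) \<inter> K0)"] conjI allI ballI)
qed

lemma hcompressible_countable:
  assumes A: "\<And>X. X \<in> A \<Longrightarrow> is_complex R X" and "lc E" "countable E"
  shows "hcompressible A E"
  unfolding hcompressible_def
proof (intro allI impI compressibleI)
  fix K X f assume K: "closed K" "countable K" and X: "X \<in> A" and f: "chain_map R X (Sq (E - K)) f"
  have "f n x \<in> finsupp R E" if "x \<in> carrier (cmodule X n)" for n x
    using chain_map_closed[OF f that] unfolding subquot_simps by (rule finsupp_monoD) auto
  then show "\<exists>f' S. countable S \<and> chain_map R X (Sq (E - K)) f' \<and> homotopic R X (Sq (E - K)) f f' \<and>
      (\<forall>n. \<forall>x\<in>carrier (cmodule X n). f' n x \<in> finsupp R S)"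
    using f homotopic_refl[OF A[OF X] subquot_cplx[OF loc_closed_Diff[OF assms(2) K(1)]] f] assms(3)
    by (intro exI[of _ f] exI[of _ E] conjI allI ballI)
qed

end

section \<open>Unipotent endomorphisms\<close>

context ring
begin

lemma fadd_neg_cancel:
  assumes "x \<in> finsupp R E" "y \<in> finsupp R E'" shows "fadd R x (fadd R y (fneg R x)) = y"
  using finsupp_coeff[OF assms(1)] finsupp_coeff[OF assms(2)]
  by (auto simp: fadd_def fneg_def fun_eq_iff a_lcomm[of "x _"] r_neg)

text \<open>
  On a basis ordered by the well-founded rank \<open>rk\<close> the map is the identity plus terms of smaller rank.  A basis element of
  maximal rank in the support of \<open>x\<close> survives in \<open>U x\<close>, which gives injectivity; surjectivity is well-founded induction on the rank.
\<close>

lemma unipotent_bij: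
  assumes U: "linear R (free_mod R E) (free_mod R E) U" and W: "wf W" "trans W"
    and N: "\<And>p. p \<in> E \<Longrightarrow> fadd R (U (basis_vec R p)) (fneg R (basis_vec R p)) \<in> finsupp R {q \<in> E. (rk q, rk p) \<in> W}"
  shows "bij_betw U (finsupp R E) (finsupp R E)"
  unfolding bij_betw_def
proof
  define n where "n = (\<lambda>x. fadd R (U x) (fneg R x))"
  have idl: "linear R (free_mod R E) (free_mod R E) (\<lambda>x. x)" by (auto simp: linear_def)
  have n: "linear R (free_mod R E) (free_mod R E) n"
  proof (rule lin_cong[OF free_mod_module lin_plus[OF free_mod_module U lin_neg[OF free_mod_module idl]]])
    show "n x = U x \<oplus>\<^bsub>free_mod R E\<^esub> (\<ominus>\<^bsub>free_mod R E\<^esub> x)" if "x \<in> finsupp R E" for x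
      using that by (simp add: n_def)
  qed
  have Un: "U x = fadd R x (n x)" if "x \<in> finsupp R E" for x
    unfolding n_def using fadd_neg_cancel[OF that lin_closed[OF U that]] by simp
  have ker: "x = fzero R" if x: "x \<in> finsupp R E" and Ux: "U x = fzero R" for x
  proof (rule ccontr)
    assume "x \<noteq> fzero R"
    then have ne: "support R x \<noteq> {}" by (auto simp: support_def fzero_def fun_eq_iff)
    have fin: "finite (support R x)" and sE: "support R x \<subseteq> E" using x by (auto simp: finsupp_iff)
    have wf: "wf (W\<inverse> \<inter> rk ` support R x \<times> rk ` support R x)"
      by (rule finite_acyclic_wf)
        (use fin W wf_acyclic acyclic_converse in \<open>auto intro: acyclic_subset\<close>)
    obtain p0 where "p0 \<in> support R x" using ne by blast
    then have "rk p0 \<in> rk ` support R x" by blast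
    then obtain z where z: "z \<in> rk ` support R x"
      "\<And>y. (y, z) \<in> W\<inverse> \<inter> rk ` support R x \<times> rk ` support R x \<Longrightarrow> y \<notin> rk ` support R x"
      by (rule wfE_min[OF wf]) blast
    then obtain p where p: "p \<in> support R x" and max: "\<And>q. q \<in> support R x \<Longrightarrow> (rk p, rk q) \<notin> W"
      by blast
    have "linear R (free_mod R (support R x)) (free_mod R {q \<in> E. \<exists>p \<in> support R x. (rk q, rk p) \<in> W}) n"
    proof (rule lin_range)
      show "linear R (free_mod R (support R x)) (free_mod R E) n" by (rule lin_sub[OF n sE])
      show "n (basis_vec R q) \<in> finsupp R {q \<in> E. \<exists>p \<in> support R x. (rk q, rk p) \<in> W}" if "q \<in> support R x" for q
        unfolding n_def by (rule finsupp_monoD[OF N]) (use that sE in auto)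
    qed
    then have "n x \<in> finsupp R {q \<in> E. \<exists>p \<in> support R x. (rk q, rk p) \<in> W}"
      using finsupp_subset_supp[OF x] by (rule lin_closed)
    then have "n x p = \<zero>" using max by (intro finsupp_outside) auto
    then have "U x p = x p" using Un[OF x] finsupp_coeff[OF x] by (simp add: fadd_def)
    then show False using Ux p by (simp add: fzero_def support_def)
  qed
  show "inj_on U (finsupp R E)"
  proof (rule inj_onI)
    fix x y assume x: "x \<in> finsupp R E" and y: "y \<in> finsupp R E" and eq: "U x = U y"
    have "U (fadd R x (fneg R y)) = fadd R (U x) (fneg R (U y))"
      using lin_add[OF U x, of "fneg R y"] lin_uminus[OF free_mod_module free_mod_module U y] y lin_closed[OF U y] by simp
    also have "\<dots> = fzero R"
      unfolding eq using finsupp_coeff[OF lin_closed[OF U y]] by (auto simp: fadd_def fneg_def fzero_def r_neg)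
    finally have "fadd R x (fneg R y) = fzero R" using ker x y by simp
    then have "x b \<oplus> \<ominus> y b = \<zero>" for b by (simp add: fadd_def fneg_def fzero_def fun_eq_iff)
    then show "x = y" using finsupp_coeff[OF x] finsupp_coeff[OF y]
      by (metis ext minus_minus minus_equality a_inv_closed)
  qed
  have sub: "U ` finsupp R E \<subseteq> finsupp R E" using lin_closed[OF U] by blast
  have im: "x \<in> U ` finsupp R E" if x: "x \<in> finsupp R S" and bs: "\<And>b. b \<in> S \<Longrightarrow> basis_vec R b \<in> U ` finsupp R E" for x S
    using x
  proof (induction rule: free_mod_induct)
    case zero
    show ?case using lin_zero[OF free_mod_module free_mod_module U] by (intro image_eqI[of _ _ "fzero R"]) simp_all
  next
    case (base b r)
    then obtain y where "y \<in> finsupp R E" "basis_vec R b = U y" using bs by blast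
    then show ?case using base lin_ract[OF U, of y r] by (intro image_eqI[of _ _ "fract R y r"]) simp_all
  next
    case (add x y)
    then obtain x' y' where "x' \<in> finsupp R E" "x = U x'" "y' \<in> finsupp R E" "y = U y'" by blast
    then show ?case using lin_add[OF U, of x' y'] by (intro image_eqI[of _ _ "fadd R x' y'"]) simp_all
  qed
  have base: "p \<in> E \<Longrightarrow> basis_vec R p \<in> U ` finsupp R E" for p
  proof (induction "rk p" arbitrary: p rule: wf_induct_rule[OF W(1)])
    case (1 p)
    then have "n (basis_vec R p) \<in> U ` finsupp R E"
      unfolding n_def by (intro im[OF N[OF 1(2)]]) auto
    then obtain y where y: "y \<in> finsupp R E" "n (basis_vec R p) = U y" by blast
    have bp: "basis_vec R p \<in> finsupp R E" using 1(2) by simp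
    have "U (fadd R (basis_vec R p) (fneg R y)) = fadd R (U (basis_vec R p)) (fneg R (U y))"
      using lin_add[OF U bp, of "fneg R y"] lin_uminus[OF free_mod_module free_mod_module U y(1)] y(1) lin_closed[OF U y(1)] by simp
    also have "\<dots> = basis_vec R p"
      unfolding Un[OF bp] y(2) using finsupp_coeff[OF lin_closed[OF U y(1)]] finsupp_coeff[OF bp]
      by (auto simp: fadd_def fneg_def fun_eq_iff a_assoc r_neg)
    finally show ?case using bp y(1) by (intro image_eqI[of _ _ "fadd R (basis_vec R p) (fneg R y)"]) simp_all
  qed
  show "U ` finsupp R E = finsupp R E" using sub im[OF _ base] by blast
qed

end

section \<open>Maps of based complexes\<close>

definition based_map :: "('r, 'b) ring_scheme \<Rightarrow> 'k set \<Rightarrow> ('k \<Rightarrow> int) \<Rightarrow> ('k \<Rightarrow> 'k \<Rightarrow> 'r) \<Rightarrow>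
    'l set \<Rightarrow> ('l \<Rightarrow> int) \<Rightarrow> ('l \<Rightarrow> 'l \<Rightarrow> 'r) \<Rightarrow> (('k \<Rightarrow> 'r) \<Rightarrow> 'l \<Rightarrow> 'r) \<Rightarrow> bool" where
  "based_map R B deg D B' deg' D' u \<longleftrightarrow> linear R (free_mod R B) (free_mod R B') u \<and>
     (\<forall>b \<in> B. u (basis_vec R b) \<in> finsupp R {c \<in> B'. deg' c = deg b}) \<and>
     (\<forall>b \<in> B. u (flift R D (basis_vec R b)) = flift R D' (u (basis_vec R b)))"

lemma (in ring) dgmap_chain_map:
  assumes "based_complex R B deg D" "based_complex R B' deg' D'" "based_map R B deg D B' deg' D' u"
  shows "chain_map R (subquot R deg D B) (subquot R deg' D' B') (\<lambda>n. u)"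
proof -
  interpret X: based_cplx R B deg D by standard (rule assms(1))
  interpret Y: based_cplx R B' deg' D' by standard (rule assms(2))
  have u: "linear R (free_mod R B) (free_mod R B') u" using assms(3) by (simp add: based_map_def)
  have eq: "u (X.bd x) = Y.bd (u x)" if "x \<in> finsupp R B" for x
    by (rule lin_ext[OF free_mod_module lin_comp[OF X.bd_lin u] lin_comp[OF u Y.bd_lin] _ that])
      (use assms(3) in \<open>auto simp: based_map_def\<close>)
  show ?thesis unfolding chain_map_def
  proof (intro allI conjI ballI)
    fix n
    have "linear R (free_mod R {b \<in> B. deg b = n}) (free_mod R {b \<in> B'. deg' b = n}) u"
      by (rule lin_range[OF lin_sub[OF u]]) (use assms(3) in \<open>auto simp: based_map_def\<close>)
    then show "linear R (cmodule (subquot R deg D B) n) (cmodule (subquot R deg' D' B') n) u" by simp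
    fix x assume "x \<in> carrier (cmodule (subquot R deg D B) n)"
    then have x: "x \<in> finsupp R B" unfolding subquot_simps by (rule finsupp_monoD) auto
    show "u (cdiff (subquot R deg D B) n x) = cdiff (subquot R deg' D' B') n (u x)"
      using eq[OF x] res_ident[OF X.bd_closed[OF x]] res_ident[OF Y.bd_closed[OF lin_closed[OF u x]]] by simp
  qed
qed

context based_cplx
begin

lemma flift_res:
  assumes "E \<subseteq> B" "x \<in> finsupp R E" shows "flift R (\<lambda>b. res R E (D b)) x = res R E (bd x)"
proof -
  have bdE: "linear R (free_mod R E) (free_mod R B) bd" by (rule lin_sub[OF bd_lin assms(1)])
  have 1: "linear R (free_mod R E) (free_mod R UNIV) (\<lambda>x. res R E (bd x))"
    by (rule lin_weaken[OF lin_comp[OF bdE lin_res]]) simp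
  show ?thesis
    by (rule lift_eq[OF free_mod_module 1 _ assms(2)]) (use assms(1) bd_be in auto)
qed

text \<open>
  The degrees may be shifted, which is used for the Cech resolution without its augmentation.
\<close>

lemma subquotient_based:
  assumes "lc E" "\<And>b. b \<in> E \<Longrightarrow> deg' b = deg b + m"
  shows "based_complex R E deg' (\<lambda>b. res R E (D b))"
  unfolding based_complex_def
proof (intro ballI conjI)
  note EB = loc_closed_subset[OF assms(1)]
  fix b assume b: "b \<in> E"
  have "res R E (D b) \<in> finsupp R (E \<inter> {c \<in> B. deg c = deg b + 1})"
    by (rule res_closed[OF D_deg]) (use b EB in auto)
  then show "res R E (D b) \<in> finsupp R {c \<in> E. deg' c = deg' b + 1}"
    by (rule finsupp_monoD) (use assms(2) b in auto)
  have "basis_vec R b \<in> finsupp R {c \<in> E. deg c = deg b}" using b by simp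
  then have "res R E (bd (res R E (bd (basis_vec R b)))) = fzero R"
    using is_complex_sq[OF subquot_cplx[OF assms(1)], of "basis_vec R b" "deg b"] by simp
  then show "flift R (\<lambda>b. res R E (D b)) (res R E (D b)) = fzero R"
    using flift_res[OF EB, of "res R E (D b)"] bd_be[of b] b EB D_closed[of b] by auto
qed

end

section \<open>The Cech resolution\<close>

context ring
begin

lemma fneg_fzero [simp]: "fneg R (fzero R) = fzero R"
  by (auto simp: fneg_def fzero_def)

lemma fadd_fzero_right: "x \<in> finsupp R E \<Longrightarrow> fadd R x (fzero R) = x"
  using finsupp_coeff[of x R E] by (auto simp: fadd_def fzero_def fun_eq_iff)

lemma fadd_fzero_left: "x \<in> finsupp R E \<Longrightarrow> fadd R (fzero R) x = x"
  using finsupp_coeff[of x R E] by (auto simp: fadd_def fzero_def fun_eq_iff)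

lemma fadd_fneg: "x \<in> finsupp R E \<Longrightarrow> fadd R x (fneg R x) = fzero R"
  using finsupp_coeff[of x R E] by (auto simp: fadd_def fneg_def fzero_def fun_eq_iff r_neg)

lemma lin_fadd: "linear R (free_mod R E) (free_mod R E') f \<Longrightarrow> x \<in> finsupp R E \<Longrightarrow> y \<in> finsupp R E \<Longrightarrow> f (fadd R x y) = fadd R (f x) (f y)"
  using lin_add[of R "free_mod R E" "free_mod R E'" f x y] by simp

lemma lin_fneg: "linear R (free_mod R E) (free_mod R E') f \<Longrightarrow> x \<in> finsupp R E \<Longrightarrow> f (fneg R x) = fneg R (f x)"
  using lin_uminus[OF free_mod_module free_mod_module, of E E' f x] lin_closed[of R "free_mod R E" "free_mod R E'" f x] by simp

lemma lin_fzero: "linear R (free_mod R E) (free_mod R E') f \<Longrightarrow> f (fzero R) = fzero R"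
  using lin_zero[OF free_mod_module free_mod_module, of E E' f] by simp

lemma lin_fadd_fun:
  "linear R (free_mod R E) (free_mod R E') f \<Longrightarrow> linear R (free_mod R E) (free_mod R E') g \<Longrightarrow> linear R (free_mod R E) (free_mod R E') (\<lambda>x. fadd R (f x) (g x))"
  using lin_plus[OF free_mod_module, of "free_mod R E" E' f g] by simp

lemma lin_fneg_fun:
  assumes f: "linear R (free_mod R E) (free_mod R E') f" shows "linear R (free_mod R E) (free_mod R E') (\<lambda>x. fneg R (f x))"
  by (rule lin_cong[OF free_mod_module lin_neg[OF free_mod_module f]]) (use lin_closed[OF f] in auto)

lemma cancel_outer:
  assumes "x \<in> carrier R" "p \<in> carrier R" "h \<in> carrier R"
  shows "((x \<oplus> \<ominus> p) \<oplus> h) \<oplus> \<ominus> x = h \<oplus> \<ominus> p"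
proof -
  have "(x \<oplus> \<ominus> p) \<oplus> h = (h \<oplus> \<ominus> p) \<oplus> x" using assms by (simp add: a_ac)
  then show ?thesis using assms by (simp add: a_assoc r_neg)
qed

end

text \<open>
  A cover of the basis by countable subcomplexes \<open>cov i\<close>, and a choice \<open>r b\<close> of a member of the cover containing \<open>b\<close>
  such that the differential never increases the choice with respect to the well-founded relation \<open>W\<close>.
\<close>

locale covered_cplx = based_cplx R B deg D for R (structure) and B :: "'k set" and deg D +
  fixes cov :: "'k \<Rightarrow> 'k set" and r :: "'k \<Rightarrow> 'k" and W :: "'k rel"
  assumes cov: "\<And>i. i \<in> B \<Longrightarrow> closed (cov i)" "\<And>i. i \<in> B \<Longrightarrow> countable (cov i)"
    and r: "\<And>b. b \<in> B \<Longrightarrow> r b \<in> B" "\<And>b. b \<in> B \<Longrightarrow> b \<in> cov (r b)"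
    and W: "wf W" "trans W"
    and r_D: "\<And>b c. b \<in> B \<Longrightarrow> c \<in> support R (D b) \<Longrightarrow> r c = r b \<or> (r c, r b) \<in> W"
begin

definition emb :: "('k \<Rightarrow> 'a) \<Rightarrow> 'k \<times> 'k list \<Rightarrow> 'a" where
  "emb = flift R (\<lambda>b. basis_vec R (b, []))"

definition prepend :: "'k \<Rightarrow> ('k \<times> 'k list \<Rightarrow> 'a) \<Rightarrow> 'k \<times> 'k list \<Rightarrow> 'a" where
  "prepend i = flift R (\<lambda>p. basis_vec R (fst p, i # snd p))"

text \<open>
  The augmented Cech complex of the cover has basis elements \<open>(b, [i\<^sub>0, \<dots>, i\<^sub>n])\<close> with \<open>b\<close> in all \<open>cov i\<^sub>k\<close>; index lists may
  contain repetitions.  The recursion prepends one index at a time, as in the mapping cone of the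
  inclusion of an intersection: \<open>d(i \<cdot> y) = y - i \<cdot> d y\<close>.  The sign at the empty list makes the two maps \<open>\<sigma>\<close> and \<open>\<delta>\<close> below chain maps rather than
  anti-chain maps.
\<close>

primrec cech_diff :: "'k \<Rightarrow> 'k list \<Rightarrow> 'k \<times> 'k list \<Rightarrow> 'a" where
  "cech_diff b [] = emb (fneg R (D b))"
| "cech_diff b (i # l) = fadd R (basis_vec R (b, l)) (fneg R (prepend i (cech_diff b l)))"

definition cech :: "'k \<times> 'k list \<Rightarrow> 'k \<times> 'k list \<Rightarrow> 'a" where
  "cech p = cech_diff (fst p) (snd p)"

definition L :: "('k \<times> 'k list) set" where
  "L = {(b, l). b \<in> B \<and> set l \<subseteq> B \<and> (\<forall>i \<in> set l. b \<in> cov i)}"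

definition degL :: "'k \<times> 'k list \<Rightarrow> int" where
  "degL p = deg (fst p) - int (length (snd p))"

text \<open>
  What can occur in the differential of \<open>(b, l)\<close>: either an index is deleted, or \<open>b\<close> is replaced by an element occurring in its differential.
\<close>

definition near :: "'k \<Rightarrow> 'k list \<Rightarrow> ('k \<times> 'k list) set" where
  "near b l = {p \<in> L. degL p = deg b - int (length l) + 1 \<and>
     (snd p = l \<or> length (snd p) < length l) \<and> (fst p = b \<or> fst p \<in> support R (D b))}"

lemma supp_D: "b \<in> B \<Longrightarrow> support R (D b) \<subseteq> {c \<in> B. deg c = deg b + 1}"
  using D_deg[of b] by (auto simp: finsupp_iff)

lemma supp_D_cov: "i \<in> B \<Longrightarrow> b \<in> cov i \<Longrightarrow> support R (D b) \<subseteq> cov i"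
  using cov(1)[of i] by (auto simp: closed_in_def finsupp_iff)

lemma emb_lin: "linear R (free_mod R B) (free_mod R {p \<in> L. snd p = []}) emb"
  unfolding emb_def by (rule flift_lin) (auto simp: L_def intro!: basis_vec_closed)

lemma emb_lin_L: "linear R (free_mod R B) (free_mod R L) emb"
  by (rule lin_weaken[OF emb_lin]) auto

lemma emb_be: "emb (basis_vec R b) = basis_vec R (b, [])"
  unfolding emb_def by (rule flift_be[where E = UNIV]) simp

lemma pre_be: "prepend i (basis_vec R p) = basis_vec R (fst p, i # snd p)"
  unfolding prepend_def by (rule flift_be[where E = UNIV]) simp

lemma pre_lin:
  "i \<in> B \<Longrightarrow> linear R (free_mod R {p \<in> L. fst p \<in> cov i}) (free_mod R L) (prepend i)"
  unfolding prepend_def by (rule flift_lin) (auto simp: L_def intro!: basis_vec_closed)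

lemma CD_near: "(b, l) \<in> L \<Longrightarrow> cech_diff b l \<in> finsupp R (near b l)"
proof (induction l)
  case Nil
  then have b: "b \<in> B" by (auto simp: L_def)
  have "linear R (free_mod R (support R (D b))) (free_mod R (near b [])) emb"
    unfolding emb_def
    by (rule flift_lin) (use supp_D[OF b] in \<open>auto simp: near_def L_def degL_def intro!: basis_vec_closed\<close>)
  moreover have "fneg R (D b) \<in> finsupp R (support R (D b))"
    using finsupp_subset_supp[OF D_closed[OF b]] by simp
  ultimately have "emb (fneg R (D b)) \<in> finsupp R (near b [])" by (rule lin_closed)
  then show ?case by simp
next
  case (Cons i l)
  then have L: "(b, l) \<in> L" and i: "i \<in> B" "b \<in> cov i" and b: "b \<in> B" by (auto simp: L_def)
  have "linear R (free_mod R (near b l)) (free_mod R (near b (i # l))) (prepend i)"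
    unfolding prepend_def
  proof (rule flift_lin, rule basis_vec_closed)
    fix p assume "p \<in> near b l"
    then show "(fst p, i # snd p) \<in> near b (i # l)"
      using supp_D_cov[OF i] i by (auto simp: near_def L_def degL_def)
  qed
  then have "prepend i (cech_diff b l) \<in> finsupp R (near b (i # l))"
    using Cons.IH[OF L] by (rule lin_closed)
  moreover have "basis_vec R (b, l) \<in> finsupp R (near b (i # l))"
    using L by (intro basis_vec_closed) (auto simp: near_def degL_def)
  ultimately show ?case by simp
qed

lemma near_L: "near b l \<subseteq> L" by (auto simp: near_def)

abbreviation "bdL \<equiv> flift R cech"

lemma bdL_lin: "linear R (free_mod R L) (free_mod R L) bdL"
proof (rule flift_lin)
  show "cech p \<in> finsupp R L" if "p \<in> L" for p
    using CD_near[of "fst p" "snd p"] that near_L unfolding cech_def by (auto intro: finsupp_monoD)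
qed

lemma bdL_be: "p \<in> L \<Longrightarrow> bdL (basis_vec R p) = cech_diff (fst p) (snd p)"
  using CD_near[of "fst p" "snd p"] by (subst flift_be[where E = "near (fst p) (snd p)"]) (auto simp: cech_def)

lemma bdL_emb: "x \<in> finsupp R B \<Longrightarrow> bdL (emb x) = fneg R (emb (bd x))"
proof (rule lin_ext[OF free_mod_module lin_comp[OF emb_lin_L bdL_lin] lin_fneg_fun[OF lin_comp[OF bd_lin emb_lin_L]]])
  fix b assume b: "b \<in> B"
  then have "(b, []) \<in> L" by (auto simp: L_def)
  then show "bdL (emb (basis_vec R b)) = fneg R (emb (bd (basis_vec R b)))"
    by (simp add: emb_be bdL_be bd_be[OF b] lin_fneg[OF emb_lin D_closed[OF b]])
qed

lemma near_cov: "i \<in> B \<Longrightarrow> b \<in> cov i \<Longrightarrow> near b l \<subseteq> {p \<in> L. fst p \<in> cov i}"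
  using supp_D_cov[of i b] by (auto simp: near_def)

lemma bdL_lin_cov:
  assumes i: "i \<in> B"
  shows "linear R (free_mod R {p \<in> L. fst p \<in> cov i}) (free_mod R {p \<in> L. fst p \<in> cov i}) bdL"
proof (rule flift_lin)
  fix p assume p: "p \<in> {p \<in> L. fst p \<in> cov i}"
  show "cech p \<in> finsupp R {p \<in> L. fst p \<in> cov i}"
    using CD_near[of "fst p" "snd p"] near_cov[OF i, of "fst p" "snd p"] p
    unfolding cech_def by (auto intro: finsupp_monoD)
qed

lemma bdL_pre:
  assumes i: "i \<in> B" and x: "x \<in> finsupp R {p \<in> L. fst p \<in> cov i}"
  shows "bdL (prepend i x) = fadd R x (fneg R (prepend i (bdL x)))"
proof (rule lin_ext[OF free_mod_module lin_comp[OF pre_lin[OF i] bdL_lin] _ _ x])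
  have idl: "linear R (free_mod R {p \<in> L. fst p \<in> cov i}) (free_mod R L) (\<lambda>x. x)"
    using finsupp_mono[of "{p \<in> L. fst p \<in> cov i}" L R] by (auto simp: linear_def)
  show "linear R (free_mod R {p \<in> L. fst p \<in> cov i}) (free_mod R L) (\<lambda>x. fadd R x (fneg R (prepend i (bdL x))))"
    by (intro lin_fadd_fun[OF idl] lin_fneg_fun lin_comp[OF bdL_lin_cov[OF i] pre_lin[OF i]])
  fix p assume p: "p \<in> {p \<in> L. fst p \<in> cov i}"
  then have "(fst p, i # snd p) \<in> L" using i by (auto simp: L_def)
  then show "bdL (prepend i (basis_vec R p)) = fadd R (basis_vec R p) (fneg R (prepend i (bdL (basis_vec R p))))"
    using p by (simp add: pre_be bdL_be)
qed

lemma bdL_CD: "(b, l) \<in> L \<Longrightarrow> bdL (cech_diff b l) = fzero R"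
proof (induction l)
  case Nil
  then have b: "b \<in> B" by (auto simp: L_def)
  have "bd (fneg R (D b)) = fneg R (bd (D b))"
    by (rule lin_fneg[OF bd_lin D_closed[OF b]])
  also have "\<dots> = fzero R"
    using bd_bd[of "basis_vec R b"] b by (simp add: bd_be)
  finally show ?case
    using bdL_emb[of "fneg R (D b)"] D_closed[OF b] lin_fzero[OF emb_lin] by simp
next
  case (Cons i l)
  then have L: "(b, l) \<in> L" and i: "i \<in> B" "b \<in> cov i" and b: "b \<in> B" by (auto simp: L_def)
  have cech_diff: "cech_diff b l \<in> finsupp R {p \<in> L. fst p \<in> cov i}"
    using CD_near[OF L] near_cov[OF i] by (rule finsupp_monoD)
  have CDL: "cech_diff b l \<in> finsupp R L" using cech_diff by (rule finsupp_monoD) auto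
  have prepend: "prepend i (cech_diff b l) \<in> finsupp R L" by (rule lin_closed[OF pre_lin[OF i(1)] cech_diff])
  have "bdL (cech_diff b (i # l)) = fadd R (bdL (basis_vec R (b, l))) (bdL (fneg R (prepend i (cech_diff b l))))"
    using lin_fadd[OF bdL_lin, of "basis_vec R (b, l)" "fneg R (prepend i (cech_diff b l))"] L prepend by simp
  also have "\<dots> = fadd R (cech_diff b l) (fneg R (bdL (prepend i (cech_diff b l))))"
    using bdL_be[OF L] lin_fneg[OF bdL_lin prepend] by simp
  also have "bdL (prepend i (cech_diff b l)) = cech_diff b l"
    using bdL_pre[OF i(1) cech_diff] Cons.IH[OF L] lin_fzero[OF pre_lin[OF i(1)]] fadd_fzero_right[OF cech_diff] by simp
  also have "fadd R (cech_diff b l) (fneg R (cech_diff b l)) = fzero R" by (rule fadd_fneg[OF cech_diff])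
  finally show ?case .
qed

lemma cech_based: "based_complex R L degL cech"
  unfolding based_complex_def
proof (intro ballI conjI)
  fix p assume p: "p \<in> L"
  have "near (fst p) (snd p) \<subseteq> {c \<in> L. degL c = degL p + 1}"
    by (auto simp: near_def degL_def)
  then show "cech p \<in> finsupp R {c \<in> L. degL c = degL p + 1}"
    unfolding cech_def using CD_near[of "fst p" "snd p"] p by (auto intro: finsupp_monoD)
  show "bdL (cech p) = fzero R" using bdL_CD[of "fst p" "snd p"] p by (simp add: cech_def)
qed

sublocale L: based_cplx R L degL cech
  by standard (rule cech_based)

text \<open>
  Prepending \<open>r b\<close> would be a contraction of the augmented complex if \<open>r\<close> were constant.
  In general \<open>d h + h d\<close>, the map \<open>U\<close> below, differs from the identity by terms in which \<open>b\<close> is replaced by some \<open>c\<close> occurring in its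
  differential with \<open>r c \<noteq> r b\<close>, hence of smaller rank.
\<close>

definition h :: "('k \<times> 'k list \<Rightarrow> 'a) \<Rightarrow> 'k \<times> 'k list \<Rightarrow> 'a" where
  "h = flift R (\<lambda>p. basis_vec R (fst p, r (fst p) # snd p))"

definition Z :: "('k \<times> 'k list) set" where "Z = {p \<in> L. snd p \<noteq> []}"

definition U :: "('k \<times> 'k list \<Rightarrow> 'a) \<Rightarrow> 'k \<times> 'k list \<Rightarrow> 'a" where
  "U x = fadd R (bdL (h x)) (h (bdL x))"

lemma Z_L: "Z \<subseteq> L" by (auto simp: Z_def)

lemma h_be: "h (basis_vec R p) = basis_vec R (fst p, r (fst p) # snd p)"
  unfolding h_def by (rule flift_be[where E = UNIV]) simp

lemma h_in_L: "p \<in> L \<Longrightarrow> (fst p, r (fst p) # snd p) \<in> L"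
  using r by (auto simp: L_def)

lemma h_lin: "linear R (free_mod R L) (free_mod R Z) h"
  unfolding h_def by (rule flift_lin) (use h_in_L in \<open>auto simp: Z_def intro!: basis_vec_closed\<close>)

lemma h_lin_L: "linear R (free_mod R L) (free_mod R L) h"
  by (rule lin_weaken[OF h_lin Z_L])

lemma h_lin_deg: "linear R (free_mod R {p \<in> L. degL p = n}) (free_mod R {p \<in> L. degL p = n - 1}) h"
  unfolding h_def by (rule flift_lin) (use h_in_L in \<open>auto simp: degL_def intro!: basis_vec_closed\<close>)

lemma U_lin: "linear R (free_mod R L) (free_mod R L) U"
  unfolding U_def by (intro lin_fadd_fun lin_comp[OF h_lin_L bdL_lin] lin_comp[OF bdL_lin h_lin_L])

lemma U_lin_deg: "linear R (free_mod R {p \<in> L. degL p = n}) (free_mod R {p \<in> L. degL p = n}) U"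
  unfolding U_def
  using lin_comp[OF h_lin_deg[of n] L.bd_deg[of "n - 1"]] lin_comp[OF L.bd_deg[of n] h_lin_deg[of "n + 1"]]
  by (intro lin_fadd_fun) simp_all

text \<open>
  With \<open>y\<close> the differential of \<open>(b, l)\<close>, the error is \<open>h y - (r b) \<cdot> y\<close>.  On basis elements \<open>(c, l')\<close> with \<open>r c = r b\<close> it vanishes.
\<close>

lemma U_unipotent:
  assumes p: "p \<in> L"
  shows "fadd R (U (basis_vec R p)) (fneg R (basis_vec R p)) \<in> finsupp R {q \<in> L. (r (fst q), r (fst p)) \<in> W}"
proof -
  obtain b l where bl: "p = (b, l)" by (cases p)
  have L: "(b, l) \<in> L" and b: "b \<in> B" using p bl by (auto simp: L_def)
  have rb: "r b \<in> B" "b \<in> cov (r b)" using r b by auto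
  define y where "y = cech_diff b l"
  have y: "y \<in> finsupp R (near b l)" unfolding y_def by (rule CD_near[OF L])
  have y_cov: "y \<in> finsupp R {p \<in> L. fst p \<in> cov (r b)}" by (rule finsupp_monoD[OF y near_cov[OF rb]])
  have yL: "y \<in> finsupp R L" by (rule finsupp_monoD[OF y near_L])
  have prey: "prepend (r b) y \<in> finsupp R L" by (rule lin_closed[OF pre_lin[OF rb(1)] y_cov])
  have hy: "h y \<in> finsupp R L" by (rule lin_closed[OF h_lin_L yL])
  have "U (basis_vec R p) = fadd R (fadd R (basis_vec R p) (fneg R (prepend (r b) y))) (h y)"
    using h_in_L[OF p] bdL_be[OF p] bdL_be[OF h_in_L[OF p]] by (simp add: U_def h_be bl y_def)
  moreover have "basis_vec R p \<in> finsupp R L" using p by simp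
  ultimately have eq: "fadd R (U (basis_vec R p)) (fneg R (basis_vec R p)) = fadd R (h y) (fneg R (prepend (r b) y))"
    using cancel_outer[OF finsupp_coeff finsupp_coeff[OF prey] finsupp_coeff[OF hy], of "basis_vec R p" L]
    by (simp add: fadd_def fneg_def fun_eq_iff)
  have "linear R (free_mod R (near b l)) (free_mod R {q \<in> L. (r (fst q), r b) \<in> W}) (\<lambda>y. fadd R (h y) (fneg R (prepend (r b) y)))"
  proof (rule lin_range)
    show "linear R (free_mod R (near b l)) (free_mod R L) (\<lambda>y. fadd R (h y) (fneg R (prepend (r b) y)))"
      by (intro lin_fadd_fun lin_fneg_fun lin_sub[OF h_lin_L near_L] lin_sub[OF pre_lin[OF rb(1)] near_cov[OF rb]])
    fix q assume q: "q \<in> near b l"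
    then have qL: "q \<in> L" by (auto simp: near_def)
    have "fst q = b \<or> fst q \<in> support R (D b)" using q by (auto simp: near_def)
    then consider "r (fst q) = r b" | "(r (fst q), r b) \<in> W" using r_D[OF b] by blast
    then show "fadd R (h (basis_vec R q)) (fneg R (prepend (r b) (basis_vec R q))) \<in> finsupp R {q \<in> L. (r (fst q), r b) \<in> W}"
    proof cases
      case 1
      then show ?thesis using fadd_fneg[of "basis_vec R (fst q, r b # snd q)" UNIV] by (simp add: h_be pre_be)
    next
      case 2
      have "(fst q, r b # snd q) \<in> L"
        using qL near_cov[OF rb] q rb by (auto simp: L_def)
      then show ?thesis using 2 h_in_L[OF qL] by (auto simp: h_be pre_be intro!: fadd_closed fneg_closed basis_vec_closed)
    qed
  qed
  from lin_closed[OF this y] show ?thesis unfolding eq by (simp add: bl)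
qed

lemma U_bij: "bij_betw U (finsupp R L) (finsupp R L)"
  by (rule unipotent_bij[OF U_lin W, where rk = "\<lambda>p. r (fst p)"]) (rule U_unipotent)

text \<open>
  Applied to each degree separately, so that the inverse is homogeneous too.
\<close>

lemma U_bij_deg: "bij_betw U (finsupp R {p \<in> L. degL p = n}) (finsupp R {p \<in> L. degL p = n})"
proof (rule unipotent_bij[OF U_lin_deg W, where rk = "\<lambda>p. r (fst p)"])
  fix p assume p: "p \<in> {p \<in> L. degL p = n}"
  then have "fadd R (U (basis_vec R p)) (fneg R (basis_vec R p)) \<in> finsupp R {p \<in> L. degL p = n}"
    using lin_closed[OF U_lin_deg, of "basis_vec R p" n] by simp
  from finsupp_Int[OF this U_unipotent[of p]] p
  show "fadd R (U (basis_vec R p)) (fneg R (basis_vec R p)) \<in> finsupp R {q \<in> {p \<in> L. degL p = n}. (r (fst q), r (fst p)) \<in> W}"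
    by (auto intro: finsupp_monoD)
qed

definition V :: "('k \<times> 'k list \<Rightarrow> 'a) \<Rightarrow> 'k \<times> 'k list \<Rightarrow> 'a" where
  "V = inv_into (finsupp R L) U"

lemma UV: "x \<in> finsupp R L \<Longrightarrow> U (V x) = x"
  unfolding V_def using U_bij by (simp add: bij_betw_inv_into_right)

lemma VU: "x \<in> finsupp R L \<Longrightarrow> V (U x) = x"
  unfolding V_def using U_bij by (simp add: bij_betw_inv_into_left)

lemma V_closed: "x \<in> finsupp R L \<Longrightarrow> V x \<in> finsupp R L"
  unfolding V_def using bij_betw_inv_into[OF U_bij] by (auto simp: bij_betw_def)

lemma V_lin: "linear R (free_mod R L) (free_mod R L) V"
proof (rule linearI)
  fix x y assume x: "x \<in> finsupp R L" and y: "y \<in> finsupp R L"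
  have "U (fadd R (V x) (V y)) = fadd R x y"
    using lin_fadd[OF U_lin V_closed[OF x] V_closed[OF y]] UV x y by simp
  then show "V (x \<oplus>\<^bsub>free_mod R L\<^esub> y) = V x \<oplus>\<^bsub>free_mod R L\<^esub> V y"
    using VU[of "fadd R (V x) (V y)"] V_closed x y by simp
next
  fix x s assume x: "x \<in> finsupp R L" and s: "s \<in> carrier R"
  have "U (fract R (V x) s) = fract R x s"
    using lin_ract[OF U_lin, of "V x" s] V_closed[OF x] s UV[OF x] by simp
  then show "V (ract (free_mod R L) x s) = ract (free_mod R L) (V x) s"
    using VU[of "fract R (V x) s"] V_closed[OF x] s by simp
qed (simp add: V_closed)

lemma V_deg:
  assumes x: "x \<in> finsupp R {p \<in> L. degL p = n}" shows "V x \<in> finsupp R {p \<in> L. degL p = n}"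
proof -
  have "x \<in> U ` finsupp R {p \<in> L. degL p = n}"
    using U_bij_deg[of n] x by (simp add: bij_betw_def)
  then obtain y where y: "y \<in> finsupp R {p \<in> L. degL p = n}" "x = U y" by blast
  have "y \<in> finsupp R L" using y(1) by (rule finsupp_monoD) auto
  from VU[OF this] y show ?thesis by simp
qed

lemma U_bdL:
  assumes x: "x \<in> finsupp R L" shows "U (bdL x) = bdL (U x)"
proof -
  have hx: "h x \<in> finsupp R L" and bx: "bdL x \<in> finsupp R L" using lin_closed[OF h_lin_L x] L.bd_closed[OF x] .
  have hbx: "h (bdL x) \<in> finsupp R L" by (rule lin_closed[OF h_lin_L bx])
  have "U (bdL x) = fadd R (bdL (h (bdL x))) (fzero R)"
    unfolding U_def L.bd_bd[OF x] lin_fzero[OF h_lin_L] ..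
  also have "\<dots> = fadd R (fzero R) (bdL (h (bdL x)))"
    unfolding fadd_fzero_right[OF L.bd_closed[OF hbx]] fadd_fzero_left[OF L.bd_closed[OF hbx]] ..
  also have "\<dots> = bdL (U x)"
    unfolding U_def lin_fadd[OF bdL_lin L.bd_closed[OF hx] hbx] L.bd_bd[OF hx] ..
  finally show ?thesis .
qed

lemma V_bdL:
  assumes x: "x \<in> finsupp R L" shows "V (bdL x) = bdL (V x)"
proof -
  have "bdL x = U (bdL (V x))" unfolding U_bdL[OF V_closed[OF x]] UV[OF x] ..
  then show ?thesis using VU[OF L.bd_closed[OF V_closed[OF x]]] by metis
qed

text \<open>
  Since \<open>U\<close> commutes with the differential, \<open>h U\<^sup>-\<^sup>1\<close> is a contraction of the augmented complex.  Its restriction to the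
  augmentation is the section of the resolution \<open>\<delta>\<close>.
\<close>

definition \<sigma> :: "('k \<Rightarrow> 'a) \<Rightarrow> 'k \<times> 'k list \<Rightarrow> 'a" where "\<sigma> x = h (V (emb x))"

definition proj :: "('k \<times> 'k list \<Rightarrow> 'a) \<Rightarrow> 'k \<Rightarrow> 'a" where
  "proj = flift R (\<lambda>p. if snd p = [] then basis_vec R (fst p) else fzero R)"

definition \<delta> :: "('k \<times> 'k list \<Rightarrow> 'a) \<Rightarrow> 'k \<Rightarrow> 'a" where "\<delta> y = proj (bdL y)"

definition degZ :: "'k \<times> 'k list \<Rightarrow> int" where "degZ p = degL p + 1"

definition DZ :: "'k \<times> 'k list \<Rightarrow> 'k \<times> 'k list \<Rightarrow> 'a" where "DZ p = res R Z (cech p)"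

lemma proj_lin: "linear R (free_mod R L) (free_mod R B) proj"
  unfolding proj_def by (rule flift_lin) (auto simp: L_def intro!: basis_vec_closed)

lemma proj_be: "proj (basis_vec R p) = (if snd p = [] then basis_vec R (fst p) else fzero R)"
  unfolding proj_def by (rule flift_be[where E = UNIV]) simp

lemma proj_Z: "x \<in> finsupp R Z \<Longrightarrow> proj x = fzero R"
proof (rule lin_ext[OF free_mod_module lin_sub[OF proj_lin Z_L]])
  show "linear R (free_mod R Z) (free_mod R B) (\<lambda>x. fzero R)"
    using lin_const_zero[OF free_mod_module, of "free_mod R Z" B] by simp
qed (auto simp: proj_be Z_def)

lemma proj_emb: "x \<in> finsupp R B \<Longrightarrow> proj (emb x) = x"
proof (rule lin_ext[OF free_mod_module lin_comp[OF emb_lin_L proj_lin]])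
  show "linear R (free_mod R B) (free_mod R B) (\<lambda>x. x)" by (auto simp: linear_def)
qed (auto simp: emb_be proj_be)

lemma decomp:
  assumes "x \<in> finsupp R L" shows "x = fadd R (res R Z x) (emb (proj x))"
proof (rule lin_ext[OF free_mod_module _ _ _ assms])
  show "linear R (free_mod R L) (free_mod R L) (\<lambda>x. x)" by (auto simp: linear_def)
  show "linear R (free_mod R L) (free_mod R L) (\<lambda>x. fadd R (res R Z x) (emb (proj x)))"
    by (intro lin_fadd_fun lin_weaken[OF lin_res] lin_comp[OF proj_lin emb_lin_L]) auto
  fix p assume p: "p \<in> L"
  show "basis_vec R p = fadd R (res R Z (basis_vec R p)) (emb (proj (basis_vec R p)))"
  proof (cases "snd p = []")
    case True
    then have "p = (fst p, [])" by (cases p) auto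
    then have "basis_vec R (fst p, []) = basis_vec R p" by simp
    moreover have "res R Z (basis_vec R p) = fzero R"
      using True by (auto simp: res_def Z_def fzero_def basis_vec_def fun_eq_iff)
    ultimately show ?thesis
      using True fadd_fzero_left[of "basis_vec R p" UNIV] by (simp add: proj_be emb_be)
  next
    case False
    then have "res R Z (basis_vec R p) = basis_vec R p" using p by (intro res_ident[of _ Z] basis_vec_closed) (auto simp: Z_def)
    then show ?thesis using False lin_fzero[OF emb_lin] fadd_fzero_right[of "basis_vec R p" UNIV] by (simp add: proj_be)
  qed
qed

lemma Z_lc: "L.lc Z"
proof -
  have "L.closed {p \<in> L. snd p = []}" unfolding closed_in_def
  proof (intro conjI ballI)
    fix p assume "p \<in> {p \<in> L. snd p = []}"
    then have p: "(fst p, snd p) \<in> L" "snd p = []" by (cases p; auto)+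
    show "cech p \<in> finsupp R {p \<in> L. snd p = []}"
      unfolding cech_def by (rule finsupp_monoD[OF CD_near[OF p(1)]]) (use p(2) in \<open>auto simp: near_def\<close>)
  qed auto
  moreover have "Z = L - {p \<in> L. snd p = []}" by (auto simp: Z_def)
  ultimately show ?thesis unfolding loc_closed_def using L.B_closed by blast
qed

lemma Z_based: "based_complex R Z degZ DZ"
  unfolding DZ_def by (rule L.subquotient_based[OF Z_lc]) (simp add: degZ_def)

lemma bdZ: "x \<in> finsupp R Z \<Longrightarrow> flift R DZ x = res R Z (bdL x)"
  using L.flift_res[OF Z_L] unfolding DZ_def by simp

lemma \<sigma>_lin: "linear R (free_mod R B) (free_mod R Z) \<sigma>"
  unfolding \<sigma>_def by (rule lin_comp[OF lin_comp[OF emb_lin_L V_lin] h_lin])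

text \<open>
  The contraction identity \<open>d (h V) + (h V) d = 1\<close>, evaluated on the augmentation.
\<close>

lemma bdL_\<sigma>: "x \<in> finsupp R B \<Longrightarrow> bdL (\<sigma> x) = fadd R (emb x) (\<sigma> (bd x))"
proof -
  assume x: "x \<in> finsupp R B"
  note ex = lin_closed[OF emb_lin_L x]
  note vx = V_closed[OF ex]
  have bx: "emb (bd x) \<in> finsupp R L" by (rule lin_closed[OF emb_lin_L bd_closed[OF x]])
  have 1: "emb x = fadd R (bdL (\<sigma> x)) (h (bdL (V (emb x))))"
    using UV[OF ex] by (simp add: U_def \<sigma>_def)
  have 2: "h (bdL (V (emb x))) = fneg R (\<sigma> (bd x))"
    using V_bdL[OF ex] bdL_emb[OF x] lin_fneg[OF V_lin bx] lin_fneg[OF h_lin V_closed[OF bx]]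
    by (simp add: \<sigma>_def)
  have c1: "bdL (\<sigma> x) \<in> finsupp R L" and c2: "\<sigma> (bd x) \<in> finsupp R Z"
    using L.bd_closed[OF finsupp_monoD[OF lin_closed[OF \<sigma>_lin x] Z_L]] lin_closed[OF \<sigma>_lin bd_closed[OF x]] .
  have "fadd R (fadd R (bdL (\<sigma> x)) (fneg R (\<sigma> (bd x)))) (\<sigma> (bd x)) = bdL (\<sigma> x)"
    using finsupp_coeff[OF c1] finsupp_coeff[OF c2] by (auto simp: fadd_def fneg_def fun_eq_iff a_assoc l_neg)
  then show ?thesis using 1 2 by simp
qed

lemma \<delta>_\<sigma>: "x \<in> finsupp R B \<Longrightarrow> \<delta> (\<sigma> x) = x"
proof -
  assume x: "x \<in> finsupp R B"
  have c: "\<sigma> (bd x) \<in> finsupp R Z" by (rule lin_closed[OF \<sigma>_lin bd_closed[OF x]])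
  show ?thesis unfolding \<delta>_def bdL_\<sigma>[OF x]
    using lin_fadd[OF proj_lin lin_closed[OF emb_lin_L x] finsupp_monoD[OF c Z_L]] proj_emb[OF x] proj_Z[OF c]
      fadd_fzero_right[OF x] by simp
qed

lemma \<sigma>_based_map: "based_map R B deg D Z degZ DZ \<sigma>"
  unfolding based_map_def
proof (intro conjI ballI \<sigma>_lin)
  fix b assume b: "b \<in> B"
  have "emb (basis_vec R b) \<in> finsupp R {p \<in> L. degL p = deg b}"
    using b by (auto simp: emb_be L_def degL_def intro!: basis_vec_closed)
  from lin_closed[OF h_lin_deg V_deg[OF this]]
  have "\<sigma> (basis_vec R b) \<in> finsupp R {p \<in> L. degL p = deg b - 1}" by (simp add: \<sigma>_def)
  moreover have "\<sigma> (basis_vec R b) \<in> finsupp R Z" using lin_closed[OF \<sigma>_lin, of "basis_vec R b"] b by simp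
  ultimately have "\<sigma> (basis_vec R b) \<in> finsupp R ({p \<in> L. degL p = deg b - 1} \<inter> Z)" by (rule finsupp_Int)
  then show "\<sigma> (basis_vec R b) \<in> finsupp R {c \<in> Z. degZ c = deg b}"
    by (rule finsupp_monoD) (auto simp: degZ_def)
  have x: "basis_vec R b \<in> finsupp R B" using b by simp
  have "flift R DZ (\<sigma> (basis_vec R b)) = res R Z (fadd R (emb (basis_vec R b)) (\<sigma> (bd (basis_vec R b))))"
    using bdZ[OF lin_closed[OF \<sigma>_lin x]] bdL_\<sigma>[OF x] by simp
  also have "\<dots> = fadd R (res R Z (emb (basis_vec R b))) (res R Z (\<sigma> (bd (basis_vec R b))))"
    by (auto simp: res_def fadd_def fun_eq_iff)
  also have "res R Z (emb (basis_vec R b)) = fzero R"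
    unfolding emb_be by (auto simp: res_def Z_def fzero_def basis_vec_def fun_eq_iff)
  also have "fadd R (fzero R) (res R Z (\<sigma> (bd (basis_vec R b)))) = \<sigma> (bd (basis_vec R b))"
    using res_ident[of "\<sigma> (bd (basis_vec R b))" Z] fadd_fzero_left[of "\<sigma> (bd (basis_vec R b))" Z]
      lin_closed[OF \<sigma>_lin bd_closed[OF x]] by simp
  finally show "\<sigma> (bd (basis_vec R b)) = flift R DZ (\<sigma> (basis_vec R b))" by simp
qed

lemma \<delta>_lin: "linear R (free_mod R L) (free_mod R B) \<delta>"
  unfolding \<delta>_def by (rule lin_comp[OF bdL_lin proj_lin])

text \<open>
  The part of \<open>d d = 0\<close> that lies in the augmentation.
\<close>

lemma \<delta>_based_map: "based_map R Z degZ DZ B deg D \<delta>"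
  unfolding based_map_def
proof (intro conjI ballI)
  show "linear R (free_mod R Z) (free_mod R B) \<delta>" by (rule lin_sub[OF \<delta>_lin Z_L])
  fix p assume p: "p \<in> Z"
  then have pL: "p \<in> L" using Z_L by auto
  have "linear R (free_mod R {q \<in> L. degL q = degL p + 1}) (free_mod R {c \<in> B. deg c = degZ p}) proj"
    unfolding proj_def by (rule flift_lin) (auto simp: L_def degL_def degZ_def intro!: basis_vec_closed)
  from lin_closed[OF this L.D_deg[OF pL]]
  show "\<delta> (basis_vec R p) \<in> finsupp R {c \<in> B. deg c = degZ p}"
    by (simp add: \<delta>_def L.bd_be[OF pL])
  have y: "basis_vec R p \<in> finsupp R Z" "basis_vec R p \<in> finsupp R L" using p pL by simp_all
  define w where "w = bdL (basis_vec R p)"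
  have w: "w \<in> finsupp R L" unfolding w_def by (rule L.bd_closed[OF y(2)])
  have pw: "proj w \<in> finsupp R B" by (rule lin_closed[OF proj_lin w])
  have rw: "res R Z w \<in> finsupp R L" using res_closed'[OF w, of Z] by (rule finsupp_monoD[OF _ Z_L])
  have ew: "emb (proj w) \<in> finsupp R L" and ebw: "emb (bd (proj w)) \<in> finsupp R L"
    using lin_closed[OF emb_lin_L pw] lin_closed[OF emb_lin_L bd_closed[OF pw]] .
  have "fzero R = bdL w" unfolding w_def using L.bd_bd[OF y(2)] by simp
  also have "\<dots> = fadd R (bdL (res R Z w)) (bdL (emb (proj w)))"
    using lin_fadd[OF bdL_lin rw ew] decomp[OF w] by simp
  also have "\<dots> = fadd R (bdL (res R Z w)) (fneg R (emb (bd (proj w))))"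
    using bdL_emb[OF pw] by simp
  finally have 0: "fadd R (bdL (res R Z w)) (fneg R (emb (bd (proj w)))) = fzero R" by simp
  have "bdL (res R Z w) = emb (bd (proj w))"
  proof
    fix q
    have "bdL (res R Z w) q \<oplus> \<ominus> emb (bd (proj w)) q = \<zero>"
      using fun_cong[OF 0, of q] by (simp add: fadd_def fneg_def fzero_def)
    then show "bdL (res R Z w) q = emb (bd (proj w)) q"
      using finsupp_coeff[OF L.bd_closed[OF rw]] finsupp_coeff[OF ebw]
      by (metis minus_minus minus_equality a_inv_closed)
  qed
  then have "\<delta> (res R Z w) = bd (proj w)"
    unfolding \<delta>_def using proj_emb[OF bd_closed[OF pw]] by simp
  then show "\<delta> (flift R DZ (basis_vec R p)) = bd (\<delta> (basis_vec R p))"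
    using bdZ[OF y(1)] by (simp add: w_def \<delta>_def)
qed

lemma DZ_near: "p \<in> Z \<Longrightarrow> DZ p \<in> finsupp R {q \<in> Z. snd q = snd p \<or> length (snd q) < length (snd p)}"
proof -
  assume p: "p \<in> Z"
  then have "cech p \<in> finsupp R (near (fst p) (snd p))"
    using CD_near[of "fst p" "snd p"] Z_L by (auto simp: cech_def)
  then have "DZ p \<in> finsupp R (Z \<inter> near (fst p) (snd p))"
    unfolding DZ_def by (rule res_closed)
  then show ?thesis by (rule finsupp_monoD) (auto simp: near_def)
qed

text \<open>
  For a nonempty list \<open>l\<close> these basis elements lie in one member of the cover.
\<close>

lemma Z_fibre_countable: "countable {p \<in> Z. snd p = l}"
proof (cases l)
  case Nil
  then show ?thesis by (auto simp: Z_def)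
next
  case (Cons i l')
  show ?thesis
  proof (cases "i \<in> B")
    case True
    have "{p \<in> Z. snd p = l} \<subseteq> (\<lambda>b. (b, l)) ` cov i"
      using Cons by (auto simp: Z_def L_def)
    then show ?thesis using cov(2)[OF True] by (meson countable_image countable_subset)
  next
    case False
    then have "{p \<in> Z. snd p = l} = {}" using Cons by (auto simp: Z_def L_def)
    then show ?thesis by (simp only: countable_empty)
  qed
qed

lemma Z_subset: "Z \<subseteq> B \<times> lists B"
  by (auto simp: Z_def L_def)

end

section \<open>The mapping telescope\<close>

text \<open>
  The sublevel sets of \<open>\<rho>\<close> form an increasing sequence of subcomplexes whose union is the whole complex.
\<close>

locale filtered_cplx = based_cplx R B deg D for R (structure) and B :: "'k set" and deg D +
  fixes \<rho> :: "'k \<Rightarrow> nat"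
  assumes rho_D: "\<And>b. b \<in> B \<Longrightarrow> D b \<in> finsupp R {c \<in> B. \<rho> c \<le> \<rho> b}"
begin

definition \<tau> :: "nat \<Rightarrow> ('k \<Rightarrow> 'a) \<Rightarrow> 'k \<times> nat \<times> bool \<Rightarrow> 'a" where
  "\<tau> k = flift R (\<lambda>z. basis_vec R (z, k, False))"

definition \<kappa> :: "nat \<Rightarrow> ('k \<Rightarrow> 'a) \<Rightarrow> 'k \<times> nat \<times> bool \<Rightarrow> 'a" where
  "\<kappa> k = flift R (\<lambda>z. basis_vec R (z, k, True))"

text \<open>
  The telescope of the sequence of sublevel complexes: \<open>(z, k, False)\<close> is the copy of \<open>z\<close> in the \<open>k\<close>-th
  stage and \<open>(z, k, True)\<close> is the cylinder connecting the copies in the stages \<open>k\<close> and \<open>k + 1\<close>.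
\<close>

fun tel_diff :: "'k \<times> nat \<times> bool \<Rightarrow> 'k \<times> nat \<times> bool \<Rightarrow> 'a" where
  "tel_diff (z, k, False) = \<tau> k (D z)"
| "tel_diff (z, k, True) = fadd R (basis_vec R (z, k, False)) (fneg R (fadd R (basis_vec R (z, Suc k, False)) (\<kappa> k (D z))))"

definition T :: "('k \<times> nat \<times> bool) set" where "T = {(z, k, e). z \<in> B \<and> \<rho> z \<le> k}"

fun degT :: "'k \<times> nat \<times> bool \<Rightarrow> int" where
  "degT (z, k, e) = deg z - (if e then 1 else 0)"

definition Bk :: "nat \<Rightarrow> 'k set" where "Bk k = {z \<in> B. \<rho> z \<le> k}"

abbreviation "bd_tel \<equiv> flift R tel_diff"

lemma D_near: "z \<in> B \<Longrightarrow> D z \<in> finsupp R {c \<in> B. \<rho> c \<le> \<rho> z \<and> deg c = deg z + 1}"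
  using finsupp_Int[OF rho_D D_deg, of z] by (auto elim: finsupp_monoD)

lemma D_Bk: "z \<in> Bk k \<Longrightarrow> D z \<in> finsupp R (Bk k)"
  using rho_D[of z] by (auto simp: Bk_def elim!: finsupp_monoD)

lemma bd_Bk: "linear R (free_mod R (Bk k)) (free_mod R (Bk k)) bd"
  by (rule flift_lin) (rule D_Bk)

lemma Bk_B: "Bk k \<subseteq> B" by (auto simp: Bk_def)

lemma Bk_mono: "k \<le> k' \<Longrightarrow> Bk k \<subseteq> Bk k'" by (auto simp: Bk_def)

lemma \<tau>_be: "\<tau> k (basis_vec R z) = basis_vec R (z, k, False)"
  unfolding \<tau>_def by (rule flift_be[where E = UNIV]) simp

lemma \<kappa>_be: "\<kappa> k (basis_vec R z) = basis_vec R (z, k, True)"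
  unfolding \<kappa>_def by (rule flift_be[where E = UNIV]) simp

lemma \<tau>_lin: "E \<subseteq> Bk k \<Longrightarrow> linear R (free_mod R E) (free_mod R {(z, k', e). z \<in> E \<and> k' = k \<and> \<not> e}) (\<tau> k)"
  unfolding \<tau>_def by (rule flift_lin) (auto intro!: basis_vec_closed)

lemma \<kappa>_lin: "E \<subseteq> Bk k \<Longrightarrow> linear R (free_mod R E) (free_mod R {(z, k', e). z \<in> E \<and> k' = k \<and> e}) (\<kappa> k)"
  unfolding \<kappa>_def by (rule flift_lin) (auto intro!: basis_vec_closed)

lemma \<tau>_lin_T: "E \<subseteq> Bk k \<Longrightarrow> linear R (free_mod R E) (free_mod R T) (\<tau> k)"
  by (rule lin_weaken[OF \<tau>_lin]) (auto simp: Bk_def T_def)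

lemma \<kappa>_lin_T: "E \<subseteq> Bk k \<Longrightarrow> linear R (free_mod R E) (free_mod R T) (\<kappa> k)"
  by (rule lin_weaken[OF \<kappa>_lin]) (auto simp: Bk_def T_def)

definition nearT :: "'k \<times> nat \<times> bool \<Rightarrow> ('k \<times> nat \<times> bool) set" where
  "nearT p = {q \<in> T. degT q = degT p + 1 \<and>
     (snd (snd p) \<and> \<not> snd (snd q) \<or> snd q = snd p \<and> fst q \<in> support R (D (fst p)))}"

lemma TD_near: "p \<in> T \<Longrightarrow> tel_diff p \<in> finsupp R (nearT p)"
proof (cases p)
  case (fields z k e)
  assume p: "p \<in> T"
  then have z: "z \<in> Bk k" and zB: "z \<in> B" using fields by (auto simp: T_def Bk_def)
  have Dz: "D z \<in> finsupp R (support R (D z))" using finsupp_subset_supp[OF D_closed[OF zB]] .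
  have sD: "support R (D z) \<subseteq> {c \<in> Bk k. deg c = deg z + 1}"
    using D_near[OF zB] z by (auto simp: finsupp_iff Bk_def)
  show ?thesis
  proof (cases e)
    case False
    have "\<tau> k (D z) \<in> finsupp R (nearT p)"
      by (rule finsupp_monoD[OF lin_closed[OF \<tau>_lin Dz]])
        (use sD fields False in \<open>auto simp: nearT_def T_def Bk_def\<close>)
    then show ?thesis using fields False by simp
  next
    case True
    have "\<kappa> k (D z) \<in> finsupp R (nearT p)"
      by (rule finsupp_monoD[OF lin_closed[OF \<kappa>_lin Dz]])
        (use sD fields True in \<open>auto simp: nearT_def T_def Bk_def\<close>)
    moreover have "basis_vec R (z, k, False) \<in> finsupp R (nearT p)" "basis_vec R (z, Suc k, False) \<in> finsupp R (nearT p)"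
      using z fields True by (auto simp: nearT_def T_def Bk_def intro!: basis_vec_closed)
    ultimately show ?thesis using fields True by simp
  qed
qed

lemma nearT_T: "nearT p \<subseteq> T" by (auto simp: nearT_def)

lemma bdT_lin: "linear R (free_mod R T) (free_mod R T) bd_tel"
  by (rule flift_lin) (use TD_near nearT_T finsupp_monoD in blast)

lemma bdT_be: "p \<in> T \<Longrightarrow> bd_tel (basis_vec R p) = tel_diff p"
  using TD_near flift_be by metis

lemma bdT_\<tau>: "x \<in> finsupp R (Bk k) \<Longrightarrow> bd_tel (\<tau> k x) = \<tau> k (bd x)"
proof (rule lin_ext[OF free_mod_module lin_comp[OF \<tau>_lin_T bdT_lin] lin_comp[OF bd_Bk \<tau>_lin_T]])
  fix z assume z: "z \<in> Bk k"
  then have "(z, k, False) \<in> T" "z \<in> B" by (auto simp: T_def Bk_def)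
  then show "bd_tel (\<tau> k (basis_vec R z)) = \<tau> k (bd (basis_vec R z))"
    by (simp add: \<tau>_be bdT_be bd_be)
qed auto

lemma lin_id_sub: "E \<subseteq> E' \<Longrightarrow> linear R (free_mod R E) (free_mod R E') (\<lambda>x. x)"
  using finsupp_mono[of E E' R] by (auto simp: linear_def)

lemma bdT_\<kappa>: "x \<in> finsupp R (Bk k) \<Longrightarrow> bd_tel (\<kappa> k x) = fadd R (\<tau> k x) (fneg R (fadd R (\<tau> (Suc k) x) (\<kappa> k (bd x))))"
proof (rule lin_ext[OF free_mod_module lin_comp[OF \<kappa>_lin_T bdT_lin]])
  show "linear R (free_mod R (Bk k)) (free_mod R T) (\<lambda>x. fadd R (\<tau> k x) (fneg R (fadd R (\<tau> (Suc k) x) (\<kappa> k (bd x)))))"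
    by (intro lin_fadd_fun lin_fneg_fun \<tau>_lin_T lin_comp[OF bd_Bk \<kappa>_lin_T] Bk_mono) auto
  fix z assume z: "z \<in> Bk k"
  then have "(z, k, True) \<in> T" "z \<in> B" by (auto simp: T_def Bk_def)
  then show "bd_tel (\<kappa> k (basis_vec R z)) = fadd R (\<tau> k (basis_vec R z)) (fneg R (fadd R (\<tau> (Suc k) (basis_vec R z)) (\<kappa> k (bd (basis_vec R z)))))"
    by (simp add: \<tau>_be \<kappa>_be bdT_be bd_be)
qed auto

lemma cancel_telescope:
  assumes "a \<in> carrier R" "b \<in> carrier R"
  shows "a \<oplus> \<ominus> (b \<oplus> (a \<oplus> \<ominus> (b \<oplus> \<zero>))) = \<zero>"
proof -
  have "b \<oplus> (a \<oplus> \<ominus> b) = a" using assms by (simp add: a_lcomm r_neg)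
  then show ?thesis using assms by (simp add: r_neg)
qed

lemma telescope_based: "based_complex R T degT tel_diff"
  unfolding based_complex_def
proof (intro ballI conjI)
  fix p assume p: "p \<in> T"
  show "tel_diff p \<in> finsupp R {c \<in> T. degT c = degT p + 1}"
    using TD_near[OF p] by (rule finsupp_monoD) (auto simp: nearT_def)
  obtain z k e where pe: "p = (z, k, e)" by (cases p)
  then have z: "z \<in> Bk k" and zB: "z \<in> B" using p by (auto simp: T_def Bk_def)
  have Dz: "D z \<in> finsupp R (Bk k)" by (rule D_Bk[OF z])
  have dd: "bd (D z) = fzero R" using bd_bd[of "basis_vec R z"] zB by (simp add: bd_be)
  have t: "\<tau> k (D z) \<in> finsupp R T" and t': "\<tau> (Suc k) (D z) \<in> finsupp R T" and k: "\<kappa> k (D z) \<in> finsupp R T"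
    using lin_closed[OF \<tau>_lin_T Dz, of k] lin_closed[OF \<tau>_lin_T Dz, of "Suc k"] lin_closed[OF \<kappa>_lin_T Dz, of k]
      Bk_mono[of k "Suc k"] by auto
  show "bd_tel (tel_diff p) = fzero R"
  proof (cases e)
    case False
    then show ?thesis using pe bdT_\<tau>[OF Dz] dd lin_fzero[OF \<tau>_lin_T, of "{}" k] by simp
  next
    case True
    have T1: "basis_vec R (z, k, False) \<in> finsupp R T" "basis_vec R (z, Suc k, False) \<in> finsupp R T"
      using z by (auto simp: T_def Bk_def intro!: basis_vec_closed)
    have k0: "\<kappa> k (fzero R) = fzero R" using lin_fzero[OF \<kappa>_lin_T, of "{}" k] by simp
    have "bd_tel (tel_diff p) = fadd R (bd_tel (basis_vec R (z, k, False)))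
        (fneg R (fadd R (bd_tel (basis_vec R (z, Suc k, False))) (bd_tel (\<kappa> k (D z)))))"
      using pe True T1 k by (simp add: lin_fadd[OF bdT_lin] lin_fneg[OF bdT_lin])
    also have "\<dots> = fadd R (\<tau> k (D z)) (fneg R (fadd R (\<tau> (Suc k) (D z))
        (fadd R (\<tau> k (D z)) (fneg R (fadd R (\<tau> (Suc k) (D z)) (fzero R))))))"
      using bdT_be[of "(z, k, False)"] bdT_be[of "(z, Suc k, False)"] z bdT_\<kappa>[OF Dz] dd k0
      by (auto simp: T_def Bk_def)
    also have "\<dots> = fzero R"
      using cancel_telescope[OF finsupp_coeff[OF t] finsupp_coeff[OF t']]
      by (simp add: fadd_def fneg_def fzero_def)
    finally show ?thesis .
  qed
qed

sublocale T: based_cplx R T degT tel_diff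
  by standard (rule telescope_based)

text \<open>
  The sum of the cylinders over \<open>z\<close> from stage \<open>\<rho> z\<close> up to stage \<open>M\<close>.
\<close>

primrec null_step :: "'k \<Rightarrow> nat \<Rightarrow> 'k \<times> nat \<times> bool \<Rightarrow> 'a" where
  "null_step z 0 = fzero R"
| "null_step z (Suc M) = (if \<rho> z \<le> M then fadd R (null_step z M) (basis_vec R (z, M, True)) else fzero R)"

definition H :: "nat \<Rightarrow> ('k \<Rightarrow> 'a) \<Rightarrow> 'k \<times> nat \<times> bool \<Rightarrow> 'a" where
  "H M = flift R (\<lambda>z. null_step z M)"

lemma hz_closed: "z \<in> B \<Longrightarrow> null_step z M \<in> finsupp R {(z', k, e). z' = z \<and> \<rho> z \<le> k \<and> e}"
  by (induction M) (auto intro!: fadd_closed basis_vec_closed)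

lemma H_lin: "E \<subseteq> B \<Longrightarrow> linear R (free_mod R E) (free_mod R {(z, k, e). z \<in> E \<and> \<rho> z \<le> k \<and> e}) (H M)"
  unfolding H_def by (rule flift_lin) (rule finsupp_monoD[OF hz_closed], auto)

lemma H_lin_T: "E \<subseteq> B \<Longrightarrow> linear R (free_mod R E) (free_mod R T) (H M)"
  by (rule lin_weaken[OF H_lin]) (auto simp: T_def)

lemma H_be: "z \<in> B \<Longrightarrow> H M (basis_vec R z) = null_step z M"
  unfolding H_def by (rule flift_be, rule hz_closed)

lemma H_Suc: "x \<in> finsupp R (Bk M) \<Longrightarrow> H (Suc M) x = fadd R (H M x) (\<kappa> M x)"
proof (rule lin_ext[OF free_mod_module H_lin_T])
  show "linear R (free_mod R (Bk M)) (free_mod R T) (\<lambda>x. fadd R (H M x) (\<kappa> M x))"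
    by (intro lin_fadd_fun H_lin_T \<kappa>_lin_T Bk_B) auto
qed (auto simp: H_be \<kappa>_be Bk_def)

text \<open>
  The inclusion of the \<open>M\<close>-th stage, modified by the boundary of \<open>H M\<close>.  It is a chain map for formal reasons, and the
  modification makes it compatible with increasing \<open>M\<close>; the plain inclusions are compatible only up to homotopy.
\<close>

definition S :: "nat \<Rightarrow> ('k \<Rightarrow> 'a) \<Rightarrow> 'k \<times> nat \<times> bool \<Rightarrow> 'a" where
  "S M x = fadd R (\<tau> M x) (fadd R (bd_tel (H M x)) (H M (bd x)))"

lemma S_lin: "linear R (free_mod R (Bk M)) (free_mod R T) (S M)"
  unfolding S_def
  by (intro lin_fadd_fun \<tau>_lin_T lin_comp[OF H_lin_T bdT_lin] lin_comp[OF bd_Bk H_lin_T] Bk_B) auto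

lemma cancel_S:
  assumes "a \<in> carrier R" "b \<in> carrier R" "c \<in> carrier R" "d \<in> carrier R" "e \<in> carrier R"
  shows "b \<oplus> ((c \<oplus> (a \<oplus> \<ominus> (b \<oplus> d))) \<oplus> (e \<oplus> d)) = a \<oplus> (c \<oplus> e)"
proof -
  have "b \<oplus> ((c \<oplus> (a \<oplus> \<ominus> (b \<oplus> d))) \<oplus> (e \<oplus> d)) = (a \<oplus> (c \<oplus> e)) \<oplus> ((b \<oplus> d) \<oplus> \<ominus> (b \<oplus> d))"
    using assms by (simp add: a_ac del: r_neg)
  then show ?thesis using assms by (simp add: r_neg)
qed

text \<open>
  Increasing \<open>M\<close> adds \<open>\<kappa> M\<close> to \<open>H M\<close>, and the boundary of \<open>\<kappa> M\<close> is the difference of two successive inclusions.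
\<close>

lemma S_Suc:
  assumes x: "x \<in> finsupp R (Bk M)" shows "S (Suc M) x = S M x"
proof -
  have bx: "bd x \<in> finsupp R (Bk M)" by (rule lin_closed[OF bd_Bk x])
  have t: "\<tau> M x \<in> finsupp R T" and t': "\<tau> (Suc M) x \<in> finsupp R T" and k: "\<kappa> M x \<in> finsupp R T" and k': "\<kappa> M (bd x) \<in> finsupp R T"
    and h: "H M x \<in> finsupp R T" and h': "H M (bd x) \<in> finsupp R T"
    using lin_closed[OF \<tau>_lin_T x, of M] lin_closed[OF \<tau>_lin_T x, of "Suc M"]
      lin_closed[OF \<kappa>_lin_T x, of M] lin_closed[OF \<kappa>_lin_T bx, of M]
      lin_closed[OF H_lin_T[OF Bk_B] x, of M] lin_closed[OF H_lin_T[OF Bk_B] bx, of M]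
      Bk_mono[of M "Suc M"] by auto
  have "bd_tel (H (Suc M) x) = fadd R (bd_tel (H M x)) (bd_tel (\<kappa> M x))"
    using H_Suc[OF x] lin_fadd[OF bdT_lin h k] by simp
  then show ?thesis
    unfolding S_def H_Suc[OF bx] bdT_\<kappa>[OF x]
    using cancel_S[OF finsupp_coeff[OF t] finsupp_coeff[OF t'] finsupp_coeff[OF T.bd_closed[OF h]] finsupp_coeff[OF k'] finsupp_coeff[OF h']]
    by (simp add: bdT_\<kappa>[OF x] fadd_def fneg_def)
qed

lemma S_stable:
  assumes x: "x \<in> finsupp R (Bk k)" and "k \<le> M" shows "S M x = S k x"
  using assms(2)
proof (induction M rule: dec_induct)
  case (step M)
  then show ?case using S_Suc[of x M] finsupp_monoD[OF x Bk_mono[of k M]] by simp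
qed simp

text \<open>
  The section of the projection \<open>\<pi>\<close> from the telescope; on the sublevel set \<open>M\<close> it agrees with \<open>S M\<close>.
\<close>

definition s :: "('k \<Rightarrow> 'a) \<Rightarrow> 'k \<times> nat \<times> bool \<Rightarrow> 'a" where
  "s = flift R (\<lambda>z. S (\<rho> z) (basis_vec R z))"

lemma s_lin: "linear R (free_mod R B) (free_mod R T) s"
  unfolding s_def by (rule flift_lin) (rule lin_closed[OF S_lin], auto simp: Bk_def intro!: basis_vec_closed)

lemma s_be: "z \<in> B \<Longrightarrow> s (basis_vec R z) = S (\<rho> z) (basis_vec R z)"
  unfolding s_def by (rule flift_be, rule lin_closed[OF S_lin]) (auto simp: Bk_def intro!: basis_vec_closed)

lemma s_eq: "x \<in> finsupp R (Bk M) \<Longrightarrow> s x = S M x"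
proof (rule lin_ext[OF free_mod_module lin_sub[OF s_lin Bk_B] S_lin])
  fix z assume "z \<in> Bk M"
  then show "s (basis_vec R z) = S M (basis_vec R z)"
    using S_stable[of "basis_vec R z" "\<rho> z" M] by (auto simp: s_be Bk_def)
qed

definition \<pi> :: "('k \<times> nat \<times> bool \<Rightarrow> 'a) \<Rightarrow> 'k \<Rightarrow> 'a" where
  "\<pi> = flift R (\<lambda>p. if snd (snd p) then fzero R else basis_vec R (fst p))"

lemma \<pi>_lin: "linear R (free_mod R T) (free_mod R B) \<pi>"
  unfolding \<pi>_def by (rule flift_lin) (auto simp: T_def intro!: basis_vec_closed)

lemma \<pi>_be: "\<pi> (basis_vec R p) = (if snd (snd p) then fzero R else basis_vec R (fst p))"
  unfolding \<pi>_def by (rule flift_be[where E = UNIV]) simp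

lemma \<pi>_\<tau>: "x \<in> finsupp R (Bk k) \<Longrightarrow> \<pi> (\<tau> k x) = x"
  by (rule lin_ext[OF free_mod_module lin_comp[OF \<tau>_lin_T \<pi>_lin] lin_id_sub[OF Bk_B]]) (auto simp: \<tau>_be \<pi>_be)

lemma \<pi>_True: "x \<in> finsupp R {(z, k, e). (z, k, e) \<in> T \<and> e} \<Longrightarrow> \<pi> x = fzero R"
proof (rule lin_ext[OF free_mod_module lin_sub[OF \<pi>_lin]])
  show "linear R (free_mod R {(z, k, e). (z, k, e) \<in> T \<and> e}) (free_mod R B) (\<lambda>x. fzero R)"
    using lin_const_zero[OF free_mod_module, of "free_mod R {(z, k, e). (z, k, e) \<in> T \<and> e}" B] by simp
qed (auto simp: \<pi>_be)

lemma \<pi>_\<kappa>: "x \<in> finsupp R (Bk k) \<Longrightarrow> \<pi> (\<kappa> k x) = fzero R"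
  by (rule \<pi>_True, rule finsupp_monoD[OF lin_closed[OF \<kappa>_lin]]) (auto simp: T_def Bk_def)

lemma \<pi>_H: "x \<in> finsupp R B \<Longrightarrow> \<pi> (H M x) = fzero R"
  by (rule \<pi>_True, rule finsupp_monoD[OF lin_closed[OF H_lin]]) (auto simp: T_def)

lemma \<pi>_bdT: "x \<in> finsupp R T \<Longrightarrow> \<pi> (bd_tel x) = bd (\<pi> x)"
proof (rule lin_ext[OF free_mod_module lin_comp[OF bdT_lin \<pi>_lin] lin_comp[OF \<pi>_lin bd_lin]])
  fix p assume p: "p \<in> T"
  obtain z k e where pe: "p = (z, k, e)" by (cases p)
  then have z: "z \<in> Bk k" and zB: "z \<in> B" using p by (auto simp: T_def Bk_def)
  have Dz: "D z \<in> finsupp R (Bk k)" by (rule D_Bk[OF z])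
  show "\<pi> (bd_tel (basis_vec R p)) = bd (\<pi> (basis_vec R p))"
  proof (cases e)
    case False
    have "bd_tel (basis_vec R p) = \<tau> k (D z)" using bdT_be[OF p] pe False by simp
    moreover have "bd (\<pi> (basis_vec R p)) = D z" using bd_be[OF zB] pe False by (simp add: \<pi>_be)
    ultimately show ?thesis using \<pi>_\<tau>[OF Dz] by simp
  next
    case True
    have T1: "basis_vec R (z, k, False) \<in> finsupp R T" "basis_vec R (z, Suc k, False) \<in> finsupp R T"
      using z by (auto simp: T_def Bk_def intro!: basis_vec_closed)
    have k: "\<kappa> k (D z) \<in> finsupp R T" by (rule lin_closed[OF \<kappa>_lin_T Dz]) simp
    have "\<pi> (tel_diff p) = fadd R (basis_vec R z) (fneg R (fadd R (basis_vec R z) (fzero R)))"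
      using pe True T1 k \<pi>_\<kappa>[OF Dz] by (simp add: lin_fadd[OF \<pi>_lin] lin_fneg[OF \<pi>_lin] \<pi>_be)
    also have "\<dots> = fzero R" using fadd_fzero_right[of "basis_vec R z" B] fadd_fneg[of "basis_vec R z" B] zB by simp
    finally have "\<pi> (bd_tel (basis_vec R p)) = fzero R" unfolding bdT_be[OF p] .
    moreover have "bd (\<pi> (basis_vec R p)) = fzero R"
      using pe True lin_fzero[OF bd_lin] by (simp add: \<pi>_be)
    ultimately show ?thesis by simp
  qed
qed

lemma \<pi>_S:
  assumes x: "x \<in> finsupp R (Bk M)" shows "\<pi> (S M x) = x"
proof -
  have xB: "x \<in> finsupp R B" by (rule finsupp_monoD[OF x Bk_B])
  have h: "H M x \<in> finsupp R T" and h': "H M (bd x) \<in> finsupp R T"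
    using lin_closed[OF H_lin_T[OF order_refl] xB] lin_closed[OF H_lin_T[OF order_refl] bd_closed[OF xB]] .
  have t: "\<tau> M x \<in> finsupp R T" by (rule lin_closed[OF \<tau>_lin_T x]) simp
  show ?thesis unfolding S_def
    using t T.bd_closed[OF h] h' \<pi>_\<tau>[OF x] \<pi>_bdT[OF h] \<pi>_H[OF xB] \<pi>_H[OF bd_closed[OF xB]]
      lin_fzero[OF bd_lin] fadd_fzero_right[OF x] fadd_fzero_right[of "fzero R" B]
    by (simp add: lin_fadd[OF \<pi>_lin])
qed

lemma \<pi>_s: "x \<in> finsupp R B \<Longrightarrow> \<pi> (s x) = x"
proof (rule lin_ext[OF free_mod_module lin_comp[OF s_lin \<pi>_lin] lin_id_sub[OF order_refl]])
  show "\<pi> (s (basis_vec R z)) = basis_vec R z" if "z \<in> B" for z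
    using that \<pi>_S[of "basis_vec R z" "\<rho> z"] by (simp add: s_be Bk_def)
qed

lemma S_bd:
  assumes x: "x \<in> finsupp R (Bk M)" shows "bd_tel (S M x) = S M (bd x)"
proof -
  have xB: "x \<in> finsupp R B" by (rule finsupp_monoD[OF x Bk_B])
  have bx: "bd x \<in> finsupp R (Bk M)" by (rule lin_closed[OF bd_Bk x])
  have h: "H M x \<in> finsupp R T" and h': "H M (bd x) \<in> finsupp R T"
    using lin_closed[OF H_lin_T[OF order_refl] xB] lin_closed[OF H_lin_T[OF order_refl] bd_closed[OF xB]] .
  have t: "\<tau> M x \<in> finsupp R T" by (rule lin_closed[OF \<tau>_lin_T x]) simp
  have z: "H M (fzero R) = fzero R" by (rule lin_fzero[OF H_lin_T[OF order_refl]])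
  show ?thesis unfolding S_def
    using t T.bd_closed[OF h] h' T.bd_bd[OF h] bdT_\<tau>[OF x] bd_bd[OF xB] z
      fadd_fzero_left[OF T.bd_closed[OF h']] fadd_fzero_right[OF T.bd_closed[OF h']]
    by (simp add: lin_fadd[OF bdT_lin])
qed

lemma s_based_map: "based_map R B deg D T degT tel_diff s"
  unfolding based_map_def
proof (intro conjI ballI s_lin)
  fix z assume z: "z \<in> B"
  let ?x = "basis_vec R z"
  have x: "?x \<in> finsupp R (Bk (\<rho> z))" using z by (simp add: Bk_def)
  have xB: "?x \<in> finsupp R B" using z by simp
  show "s (bd ?x) = bd_tel (s ?x)"
    using S_bd[OF x] s_eq[OF x] s_eq[OF lin_closed[OF bd_Bk x]] by simp
  have 1: "\<tau> (\<rho> z) ?x \<in> finsupp R {c \<in> T. degT c = deg z}"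
    unfolding \<tau>_be using z by (intro basis_vec_closed) (auto simp: T_def)
  have "H (\<rho> z) ?x \<in> finsupp R {c \<in> T. degT c = deg z - 1}"
    unfolding H_be[OF z] by (rule finsupp_monoD[OF hz_closed[OF z]]) (use z in \<open>auto simp: T_def\<close>)
  from lin_closed[OF T.bd_deg this] have 2: "bd_tel (H (\<rho> z) ?x) \<in> finsupp R {c \<in> T. degT c = deg z}" by simp
  have "D z \<in> finsupp R {c \<in> B. deg c = deg z + 1}" by (rule D_deg[OF z])
  from lin_closed[OF H_lin this] have "H (\<rho> z) (D z) \<in> finsupp R {(c, k, e). c \<in> {c \<in> B. deg c = deg z + 1} \<and> \<rho> c \<le> k \<and> e}"
    by auto
  then have 3: "H (\<rho> z) (D z) \<in> finsupp R {c \<in> T. degT c = deg z}"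
    by (rule finsupp_monoD) (auto simp: T_def)
  show "s ?x \<in> finsupp R {c \<in> T. degT c = deg z}"
    unfolding s_be[OF z] S_def bd_be[OF z] by (intro fadd_closed 1 2 3)
qed

lemma \<pi>_based_map: "based_map R T degT tel_diff B deg D \<pi>"
  unfolding based_map_def
proof (intro conjI ballI \<pi>_lin)
  fix p assume p: "p \<in> T"
  then show "\<pi> (basis_vec R p) \<in> finsupp R {c \<in> B. deg c = degT p}"
    by (cases p) (auto simp: \<pi>_be T_def intro!: basis_vec_closed)
  show "\<pi> (bd_tel (basis_vec R p)) = bd (\<pi> (basis_vec R p))" by (rule \<pi>_bdT) (use p in simp)
qed

end

section \<open>Transport of structure and coproducts\<close>

text \<open>
  Free modules live on function types; a bijection \<open>enc\<close> with a subset of the universe \<open>'u\<close>, inverted by \<open>dec\<close>, turns them into objects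
  of the category.
\<close>

definition transport_mod :: "('m \<Rightarrow> 'u) \<Rightarrow> ('u \<Rightarrow> 'm) \<Rightarrow> ('r, 'm) rmodule \<Rightarrow> ('r, 'u) rmodule" where
  "transport_mod enc dec M = \<lparr>carrier = enc ` carrier M, mult = undefined, one = undefined,
     zero = enc \<zero>\<^bsub>M\<^esub>, add = (\<lambda>u v. enc (dec u \<oplus>\<^bsub>M\<^esub> dec v)), ract = (\<lambda>u r. enc (ract M (dec u) r))\<rparr>"

definition transport :: "('m \<Rightarrow> 'u) \<Rightarrow> ('u \<Rightarrow> 'm) \<Rightarrow> ('r, 'm) chain_complex \<Rightarrow> ('r, 'u) chain_complex" where
  "transport enc dec Y = \<lparr>cmodule = (\<lambda>n. transport_mod enc dec (cmodule Y n)),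
     cdiff = (\<lambda>n. restrict (\<lambda>u. enc (cdiff Y n (dec u))) (enc ` carrier (cmodule Y n)))\<rparr>"

lemma transport_mod_simps [simp]:
  "carrier (transport_mod enc dec M) = enc ` carrier M" "zero (transport_mod enc dec M) = enc \<zero>\<^bsub>M\<^esub>"
  "add (transport_mod enc dec M) = (\<lambda>u v. enc (dec u \<oplus>\<^bsub>M\<^esub> dec v))" "ract (transport_mod enc dec M) = (\<lambda>u r. enc (ract M (dec u) r))"
  by (simp_all add: transport_mod_def)

lemma transport_mod_module:
  assumes M: "right_module R M" and inv: "\<And>x. x \<in> carrier M \<Longrightarrow> dec (enc x) = x"
  shows "right_module R (transport_mod enc dec M)"
proof -
  interpret M: abelian_group M using M by (rule right_module_abelian)
  have "abelian_group (transport_mod enc dec M)"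
  proof (rule abelian_groupI)
    fix u assume "u \<in> carrier (transport_mod enc dec M)"
    then obtain x where "x \<in> carrier M" "u = enc x" by auto
    then show "\<exists>v\<in>carrier (transport_mod enc dec M). v \<oplus>\<^bsub>transport_mod enc dec M\<^esub> u = \<zero>\<^bsub>transport_mod enc dec M\<^esub>"
      by (intro bexI[of _ "enc (\<ominus>\<^bsub>M\<^esub> x)"]) (auto simp: inv M.l_neg)
  qed (auto simp: inv M.a_ac)
  then show ?thesis using M unfolding right_module_def
    by (auto simp: inv)
qed

lemma transport_mod_lin:
  assumes inv: "\<And>x. x \<in> carrier M \<Longrightarrow> dec (enc x) = x"
  shows "linear R M (transport_mod enc dec M) enc"
  by (rule linearI) (auto simp: inv)

lemma transport_mod_lin':
  assumes M: "right_module R M" and inv: "\<And>x. x \<in> carrier M \<Longrightarrow> dec (enc x) = x"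
  shows "linear R (transport_mod enc dec M) M dec"
proof -
  interpret M: abelian_group M using M by (rule right_module_abelian)
  show ?thesis by (rule linearI) (use right_module_ract_closed[OF M] in \<open>auto simp: inv\<close>)
qed

context
  fixes R :: "('r, 'b) ring_scheme" and Y :: "('r, 'm) chain_complex" and enc :: "'m \<Rightarrow> 'u" and dec :: "'u \<Rightarrow> 'm"
  assumes Y: "is_complex R Y" and inv: "\<And>n x. x \<in> carrier (cmodule Y n) \<Longrightarrow> dec (enc x) = x"
begin

lemma transport_lin: "linear R (cmodule Y n) (cmodule (transport enc dec Y) n) enc"
  unfolding transport_def using transport_mod_lin[of "cmodule Y n" dec enc R] inv by simp

lemma transport_lin': "linear R (cmodule (transport enc dec Y) n) (cmodule Y n) dec"
  unfolding transport_def using transport_mod_lin'[OF is_complex_module[OF Y], where dec = dec and enc = enc] inv by simp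

lemma transport_cplx: "is_complex R (transport enc dec Y)"
  unfolding is_complex_def
proof (intro allI conjI ballI)
  fix n
  show M: "right_module R (cmodule (transport enc dec Y) n)" for n
    unfolding transport_def using transport_mod_module[OF is_complex_module[OF Y], where dec = dec and enc = enc] inv by simp
  show "linear R (cmodule (transport enc dec Y) n) (cmodule (transport enc dec Y) (n + 1)) (cdiff (transport enc dec Y) n)"
    by (rule lin_cong[OF M lin_comp[OF lin_comp[OF transport_lin' is_complex_diff[OF Y]] transport_lin]]) (auto simp: transport_def)
  fix x assume "x \<in> carrier (cmodule (transport enc dec Y) n)"
  then obtain y where y: "y \<in> carrier (cmodule Y n)" "x = enc y" by (auto simp: transport_def)
  have dy: "cdiff Y n y \<in> carrier (cmodule Y (n + 1))" by (rule lin_closed[OF is_complex_diff[OF Y] y(1)])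
  show "cdiff (transport enc dec Y) (n + 1) (cdiff (transport enc dec Y) n x) = \<zero>\<^bsub>cmodule (transport enc dec Y) (n + 1 + 1)\<^esub>"
    using y dy is_complex_sq[OF Y y(1)] by (simp add: transport_def inv[OF y(1)] inv[OF dy])
qed

lemma transport_enc: "chain_map R Y (transport enc dec Y) (\<lambda>n. enc)"
  unfolding chain_map_def using transport_lin inv by (auto simp: transport_def)

lemma transport_dec: "chain_map R (transport enc dec Y) Y (\<lambda>n. dec)"
  unfolding chain_map_def
proof (intro allI conjI ballI transport_lin')
  fix n x assume "x \<in> carrier (cmodule (transport enc dec Y) n)"
  then obtain y where y: "y \<in> carrier (cmodule Y n)" "x = enc y" by (auto simp: transport_def)
  have dy: "cdiff Y n y \<in> carrier (cmodule Y (n + 1))" by (rule lin_closed[OF is_complex_diff[OF Y] y(1)])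
  show "dec (cdiff (transport enc dec Y) n x) = cdiff Y n (dec x)"
    using y inv[OF y(1)] inv[OF dy] by (auto simp: transport_def)
qed

lemma transport_enc_dec: "u \<in> carrier (cmodule (transport enc dec Y) n) \<Longrightarrow> enc (dec u) = u"
  using inv by (auto simp: transport_def)

end

text \<open>
  Choose preimages of the images of the basis elements.
\<close>

lemma (in ring) free_projective:
  fixes enc :: "('k \<Rightarrow> 'a) \<Rightarrow> 'u"
  assumes inv: "\<And>x. x \<in> finsupp R E \<Longrightarrow> dec (enc x) = x" and small: "|finsupp R E| <o |UNIV :: 'u set|"
  shows "projective R (transport_mod enc dec (free_mod R E))"
  unfolding projective_def small_right_module_def
proof (intro conjI allI impI ballI)
  show "right_module R (transport_mod enc dec (free_mod R E))" by (rule transport_mod_module[OF free_mod_module inv])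
  show "carrier (transport_mod enc dec (free_mod R E)) \<in> small_sets"
    using card_of_image[of enc "finsupp R E"] small by (auto simp: small_sets_def intro: ordLeq_ordLess_trans)
  fix M N :: "('a, 'u) rmodule" and g f
  assume MN: "(right_module R M \<and> carrier M \<in> small_sets) \<and> right_module R N \<and> carrier N \<in> small_sets"
    and g: "g \<in> rhom R M N" and f: "f \<in> rhom R (transport_mod enc dec (free_mod R E)) N" and surj: "g ` carrier M = carrier N"
  have M: "right_module R M" and N: "right_module R N" using MN by auto
  have gl: "linear R M N g" and fl: "linear R (transport_mod enc dec (free_mod R E)) N f" using g f by (auto simp: rhom_iff_lin)
  have fe: "linear R (free_mod R E) N (\<lambda>x. f (enc x))" by (rule lin_comp[OF transport_mod_lin fl]) (rule inv)
  have "\<exists>y. y \<in> carrier M \<and> g y = f (enc (basis_vec R b))" if "b \<in> E" for b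
  proof -
    have "f (enc (basis_vec R b)) \<in> carrier N" using lin_closed[OF fe, of "basis_vec R b"] that by simp
    then show ?thesis unfolding surj[symmetric] by (metis image_iff)
  qed
  then obtain \<psi> where \<psi>: "\<And>b. b \<in> E \<Longrightarrow> \<psi> b \<in> carrier M" "\<And>b. b \<in> E \<Longrightarrow> g (\<psi> b) = f (enc (basis_vec R b))"
    by metis
  have l: "linear R (free_mod R E) M (lift R M \<psi>)" by (rule lift_lin[OF M]) (use \<psi> in auto)
  have eq: "g (lift R M \<psi> x) = f (enc x)" if "x \<in> finsupp R E" for x
    by (rule lin_ext[OF N lin_comp[OF l gl] fe _ that]) (use \<psi> lift_be[where \<phi> = \<psi>, OF M] in simp)
  define hh where "hh = restrict (\<lambda>u. lift R M \<psi> (dec u)) (enc ` finsupp R E)"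
  have "linear R (transport_mod enc dec (free_mod R E)) M hh"
    by (rule lin_cong[OF transport_mod_module[OF free_mod_module inv] lin_comp[OF transport_mod_lin'[OF free_mod_module inv] l]])
      (auto simp: hh_def)
  then have "hh \<in> rhom R (transport_mod enc dec (free_mod R E)) M" by (simp add: rhom_iff_lin hh_def)
  moreover have "\<forall>x\<in>carrier (transport_mod enc dec (free_mod R E)). g (hh x) = f x"
    using eq inv by (auto simp: hh_def)
  ultimately show "\<exists>h\<in>rhom R (transport_mod enc dec (free_mod R E)) M. \<forall>x\<in>carrier (transport_mod enc dec (free_mod R E)). g (h x) = f x"
    by blast
qed

text \<open>
  The universal property of a coproduct in the homotopy category, in terms of chain maps.
\<close>

definition htpy_coproduct :: "('r, 'b) ring_scheme \<Rightarrow> 'i set \<Rightarrow> ('i \<Rightarrow> ('r, 'u) chain_complex) \<Rightarrow>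
    ('r, 'u) chain_complex \<Rightarrow> ('i \<Rightarrow> 'u graded_map) \<Rightarrow> bool" where
  "htpy_coproduct R I X P \<iota> \<longleftrightarrow> P \<in> projective_complexes R \<and>
     (\<forall>i \<in> I. X i \<in> projective_complexes R \<and> chain_map R (X i) P (\<iota> i)) \<and>
     (\<forall>Y \<in> (projective_complexes R :: ('r, 'u) chain_complex set).
        (\<forall>f. (\<forall>i \<in> I. chain_map R (X i) Y (f i)) \<longrightarrow>
          (\<exists>h. chain_map R P Y h \<and> (\<forall>i \<in> I. homotopic R (X i) Y (\<lambda>n x. h n (\<iota> i n x)) (f i)))) \<and>
        (\<forall>a b. chain_map R P Y a \<and> chain_map R P Y b \<and>
            (\<forall>i \<in> I. homotopic R (X i) Y (\<lambda>n x. a n (\<iota> i n x)) (\<lambda>n x. b n (\<iota> i n x))) \<longrightarrow> homotopic R P Y a b))"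

lemma htpy_coproduct_imp_is_coproduct:
  assumes c: "htpy_coproduct R I X P \<iota>"
  shows "is_coproduct (K_Proj R) I X P (\<lambda>i. htpy_class R (X i) P (\<iota> i))"
  unfolding is_coproduct_def Obj_K
proof (intro conjI ballI allI impI)
  note pc = projective_complexes_cplx
  show P: "P \<in> projective_complexes R" using c by (simp add: htpy_coproduct_def)
  fix i assume i: "i \<in> I"
  then show "X i \<in> projective_complexes R" "htpy_class R (X i) P (\<iota> i) \<in> Hom (K_Proj R) (X i) P"
    using c P by (auto simp: htpy_coproduct_def intro!: htpy_class_in_Hom pc)
next
  note pc = projective_complexes_cplx
  have P: "P \<in> projective_complexes R" using c by (simp add: htpy_coproduct_def)
  have X: "X i \<in> projective_complexes R" "chain_map R (X i) P (\<iota> i)" if "i \<in> I" for i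
    using c that by (auto simp: htpy_coproduct_def)
  fix Y F assume Y: "Y \<in> projective_complexes R" and F: "\<forall>i\<in>I. F i \<in> Hom (K_Proj R) (X i) Y"
  have "\<exists>f. chain_map R (X i) Y f \<and> F i = htpy_class R (X i) Y f" if "i \<in> I" for i
    using Hom_cases[OF pc[OF X(1)[OF that]] pc[OF Y]] F that by metis
  then obtain f where f: "\<And>i. i \<in> I \<Longrightarrow> chain_map R (X i) Y (f i)" "\<And>i. i \<in> I \<Longrightarrow> F i = htpy_class R (X i) Y (f i)"
    by metis
  obtain h where h: "chain_map R P Y h" "\<And>i. i \<in> I \<Longrightarrow> homotopic R (X i) Y (\<lambda>n x. h n (\<iota> i n x)) (f i)"
    using c Y f(1) unfolding htpy_coproduct_def by meson
  have comp: "Comp (K_Proj R) (X i) P Y (htpy_class R P Y a) (htpy_class R (X i) P (\<iota> i)) = htpy_class R (X i) Y (\<lambda>n x. a n (\<iota> i n x))"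
    if "i \<in> I" "chain_map R P Y a" for i a
    by (rule Comp_cls[OF pc[OF X(1)[OF that(1)]] pc[OF P] pc[OF Y] X(2)[OF that(1)] that(2)])
  have eq: "Comp (K_Proj R) (X i) P Y (htpy_class R P Y a) (htpy_class R (X i) P (\<iota> i)) = F i \<longleftrightarrow>
      homotopic R (X i) Y (\<lambda>n x. a n (\<iota> i n x)) (f i)" if "i \<in> I" "chain_map R P Y a" for i a
    unfolding comp[OF that] f(2)[OF that(1)]
    by (rule htpy_class_eq_iff[OF pc[OF X(1)[OF that(1)]] pc[OF Y] chain_map_comp[OF X(2)[OF that(1)] that(2)] f(1)[OF that(1)]])
  show "\<exists>!h. h \<in> Hom (K_Proj R) P Y \<and> (\<forall>i\<in>I. Comp (K_Proj R) (X i) P Y h (htpy_class R (X i) P (\<iota> i)) = F i)"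
  proof (rule ex1I[of _ "htpy_class R P Y h"])
    show "htpy_class R P Y h \<in> Hom (K_Proj R) P Y \<and>
        (\<forall>i\<in>I. Comp (K_Proj R) (X i) P Y (htpy_class R P Y h) (htpy_class R (X i) P (\<iota> i)) = F i)"
      using htpy_class_in_Hom[OF pc[OF P] pc[OF Y] h(1)] eq h by blast
    fix k assume k: "k \<in> Hom (K_Proj R) P Y \<and> (\<forall>i\<in>I. Comp (K_Proj R) (X i) P Y k (htpy_class R (X i) P (\<iota> i)) = F i)"
    then obtain a where a: "chain_map R P Y a" "k = htpy_class R P Y a"
      using Hom_cases[OF pc[OF P] pc[OF Y]] by metis
    have "homotopic R (X i) Y (\<lambda>n x. a n (\<iota> i n x)) (\<lambda>n x. h n (\<iota> i n x))" if i: "i \<in> I" for i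
    proof (rule homotopic_trans[OF pc[OF X(1)[OF i]] pc[OF Y] chain_map_comp[OF X(2)[OF i] h(1)]])
      show "homotopic R (X i) Y (\<lambda>n x. a n (\<iota> i n x)) (f i)" using k eq[OF i a(1)] a(2) i by blast
      show "homotopic R (X i) Y (f i) (\<lambda>n x. h n (\<iota> i n x))"
        by (rule homotopic_sym[OF pc[OF X(1)[OF i]] pc[OF Y] chain_map_comp[OF X(2)[OF i] h(1)] f(1)[OF i] h(2)[OF i]])
    qed
    then have "homotopic R P Y a h" using c Y a(1) h(1) unfolding htpy_coproduct_def by meson
    then show "k = htpy_class R P Y h" using htpy_class_eq_iff[OF pc[OF P] pc[OF Y] a(1) h(1)] a(2) by simp
  qed
qed

lemma is_coproduct_imp_coprod:
  fixes P :: "('r, 'u) chain_complex"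
  assumes c: "is_coproduct (K_Proj R) I X P \<kappa>"
  obtains \<iota> where "\<And>i. i \<in> I \<Longrightarrow> \<kappa> i = htpy_class R (X i) P (\<iota> i)" "htpy_coproduct R I X P \<iota>"
proof -
  note pc = projective_complexes_cplx
  have P: "P \<in> projective_complexes R" using c by (simp add: is_coproduct_def)
  have X: "X i \<in> projective_complexes R" "\<kappa> i \<in> Hom (K_Proj R) (X i) P" if "i \<in> I" for i
    using c that by (auto simp: is_coproduct_def)
  have "\<exists>f. chain_map R (X i) P f \<and> \<kappa> i = htpy_class R (X i) P f" if "i \<in> I" for i
    using Hom_cases[OF pc[OF X(1)[OF that]] pc[OF P] X(2)[OF that]] by metis
  then obtain \<iota> where \<iota>: "\<And>i. i \<in> I \<Longrightarrow> chain_map R (X i) P (\<iota> i)" "\<And>i. i \<in> I \<Longrightarrow> \<kappa> i = htpy_class R (X i) P (\<iota> i)"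
    by metis
  have ex1: "\<exists>!h. h \<in> Hom (K_Proj R) P Y \<and> (\<forall>i\<in>I. Comp (K_Proj R) (X i) P Y h (\<kappa> i) = F i)"
    if "Y \<in> (projective_complexes R :: ('r, 'u) chain_complex set)" "\<And>i. i \<in> I \<Longrightarrow> F i \<in> Hom (K_Proj R) (X i) Y" for Y F
    using c that unfolding is_coproduct_def Obj_K by blast
  have comp: "Comp (K_Proj R) (X i) P Y (htpy_class R P Y a) (\<kappa> i) = htpy_class R (X i) Y (\<lambda>n x. a n (\<iota> i n x))"
    if "i \<in> I" "chain_map R P Y a" "Y \<in> (projective_complexes R :: ('r, 'u) chain_complex set)" for i a Y
    unfolding \<iota>(2)[OF that(1)]
    by (rule Comp_cls[OF pc[OF X(1)[OF that(1)]] pc[OF P] pc[OF that(3)] \<iota>(1)[OF that(1)] that(2)])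
  have "htpy_coproduct R I X P \<iota>"
    unfolding htpy_coproduct_def
  proof (intro conjI ballI allI impI P X(1) \<iota>(1))
    fix Y :: "('r, 'u) chain_complex" and f assume Y: "Y \<in> projective_complexes R" and f: "\<forall>i\<in>I. chain_map R (X i) Y (f i)"
    have "\<exists>h. h \<in> Hom (K_Proj R) P Y \<and> (\<forall>i\<in>I. Comp (K_Proj R) (X i) P Y h (\<kappa> i) = htpy_class R (X i) Y (f i))"
      by (rule ex1_implies_ex[OF ex1[OF Y]]) (use f X Y in \<open>auto intro!: htpy_class_in_Hom pc\<close>)
    then obtain h where "h \<in> Hom (K_Proj R) P Y" and h: "\<forall>i\<in>I. Comp (K_Proj R) (X i) P Y h (\<kappa> i) = htpy_class R (X i) Y (f i)"
      by blast
    then obtain a where a: "chain_map R P Y a" "h = htpy_class R P Y a" using Hom_cases[OF pc[OF P] pc[OF Y]] by metis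
    have "homotopic R (X i) Y (\<lambda>n x. a n (\<iota> i n x)) (f i)" if i: "i \<in> I" for i
    proof -
      have "htpy_class R (X i) Y (\<lambda>n x. a n (\<iota> i n x)) = htpy_class R (X i) Y (f i)"
        using comp[OF i a(1) Y] h a(2) i by metis
      then show ?thesis
        using htpy_class_eq_iff[OF pc[OF X(1)[OF i]] pc[OF Y] chain_map_comp[OF \<iota>(1)[OF i] a(1)]] f i by blast
    qed
    then show "\<exists>h. chain_map R P Y h \<and> (\<forall>i\<in>I. homotopic R (X i) Y (\<lambda>n x. h n (\<iota> i n x)) (f i))" using a(1) by blast
  next
    fix Y :: "('r, 'u) chain_complex" and a b assume Y: "Y \<in> projective_complexes R" and ab: "chain_map R P Y a \<and> chain_map R P Y b \<and>
       (\<forall>i\<in>I. homotopic R (X i) Y (\<lambda>n x. a n (\<iota> i n x)) (\<lambda>n x. b n (\<iota> i n x)))"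
    then have a: "chain_map R P Y a" and b: "chain_map R P Y b" by auto
    have "\<exists>!h. h \<in> Hom (K_Proj R) P Y \<and> (\<forall>i\<in>I. Comp (K_Proj R) (X i) P Y h (\<kappa> i) = htpy_class R (X i) Y (\<lambda>n x. b n (\<iota> i n x)))"
      by (rule ex1[OF Y]) (use X Y chain_map_comp[OF \<iota>(1) b] in \<open>auto intro!: htpy_class_in_Hom pc\<close>)
    moreover have "Comp (K_Proj R) (X i) P Y (htpy_class R P Y a) (\<kappa> i) = htpy_class R (X i) Y (\<lambda>n x. b n (\<iota> i n x))" if i: "i \<in> I" for i
      using comp[OF i a Y] ab i
        htpy_class_eq_iff[OF pc[OF X(1)[OF i]] pc[OF Y] chain_map_comp[OF \<iota>(1)[OF i] a] chain_map_comp[OF \<iota>(1)[OF i] b]] by auto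
    moreover have "Comp (K_Proj R) (X i) P Y (htpy_class R P Y b) (\<kappa> i) = htpy_class R (X i) Y (\<lambda>n x. b n (\<iota> i n x))" if i: "i \<in> I" for i
      using comp[OF i b Y] .
    ultimately have "htpy_class R P Y a = htpy_class R P Y b"
      using htpy_class_in_Hom[OF pc[OF P] pc[OF Y] a] htpy_class_in_Hom[OF pc[OF P] pc[OF Y] b] by blast
    then show "homotopic R P Y a b" using htpy_class_eq_iff[OF pc[OF P] pc[OF Y] a b] by simp
  qed
  then show ?thesis using that \<iota> by blast
qed

section \<open>Factorisation through countable subcomplexes\<close>

lemma countable_card_le: "countable S \<longleftrightarrow> |S| \<le>o |UNIV :: nat set|"
  unfolding countable_def card_of_ordLeq[symmetric] by auto

text \<open>
  The parameter \<open>U\<close> is the universe; naming it makes its type available to the abbreviation \<open>small\<close>.  \<open>A\<close> is a class of compact objects: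
  \<open>\<aleph>\<^sub>1\<close>-small, and closed under the factorisations through coproducts.
\<close>

locale compact_class = ring R for R (structure) +
  fixes A :: "('a, 'u) chain_complex set" and U :: "'u set"
  assumes U: "U = UNIV" and reg: "regularCard |U|" and big: "aleph1 <o |U|"
    and card_R: "|carrier R| \<le>o aleph1"
    and A_small: "\<And>S. S \<in> A \<Longrightarrow> alpha_small (small_sets :: 'u set set) aleph1 (K_Proj R) S"
    and A_factoring: "coproduct_factoring (small_sets :: 'u set set) (K_Proj R) A"
begin

abbreviation small :: "'k set \<Rightarrow> bool" where "small S \<equiv> |S| <o |U|"

lemma nat_aleph1: "|UNIV :: nat set| \<le>o aleph1"
  using cardSuc_ordLeq[OF natLeq_Card_order] card_of_nat ordIso_ordLeq_trans by blast

lemma small_countable: "countable S \<Longrightarrow> small S"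
  using ordLeq_ordLess_trans[OF ordLeq_transitive[OF _ nat_aleph1] big]
  unfolding countable_card_le by blast

lemma infinite_U: "infinite U"
proof
  assume "finite U"
  moreover have "small (UNIV :: nat set)" by (rule small_countable) simp
  then have "|UNIV :: nat set| \<le>o |U|" by (rule ordLess_imp_ordLeq)
  ultimately show False using card_of_ordLeq_finite infinite_UNIV_nat by blast
qed

lemma small_inj: "inj_on f S \<Longrightarrow> f ` S \<subseteq> S' \<Longrightarrow> small S' \<Longrightarrow> small S"
  using ordLeq_ordLess_trans[of "|S|" "|S'|" "|U|"] card_of_ordLeq[of S S'] by blast

lemma small_image: "small S \<Longrightarrow> small (f ` S)"
  using ordLeq_ordLess_trans[OF card_of_image] by blast

lemma small_subset: "S \<subseteq> S' \<Longrightarrow> small S' \<Longrightarrow> small S"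
  by (rule small_inj[of id]) auto

lemma U_stable: "stable |U|"
  by (rule regularCard_stable[OF card_of_Card_order _ reg]) (use infinite_U in \<open>simp add: Field_card_of\<close>)

lemma small_Times: "small S \<Longrightarrow> small S' \<Longrightarrow> small (S \<times> S')"
  by (rule stable_elim[OF U_stable])

lemma small_UN: "small I \<Longrightarrow> (\<And>i. i \<in> I \<Longrightarrow> small (F i)) \<Longrightarrow> small (\<Union>i\<in>I. F i)"
  by (rule stable_UNION[OF U_stable])

text \<open>
  Lists of fixed length are iterated products; regularity of the universe handles the countable union over the lengths.
\<close>

lemma small_lists: assumes "small S" shows "small (lists S)"
proof -
  have s: "small {l \<in> lists S. length l = n}" for n
  proof (induction n)
    case 0
    have "{l \<in> lists S. length l = 0} \<subseteq> {[]}" by auto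
    then show ?case by (rule small_countable[OF countable_finite[OF finite_subset]]) simp
  next
    case (Suc n)
    show ?case
    proof (rule small_inj[OF _ _ small_Times[OF assms Suc]])
      show "inj_on (\<lambda>l. (hd l, tl l)) {l \<in> lists S. length l = Suc n}"
      proof (rule inj_onI)
        fix l l' assume "l \<in> {l \<in> lists S. length l = Suc n}" "l' \<in> {l \<in> lists S. length l = Suc n}"
          and "(hd l, tl l) = (hd l', tl l')"
        then show "l = l'" by (cases l; cases l') simp_all
      qed
      show "(\<lambda>l. (hd l, tl l)) ` {l \<in> lists S. length l = Suc n} \<subseteq> S \<times> {l \<in> lists S. length l = n}"
      proof
        fix q assume "q \<in> (\<lambda>l. (hd l, tl l)) ` {l \<in> lists S. length l = Suc n}"
        then obtain l where "q = (hd l, tl l)" "l \<in> lists S" "length l = Suc n" by blast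
        then show "q \<in> S \<times> {l \<in> lists S. length l = n}" by (cases l) simp_all
      qed
    qed
  qed
  have "small (\<Union>n\<in>UNIV. {l \<in> lists S. length l = n})"
    by (rule small_UN[OF small_countable s]) simp
  moreover have "lists S = (\<Union>n\<in>UNIV. {l \<in> lists S. length l = n})" by auto
  ultimately show ?thesis by simp
qed

lemma small_fc:
  fixes E :: "'k set" assumes "small E" shows "small (finsupp R E)"
proof -
  have smR: "small (carrier R)" by (rule ordLeq_ordLess_trans[OF card_R big])
  define code where "code x = (SOME l. set l = (\<lambda>b. (b, x b)) ` support R x)" for x :: "'k \<Rightarrow> 'a"
  have code: "set (code x) = (\<lambda>b. (b, x b)) ` support R x" if "x \<in> finsupp R E" for x
  proof -
    have "finite ((\<lambda>b. (b, x b)) ` support R x)" using that by (auto simp: finsupp_iff)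
    then show ?thesis unfolding code_def by (intro someI_ex[OF finite_list])
  qed
  show ?thesis
  proof (rule small_inj[OF _ _ small_lists[OF small_Times[OF assms smR]]])
    show "inj_on code (finsupp R E)"
    proof (rule inj_onI, rule ext)
      fix x y b assume x: "x \<in> finsupp R E" and y: "y \<in> finsupp R E" and eq: "code x = code y"
      have g: "(\<lambda>b. (b, x b)) ` support R x = (\<lambda>b. (b, y b)) ` support R y"
        using code[OF x] code[OF y] eq by simp
      then have "(b, v) \<in> (\<lambda>b. (b, x b)) ` support R x \<longleftrightarrow> (b, v) \<in> (\<lambda>b. (b, y b)) ` support R y" for v by simp
      then have "(v = x b \<and> x b \<noteq> \<zero>) \<longleftrightarrow> (v = y b \<and> y b \<noteq> \<zero>)" for v
        by (auto simp: support_def image_iff)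
      then show "x b = y b" by metis
    qed
    show "code ` finsupp R E \<subseteq> lists (E \<times> carrier R)"
    proof
      fix l assume "l \<in> code ` finsupp R E"
      then obtain x where x: "x \<in> finsupp R E" "l = code x" by blast
      then have "set l \<subseteq> E \<times> carrier R" using code[OF x(1)] by (auto simp: finsupp_iff)
      then show "l \<in> lists (E \<times> carrier R)" by auto
    qed
  qed
qed

lemma A_proj:
  assumes "X \<in> A" shows "X \<in> projective_complexes R"
proof -
  have "X \<in> Obj (K_Proj R)"
    using A_small[OF assms] unfolding alpha_small_def by (rule conjunct1)
  then show ?thesis by (simp only: Obj_K)
qed

lemma A_cplx: "X \<in> A \<Longrightarrow> is_complex R X"
  by (rule projective_complexes_cplx[OF A_proj])

text \<open>
  Smallness of \<open>X\<close> in terms of chain maps.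
\<close>

lemma small_factor:
  fixes I :: "'u set" and P :: "('a, 'u) chain_complex"
  assumes X: "X \<in> A" and I: "small I" and c: "htpy_coproduct R I Xs P \<iota>" and f: "chain_map R X P f"
  shows "\<exists>I' P' \<iota>' j g. I' \<subseteq> I \<and> countable I' \<and> htpy_coproduct R I' Xs P' \<iota>' \<and> chain_map R P' P j \<and>
    (\<forall>i \<in> I'. homotopic R (Xs i) P (\<lambda>n x. j n (\<iota>' i n x)) (\<iota> i)) \<and>
    chain_map R X P' g \<and> homotopic R X P f (\<lambda>n x. j n (g n x))"
proof -
  note pc = projective_complexes_cplx
  have Xc: "is_complex R X" by (rule A_cplx[OF X])
  have P: "P \<in> projective_complexes R" using c by (simp add: htpy_coproduct_def)
  have Hf: "htpy_class R X P f \<in> Hom (K_Proj R) X P" by (rule htpy_class_in_Hom[OF Xc pc[OF P] f])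
  have IJ: "I \<in> small_sets" using I by (simp add: small_sets_def U)
  obtain I' P' \<kappa>' J G where I': "I' \<subseteq> I" "|I'| <o aleph1" and c': "is_coproduct (K_Proj R) I' Xs P' \<kappa>'"
    and J: "J \<in> Hom (K_Proj R) P' P" "\<forall>i\<in>I'. Comp (K_Proj R) (Xs i) P' P J (\<kappa>' i) = htpy_class R (Xs i) P (\<iota> i)"
    and G: "G \<in> Hom (K_Proj R) X P'" "htpy_class R X P f = Comp (K_Proj R) X P' P J G"
    using A_small[OF X, unfolded alpha_small_def, THEN conjunct2, rule_format,
        OF IJ htpy_coproduct_imp_is_coproduct[OF c] Hf] by blast
  obtain \<iota>' where \<iota>': "\<And>i. i \<in> I' \<Longrightarrow> \<kappa>' i = htpy_class R (Xs i) P' (\<iota>' i)" and cc: "htpy_coproduct R I' Xs P' \<iota>'"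
    using is_coproduct_imp_coprod[OF c'] by blast
  have P': "P' \<in> projective_complexes R" using cc by (simp add: htpy_coproduct_def)
  obtain j where j: "chain_map R P' P j" "J = htpy_class R P' P j" using Hom_cases[OF pc[OF P'] pc[OF P] J(1)] by blast
  obtain g where g: "chain_map R X P' g" "G = htpy_class R X P' g" using Hom_cases[OF Xc pc[OF P'] G(1)] by blast
  have "countable I'"
    using I'(2) cardSuc_ordLeq_ordLess[OF natLeq_Card_order card_of_Card_order[of I']]
      ordLeq_ordIso_trans[OF _ ordIso_symmetric[OF card_of_nat]]
    unfolding countable_card_le by blast
  moreover have "homotopic R (Xs i) P (\<lambda>n x. j n (\<iota>' i n x)) (\<iota> i)" if i: "i \<in> I'" for i
  proof -
    have Xi: "Xs i \<in> projective_complexes R" and ii: "chain_map R (Xs i) P' (\<iota>' i)" and i0: "chain_map R (Xs i) P (\<iota> i)"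
      using cc c i I'(1) by (auto simp: htpy_coproduct_def)
    have "htpy_class R (Xs i) P (\<lambda>n x. j n (\<iota>' i n x)) = htpy_class R (Xs i) P (\<iota> i)"
      using J(2) i \<iota>'[OF i] j(2) Comp_cls[OF pc[OF Xi] pc[OF P'] pc[OF P] ii j(1)] by metis
    then show ?thesis using htpy_class_eq_iff[OF pc[OF Xi] pc[OF P] chain_map_comp[OF ii j(1)] i0] by blast
  qed
  moreover have "homotopic R X P f (\<lambda>n x. j n (g n x))"
    using G(2) j(2) g(2) Comp_cls[OF Xc pc[OF P'] pc[OF P] g(1) j(1)]
      htpy_class_eq_iff[OF Xc pc[OF P] f chain_map_comp[OF g(1) j(1)]] by metis
  ultimately show ?thesis using I'(1) cc j(1) g(1)
    by (intro exI[of _ I'] exI[of _ P'] exI[of _ \<iota>'] exI[of _ j] exI[of _ g] conjI ballI)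
qed

text \<open>
  The factorisation property of the class in terms of chain maps.
\<close>

lemma coproduct_factor:
  fixes I :: "'u set" and P :: "('a, 'u) chain_complex"
  assumes X: "X \<in> A" and I: "small I" and c: "htpy_coproduct R I Xs P \<iota>" and f: "chain_map R X P f"
  shows "\<exists>T t Q \<kappa> h g. (\<forall>i \<in> I. T i \<in> A \<and> chain_map R (T i) (Xs i) (t i)) \<and>
    htpy_coproduct R I T Q \<kappa> \<and> chain_map R Q P h \<and>
    (\<forall>i \<in> I. homotopic R (T i) P (\<lambda>n x. h n (\<kappa> i n x)) (\<lambda>n x. \<iota> i n (t i n x))) \<and>
    chain_map R X Q g \<and> homotopic R X P f (\<lambda>n x. h n (g n x))"
proof -
  note pc = projective_complexes_cplx
  have Xc: "is_complex R X" by (rule A_cplx[OF X])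
  have P: "P \<in> projective_complexes R" using c by (simp add: htpy_coproduct_def)
  have Hf: "htpy_class R X P f \<in> Hom (K_Proj R) X P" by (rule htpy_class_in_Hom[OF Xc pc[OF P] f])
  have IJ: "I \<in> small_sets" using I by (simp add: small_sets_def U)
  obtain T t Q k H G where T: "\<forall>i\<in>I. T i \<in> A \<and> t i \<in> Hom (K_Proj R) (T i) (Xs i)"
    and c': "is_coproduct (K_Proj R) I T Q k"
    and H: "H \<in> Hom (K_Proj R) Q P"
      "\<forall>i\<in>I. Comp (K_Proj R) (T i) Q P H (k i) = Comp (K_Proj R) (T i) (Xs i) P (htpy_class R (Xs i) P (\<iota> i)) (t i)"
    and G: "G \<in> Hom (K_Proj R) X Q" "htpy_class R X P f = Comp (K_Proj R) X Q P H G"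
    using A_factoring[unfolded coproduct_factoring_def, rule_format,
        OF X IJ htpy_coproduct_imp_is_coproduct[OF c] Hf] by blast
  obtain \<kappa> where \<kappa>: "\<And>i. i \<in> I \<Longrightarrow> k i = htpy_class R (T i) Q (\<kappa> i)" and cc: "htpy_coproduct R I T Q \<kappa>"
    using is_coproduct_imp_coprod[OF c'] by blast
  have Q: "Q \<in> projective_complexes R" using cc by (simp add: htpy_coproduct_def)
  obtain h where h: "chain_map R Q P h" "H = htpy_class R Q P h" using Hom_cases[OF pc[OF Q] pc[OF P] H(1)] by blast
  obtain g where g: "chain_map R X Q g" "G = htpy_class R X Q g" using Hom_cases[OF Xc pc[OF Q] G(1)] by blast
  have Xi: "Xs i \<in> projective_complexes R" "chain_map R (Xs i) P (\<iota> i)" if "i \<in> I" for i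
    using c that by (auto simp: htpy_coproduct_def)
  have Ti: "T i \<in> projective_complexes R" "chain_map R (T i) Q (\<kappa> i)" if "i \<in> I" for i
    using cc that by (auto simp: htpy_coproduct_def)
  have "\<exists>t'. chain_map R (T i) (Xs i) t' \<and> t i = htpy_class R (T i) (Xs i) t'" if "i \<in> I" for i
    using Hom_cases[OF pc[OF Ti(1)[OF that]] pc[OF Xi(1)[OF that]]] T that by metis
  then obtain t' where t': "\<And>i. i \<in> I \<Longrightarrow> chain_map R (T i) (Xs i) (t' i)"
      "\<And>i. i \<in> I \<Longrightarrow> t i = htpy_class R (T i) (Xs i) (t' i)" by metis
  have "homotopic R (T i) P (\<lambda>n x. h n (\<kappa> i n x)) (\<lambda>n x. \<iota> i n (t' i n x))" if i: "i \<in> I" for i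
  proof -
    have "htpy_class R (T i) P (\<lambda>n x. h n (\<kappa> i n x)) = htpy_class R (T i) P (\<lambda>n x. \<iota> i n (t' i n x))"
      using H(2) i \<kappa>[OF i] h(2) t'(2)[OF i] Comp_cls[OF pc[OF Ti(1)[OF i]] pc[OF Q] pc[OF P] Ti(2)[OF i] h(1)]
        Comp_cls[OF pc[OF Ti(1)[OF i]] pc[OF Xi(1)[OF i]] pc[OF P] t'(1)[OF i] Xi(2)[OF i]] by metis
    then show ?thesis
      using htpy_class_eq_iff[OF pc[OF Ti(1)[OF i]] pc[OF P] chain_map_comp[OF Ti(2)[OF i] h(1)] chain_map_comp[OF t'(1)[OF i] Xi(2)[OF i]]]
      by blast
  qed
  moreover have "homotopic R X P f (\<lambda>n x. h n (g n x))"
    using G(2) h(2) g(2) Comp_cls[OF Xc pc[OF Q] pc[OF P] g(1) h(1)]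
      htpy_class_eq_iff[OF Xc pc[OF P] f chain_map_comp[OF g(1) h(1)]] by metis
  moreover have "T i \<in> A" if "i \<in> I" for i using T that by blast
  ultimately show ?thesis using t'(1) cc h(1) g(1)
    by (intro exI[of _ T] exI[of _ t'] exI[of _ Q] exI[of _ \<kappa>] exI[of _ h] exI[of _ g] conjI ballI)
qed

end

context based_cplx
begin

text \<open>
  The subquotient on \<open>E\<close> is the direct sum of the complexes on the fibres of \<open>p\<close>.
\<close>

definition splits_by :: "('k \<Rightarrow> 'j) \<Rightarrow> 'k set \<Rightarrow> bool" where
  "splits_by p E \<longleftrightarrow> (\<forall>b \<in> E. D b \<in> finsupp R ({c. p c = p b} \<union> - E))"

abbreviation fibre :: "('k \<Rightarrow> 'j) \<Rightarrow> 'k set \<Rightarrow> 'j \<Rightarrow> 'k set" where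
  "fibre p E j \<equiv> {b \<in> E. p b = j}"

lemma fibre_rel_closed: "splits_by p E \<Longrightarrow> rel_closed (fibre p E j) E"
  unfolding splits_by_def rel_closed_def by (auto elim!: finsupp_monoD)

text \<open>
  A map out of a free module is given on the basis, and each basis element lies in exactly one fibre.
\<close>

lemma coproduct_map:
  assumes E: "lc E" and p: "splits_by p E" and J: "p ` E \<subseteq> J" and Y: "is_complex R Y"
    and f: "\<And>j. j \<in> J \<Longrightarrow> chain_map R (Sq (fibre p E j)) Y (f j)"
  obtains g where "chain_map R (Sq E) Y g"
    "\<And>j n x. j \<in> J \<Longrightarrow> x \<in> finsupp R {b \<in> fibre p E j. deg b = n} \<Longrightarrow> g n x = f j n x"
proof -
  note EB = loc_closed_subset[OF E]
  define g where "g = (\<lambda>n. lift R (cmodule Y n) (\<lambda>b. f (p b) n (basis_vec R b)))"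
  have fb: "f (p b) (deg b) (basis_vec R b) \<in> carrier (cmodule Y (deg b))" if "b \<in> E" for b
    using chain_map_closed[OF f, of "p b" "basis_vec R b" "deg b"] that J by auto
  have g: "linear R (free_mod R {b \<in> E. deg b = n}) (cmodule Y n) (g n)" for n
    unfolding g_def by (rule lift_lin[OF is_complex_module[OF Y]]) (use fb in auto)
  have g_be: "g (deg b) (basis_vec R b) = f (p b) (deg b) (basis_vec R b)" if "b \<in> E" for b
    unfolding g_def by (rule lift_be[OF is_complex_module[OF Y]]) (rule fb[OF that])
  have eq: "g n x = f j n x" if j: "j \<in> J" and x: "x \<in> finsupp R {b \<in> fibre p E j. deg b = n}" for j n x
  proof (rule lin_ext[OF is_complex_module[OF Y] _ _ _ x])
    show "linear R (free_mod R {b \<in> fibre p E j. deg b = n}) (cmodule Y n) (g n)"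
      by (rule lin_sub[OF g]) auto
    show "linear R (free_mod R {b \<in> fibre p E j. deg b = n}) (cmodule Y n) (f j n)"
      using chain_map_lin[OF f[OF j]] by simp
    show "g n (basis_vec R b) = f j n (basis_vec R b)" if "b \<in> {b \<in> fibre p E j. deg b = n}" for b
      using g_be[of b] that by auto
  qed
  have "chain_map R (Sq E) Y g" unfolding chain_map_def subquot_simps
  proof (intro allI conjI ballI g)
    fix n x assume x: "x \<in> finsupp R {b \<in> E. deg b = n}"
    show "g (n + 1) (res R E (bd x)) = cdiff Y n (g n x)"
    proof (rule lin_ext[OF is_complex_module[OF Y] lin_comp[OF subquot_lin[OF EB] g] lin_comp[OF g is_complex_diff[OF Y]] _ x])
      fix b assume b: "b \<in> {b \<in> E. deg b = n}"
      then have bj: "b \<in> {c \<in> fibre p E (p b). deg c = n}" and pb: "p b \<in> J" using J by auto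
      have x: "basis_vec R b \<in> finsupp R {c \<in> fibre p E (p b). deg c = n}" using bj by simp
      have x': "basis_vec R b \<in> finsupp R (fibre p E (p b))" using bj by simp
      have "res R E (bd (basis_vec R b)) = res R (fibre p E (p b)) (bd (basis_vec R b))"
        by (rule rel_closed_bd[OF fibre_rel_closed[OF p] EB x'])
      moreover have "res R (fibre p E (p b)) (bd (basis_vec R b)) \<in> finsupp R {c \<in> fibre p E (p b). deg c = n + 1}"
        by (rule lin_closed[OF subquot_lin x]) (use EB in auto)
      ultimately have "g (n + 1) (res R E (bd (basis_vec R b))) = f (p b) (n + 1) (res R (fibre p E (p b)) (bd (basis_vec R b)))"
        using eq[OF pb] by simp
      also have "\<dots> = cdiff Y n (f (p b) n (basis_vec R b))"
        using chain_map_comm[OF f[OF pb], of "basis_vec R b" n] x by simp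
      also have "f (p b) n (basis_vec R b) = g n (basis_vec R b)" using eq[OF pb x] by simp
      finally show "g (n + 1) (res R E (bd (basis_vec R b))) = cdiff Y n (g n (basis_vec R b))" .
    qed
  qed
  then show ?thesis using that eq by blast
qed

lemma coproduct_homotopy:
  assumes E: "lc E" and p: "splits_by p E" and J: "p ` E \<subseteq> J" and Y: "is_complex R Y"
    and f: "chain_map R (Sq E) Y f" and g: "chain_map R (Sq E) Y g"
    and fg: "\<And>j. j \<in> J \<Longrightarrow> homotopic R (Sq (fibre p E j)) Y f g"
  shows "homotopic R (Sq E) Y f g"
proof -
  note EB = loc_closed_subset[OF E]
  \<comment> \<open>Null homotopies of the difference on one fibre; one is chosen for each fibre.\<close>
  define nullh where "nullh = (\<lambda>j s. (\<forall>n. linear R (free_mod R {b \<in> fibre p E j. deg b = n}) (cmodule Y (n - 1)) (s n)) \<and>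
     (\<forall>n. \<forall>x \<in> finsupp R {b \<in> fibre p E j. deg b = n}. f n x = g n x \<oplus>\<^bsub>cmodule Y n\<^esub>
        (cdiff Y (n - 1) (s n x) \<oplus>\<^bsub>cmodule Y n\<^esub> s (n + 1) (res R (fibre p E j) (bd x)))))"
  define s where "s = (\<lambda>j. SOME s. nullh j s)"
  have ns: "nullh j (s j)" if "j \<in> J" for j
  proof -
    have "\<exists>s. nullh j s" using fg[OF that] by (simp only: homotopic_def subquot_simps nullh_def)
    then show ?thesis unfolding s_def by (rule someI_ex)
  qed
  have s: "linear R (free_mod R {b \<in> fibre p E j. deg b = n}) (cmodule Y (n - 1)) (s j n)" if "j \<in> J" for j n
    using ns[OF that] unfolding nullh_def by blast
  have eq: "f n x = g n x \<oplus>\<^bsub>cmodule Y n\<^esub>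
        (cdiff Y (n - 1) (s j n x) \<oplus>\<^bsub>cmodule Y n\<^esub> s j (n + 1) (res R (fibre p E j) (bd x)))"
    if "j \<in> J" "x \<in> finsupp R {b \<in> fibre p E j. deg b = n}" for j n x
    using ns[OF that(1)] that(2) unfolding nullh_def by blast
  define t where "t = (\<lambda>n. lift R (cmodule Y (n - 1)) (\<lambda>b. s (p b) n (basis_vec R b)))"
  have sb: "s (p b) (deg b) (basis_vec R b) \<in> carrier (cmodule Y (deg b - 1))" if "b \<in> E" for b
    using lin_closed[OF s, of "p b" "basis_vec R b" "deg b"] that J by auto
  have t: "linear R (free_mod R {b \<in> E. deg b = n}) (cmodule Y (n - 1)) (t n)" for n
    unfolding t_def by (rule lift_lin[OF is_complex_module[OF Y]]) (use sb in auto)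
  have t_be: "t (deg b) (basis_vec R b) = s (p b) (deg b) (basis_vec R b)" if "b \<in> E" for b
    unfolding t_def by (rule lift_be[OF is_complex_module[OF Y]]) (rule sb[OF that])
  have t_eq: "t n x = s j n x" if j: "j \<in> J" and x: "x \<in> finsupp R {b \<in> fibre p E j. deg b = n}" for j n x
  proof (rule lin_ext[OF is_complex_module[OF Y] _ s[OF j] _ x])
    show "linear R (free_mod R {b \<in> fibre p E j. deg b = n}) (cmodule Y (n - 1)) (t n)"
      by (rule lin_sub[OF t]) auto
    show "t n (basis_vec R b) = s j n (basis_vec R b)" if "b \<in> {b \<in> fibre p E j. deg b = n}" for b
      using t_be[of b] that by auto
  qed
  have t1: "linear R (free_mod R {b \<in> E. deg b = n + 1}) (cmodule Y n) (t (n + 1))" for n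
    using t[of "n + 1"] by simp
  show ?thesis
  proof (rule homotopicI[where s = t], unfold subquot_simps)
    show "linear R (free_mod R {b \<in> E. deg b = n}) (cmodule Y (n - 1)) (t n)" for n by (rule t)
    fix n x assume x: "x \<in> finsupp R {b \<in> E. deg b = n}"
    show "f n x = g n x \<oplus>\<^bsub>cmodule Y n\<^esub> (cdiff Y (n - 1) (t n x) \<oplus>\<^bsub>cmodule Y n\<^esub> t (n + 1) (res R E (bd x)))"
    proof (rule lin_ext[OF is_complex_module[OF Y] _ _ _ x])
      show "linear R (free_mod R {b \<in> E. deg b = n}) (cmodule Y n) (f n)" using chain_map_lin[OF f] by simp
      show "linear R (free_mod R {b \<in> E. deg b = n}) (cmodule Y n) (\<lambda>x. g n x \<oplus>\<^bsub>cmodule Y n\<^esub>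
          (cdiff Y (n - 1) (t n x) \<oplus>\<^bsub>cmodule Y n\<^esub> t (n + 1) (res R E (bd x))))"
        using chain_map_lin[OF g, of n]
        by (intro lin_plus[OF is_complex_module[OF Y]] lin_comp[OF t is_complex_diff'[OF Y]] lin_comp[OF subquot_lin[OF EB] t1]) simp
      fix b assume b: "b \<in> {b \<in> E. deg b = n}"
      then have bj: "b \<in> {c \<in> fibre p E (p b). deg c = n}" and pb: "p b \<in> J" using J by auto
      have x: "basis_vec R b \<in> finsupp R {c \<in> fibre p E (p b). deg c = n}" using bj by simp
      have x': "basis_vec R b \<in> finsupp R (fibre p E (p b))" using bj by simp
      have r: "res R E (bd (basis_vec R b)) = res R (fibre p E (p b)) (bd (basis_vec R b))"
        by (rule rel_closed_bd[OF fibre_rel_closed[OF p] EB x'])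
      have "res R (fibre p E (p b)) (bd (basis_vec R b)) \<in> finsupp R {c \<in> fibre p E (p b). deg c = n + 1}"
        by (rule lin_closed[OF subquot_lin x]) (use EB in auto)
      from t_eq[OF pb this] show "f n (basis_vec R b) = g n (basis_vec R b) \<oplus>\<^bsub>cmodule Y n\<^esub>
          (cdiff Y (n - 1) (t n (basis_vec R b)) \<oplus>\<^bsub>cmodule Y n\<^esub> t (n + 1) (res R E (bd (basis_vec R b))))"
        unfolding r using eq[OF pb x] t_eq[OF pb x] by simp
    qed
  qed
qed

end

section \<open>Compressibility of coproducts\<close>

lemma htpy_coproduct_ex:
  fixes P Y :: "('r, 'u) chain_complex"
  assumes "htpy_coproduct R I X P \<iota>" "Y \<in> projective_complexes R" "\<And>i. i \<in> I \<Longrightarrow> chain_map R (X i) Y (f i)"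
  shows "\<exists>h. chain_map R P Y h \<and> (\<forall>i \<in> I. homotopic R (X i) Y (\<lambda>n x. h n (\<iota> i n x)) (f i))"
  by (rule assms(1)[unfolded htpy_coproduct_def, THEN conjunct2, THEN conjunct2, THEN bspec, OF assms(2),
        THEN conjunct1, THEN spec, THEN mp]) (use assms(3) in blast)

lemma htpy_coproduct_unique:
  fixes P Y :: "('r, 'u) chain_complex"
  assumes "htpy_coproduct R I X P \<iota>" "Y \<in> projective_complexes R" "chain_map R P Y a" "chain_map R P Y b"
    and "\<And>i. i \<in> I \<Longrightarrow> homotopic R (X i) Y (\<lambda>n x. a n (\<iota> i n x)) (\<lambda>n x. b n (\<iota> i n x))"
  shows "homotopic R P Y a b"
  by (rule assms(1)[unfolded htpy_coproduct_def, THEN conjunct2, THEN conjunct2, THEN bspec, OF assms(2),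
        THEN conjunct2, THEN spec, THEN spec, THEN mp]) (use assms(3-5) in blast)

lemma (in based_cplx) fibre_mono_rel_closed:
  assumes p: "splits_by p E" and E': "rel_closed E' E"
  shows "rel_closed (fibre p E' j) (fibre p E j)"
  unfolding rel_closed_def
proof (intro conjI ballI)
  show "fibre p E' j \<subseteq> fibre p E j" using E' by (auto simp: rel_closed_def)
  fix b assume b: "b \<in> fibre p E' j"
  then have "D b \<in> finsupp R (E' \<union> - E)" "D b \<in> finsupp R ({c. p c = p b} \<union> - E)"
    using E' p by (auto simp: rel_closed_def splits_by_def)
  from finsupp_Int[OF this] show "D b \<in> finsupp R (fibre p E' j \<union> - fibre p E j)"
    by (rule finsupp_monoD) (use b in auto)
qed

locale compact_based = compact_class R A U + based_cplx R B deg D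
  for R (structure) and A :: "('a, 'u) chain_complex set" and U and B :: "'k set" and deg D +
  assumes smB: "small B"
begin

definition enc :: "('k \<Rightarrow> 'a) \<Rightarrow> 'u" where "enc = (SOME f. inj_on f (finsupp R B))"

definition dec :: "'u \<Rightarrow> 'k \<Rightarrow> 'a" where "dec = inv_into (finsupp R B) enc"

abbreviation Real :: "'k set \<Rightarrow> ('a, 'u) chain_complex" where "Real E \<equiv> transport enc dec (Sq E)"

lemma dec_enc: "x \<in> finsupp R B \<Longrightarrow> dec (enc x) = x"
proof -
  have "|finsupp R B| \<le>o |U|" by (rule ordLess_imp_ordLeq[OF small_fc[OF smB]])
  then obtain f where "inj_on f (finsupp R B)" "f ` finsupp R B \<subseteq> U" unfolding card_of_ordLeq[symmetric] by blast
  then have "\<exists>f :: _ \<Rightarrow> 'u. inj_on f (finsupp R B)" by blast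
  then have "inj_on enc (finsupp R B)" unfolding enc_def by (rule someI_ex)
  then show "x \<in> finsupp R B \<Longrightarrow> dec (enc x) = x" by (simp add: dec_def)
qed

lemma dec_enc': "E \<subseteq> B \<Longrightarrow> x \<in> carrier (cmodule (Sq E) n) \<Longrightarrow> dec (enc x) = x"
  unfolding subquot_simps by (rule dec_enc, rule finsupp_monoD[of x R "{b \<in> E. deg b = n}"]) auto

lemma Rl_projective:
  assumes "lc E" shows "Real E \<in> projective_complexes R"
proof -
  note EB = loc_closed_subset[OF assms]
  have c: "is_complex R (Real E)" by (rule transport_cplx[OF subquot_cplx[OF assms] dec_enc'[OF EB]])
  have p: "projective R (cmodule (Real E) n)" for n
  proof -
    have "projective R (transport_mod enc dec (free_mod R {b \<in> E. deg b = n}))"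
    proof (rule free_projective)
      show "dec (enc x) = x" if "x \<in> finsupp R {b \<in> E. deg b = n}" for x
        using dec_enc'[OF EB, of x n] that by simp
      show "|finsupp R {b \<in> E. deg b = n}| <o |UNIV :: 'u set|"
        unfolding U[symmetric] by (rule small_fc[OF small_subset[OF _ smB]]) (use EB in auto)
    qed
    then show ?thesis by (simp add: transport_def)
  qed
  have e: "cdiff (Real E) n \<in> extensional (carrier (cmodule (Real E) n))" for n
    by (simp add: transport_def)
  show ?thesis
    unfolding projective_complexes_def rhom_iff_lin
    using p e is_complex_diff[OF c] is_complex_sq[OF c] by blast
qed

lemma enc_chain_map: "lc E \<Longrightarrow> chain_map R (Sq E) (Real E) (\<lambda>n. enc)"
  by (rule transport_enc[OF subquot_cplx dec_enc'[OF loc_closed_subset]])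

lemma dec_chain_map: "lc E \<Longrightarrow> chain_map R (Real E) (Sq E) (\<lambda>n. dec)"
  by (rule transport_dec[OF subquot_cplx dec_enc'[OF loc_closed_subset]])

lemma enc_dec: "lc E \<Longrightarrow> u \<in> carrier (cmodule (Real E) n) \<Longrightarrow> enc (dec u) = u"
  by (rule transport_enc_dec[OF subquot_cplx dec_enc'[OF loc_closed_subset]])

lemma incl_chain_map:
  assumes "lc E" "rel_closed E' E" shows "chain_map R (Real E') (Real E) (\<lambda>n u. enc (dec u))"
proof -
  note E' = rel_closed_lc(1)[OF assms]
  show ?thesis
    using chain_map_comp[OF chain_map_comp[OF dec_chain_map[OF E'] chain_map_inclusion[OF assms(2) loc_closed_subset[OF assms(1)]]]
        enc_chain_map[OF assms(1)]] .
qed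

lemma Rl_coprod:
  assumes E: "lc E" and p: "splits_by p E" and J: "p ` E \<subseteq> J"
  shows "htpy_coproduct R J (\<lambda>j. Real (fibre p E j)) (Real E) (\<lambda>j n u. enc (dec u))"
  unfolding htpy_coproduct_def
proof (intro conjI ballI allI impI)
  note pc = projective_complexes_cplx
  have rc: "rel_closed (fibre p E j) E" for j by (rule fibre_rel_closed[OF p])
  have Ej: "lc (fibre p E j)" for j by (rule rel_closed_lc(1)[OF E rc])
  note EB = loc_closed_subset[OF E]
  note EjB = loc_closed_subset[OF Ej]
  show "Real E \<in> projective_complexes R" by (rule Rl_projective[OF E])
  fix j assume j: "j \<in> J"
  show "Real (fibre p E j) \<in> projective_complexes R" by (rule Rl_projective[OF Ej])
  show "chain_map R (Real (fibre p E j)) (Real E) (\<lambda>n u. enc (dec u))" by (rule incl_chain_map[OF E rc])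
next
  note pc = projective_complexes_cplx
  have rc: "rel_closed (fibre p E j) E" for j by (rule fibre_rel_closed[OF p])
  have Ej: "lc (fibre p E j)" for j by (rule rel_closed_lc(1)[OF E rc])
  note EB = loc_closed_subset[OF E]
  note EjB = loc_closed_subset[OF Ej]
  have RE: "is_complex R (Real E)" "is_complex R (Real (fibre p E j))" for j
    using pc[OF Rl_projective] E Ej by auto
  have inE: "x \<in> carrier (cmodule (Sq (fibre p E j)) n) \<Longrightarrow> x \<in> carrier (cmodule (Sq E) n)" for x j n
    unfolding subquot_simps by (erule finsupp_monoD) auto
  fix Y :: "('a, 'u) chain_complex" assume Y: "Y \<in> projective_complexes R"
  note Yc = pc[OF Y]
  {
    fix f assume f: "\<forall>j\<in>J. chain_map R (Real (fibre p E j)) Y (f j)"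
    have f': "chain_map R (Sq (fibre p E j)) Y (\<lambda>n x. f j n (enc x))" if "j \<in> J" for j
      using chain_map_comp[OF enc_chain_map[OF Ej]] f that by blast
    obtain g where g: "chain_map R (Sq E) Y g"
      "\<And>j n x. j \<in> J \<Longrightarrow> x \<in> finsupp R {b \<in> fibre p E j. deg b = n} \<Longrightarrow> g n x = f j n (enc x)"
      using coproduct_map[OF E p J Yc f'] by blast
    have "homotopic R (Real (fibre p E j)) Y (\<lambda>n u. g n (dec (enc (dec u)))) (f j)" if j: "j \<in> J" for j
    proof (rule homotopic_eqI[OF RE(2) Yc])
      show "chain_map R (Real (fibre p E j)) Y (\<lambda>n u. g n (dec (enc (dec u))))"
        using chain_map_comp[OF incl_chain_map[OF E rc] chain_map_comp[OF dec_chain_map[OF E] g(1)]] .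
      fix n u assume u: "u \<in> carrier (cmodule (Real (fibre p E j)) n)"
      have du: "dec u \<in> carrier (cmodule (Sq (fibre p E j)) n)" by (rule chain_map_closed[OF dec_chain_map[OF Ej] u])
      show "g n (dec (enc (dec u))) = f j n u"
        unfolding dec_enc'[OF EjB du] using g(2)[OF j du[unfolded subquot_simps]] enc_dec[OF Ej u] by simp
    qed
    then have "chain_map R (Real E) Y (\<lambda>n u. g n (dec u)) \<and>
        (\<forall>j\<in>J. homotopic R (Real (fibre p E j)) Y (\<lambda>n u. g n (dec (enc (dec u)))) (f j))"
      using chain_map_comp[OF dec_chain_map[OF E] g(1)] by blast
    then show "\<exists>h. chain_map R (Real E) Y h \<and> (\<forall>j\<in>J. homotopic R (Real (fibre p E j)) Y (\<lambda>n x. h n (enc (dec x))) (f j))"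
      by (rule exI[of _ "\<lambda>n u. g n (dec u)"])
  next
    fix a b assume "chain_map R (Real E) Y a \<and> chain_map R (Real E) Y b \<and>
      (\<forall>j\<in>J. homotopic R (Real (fibre p E j)) Y (\<lambda>n x. a n (enc (dec x))) (\<lambda>n x. b n (enc (dec x))))"
    then have a: "chain_map R (Real E) Y a" and b: "chain_map R (Real E) Y b"
      and ab: "\<And>j. j \<in> J \<Longrightarrow> homotopic R (Real (fibre p E j)) Y (\<lambda>n x. a n (enc (dec x))) (\<lambda>n x. b n (enc (dec x)))"
      by auto
    have a': "chain_map R (Sq E) Y (\<lambda>n x. a n (enc x))" and b': "chain_map R (Sq E) Y (\<lambda>n x. b n (enc x))"
      using chain_map_comp[OF enc_chain_map[OF E] a] chain_map_comp[OF enc_chain_map[OF E] b] .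
    have "homotopic R (Sq (fibre p E j)) Y (\<lambda>n x. a n (enc x)) (\<lambda>n x. b n (enc x))" if j: "j \<in> J" for j
      by (rule homotopic_cong[OF subquot_cplx[OF Ej] homotopic_comp_right[OF enc_chain_map[OF Ej] ab[OF j]]])
        (simp_all only: dec_enc'[OF EjB])
    then have "homotopic R (Sq E) Y (\<lambda>n x. a n (enc x)) (\<lambda>n x. b n (enc x))"
      by (rule coproduct_homotopy[OF E p J Yc a' b'])
    from homotopic_comp_right[OF dec_chain_map[OF E] this] show "homotopic R (Real E) Y a b"
      by (rule homotopic_cong[OF RE(1)]) (simp_all only: enc_dec[OF E])
  }
qed

text \<open>
  Let \<open>f : X \<rightarrow> \<Coprod> E\<^sub>j\<close>.  It factors as \<open>X \<rightarrow> \<Coprod> T\<^sub>j \<rightarrow> \<Coprod> E\<^sub>j\<close> with \<open>T\<^sub>j \<in> A\<close>, and each \<open>T\<^sub>j \<rightarrow> E\<^sub>j\<close> is homotopic to a map into a countable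
  subcomplex \<open>E'\<^sub>j\<close>.  So \<open>f\<close> factors through \<open>\<Coprod> E'\<^sub>j\<close>, and by smallness of \<open>X\<close> through a countable subcoproduct.
\<close>

lemma compressible_coproduct_small_index:
  fixes p :: "'k \<Rightarrow> 'u"
  assumes E: "lc E" and p: "splits_by p E" and comp: "\<And>j. compressible A (fibre p E j)"
  shows "compressible A E"
proof (rule compressibleI)
  note pc = projective_complexes_cplx
  note EB = loc_closed_subset[OF E]
  fix X f assume X: "X \<in> A" and f: "chain_map R X (Sq E) f"
  note Xc = A_cplx[OF X]
  define J where "J = p ` E"
  have J: "p ` E \<subseteq> J" by (simp add: J_def)
  have smJ: "small J" unfolding J_def by (rule small_image[OF small_subset[OF EB smB]])
  have rc: "rel_closed (fibre p E j) E" for j by (rule fibre_rel_closed[OF p])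
  have Ej: "lc (fibre p E j)" for j by (rule rel_closed_lc(1)[OF E rc])
  note EjB = loc_closed_subset[OF Ej]
  have RE: "is_complex R (Real E)" by (rule pc[OF Rl_projective[OF E]])
  have ef: "chain_map R X (Real E) (\<lambda>n x. enc (f n x))" by (rule chain_map_comp[OF f enc_chain_map[OF E]])
  obtain T t Q \<kappa> h g where Tt: "\<forall>j \<in> J. T j \<in> A \<and> chain_map R (T j) (Real (fibre p E j)) (t j)"
    and Q: "htpy_coproduct R J T Q \<kappa>" and h: "chain_map R Q (Real E) h"
    and hk: "\<forall>j \<in> J. homotopic R (T j) (Real E) (\<lambda>n x. h n (\<kappa> j n x)) (\<lambda>n x. enc (dec (t j n x)))"
    and g: "chain_map R X Q g" and fg: "homotopic R X (Real E) (\<lambda>n x. enc (f n x)) (\<lambda>n x. h n (g n x))"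
    using coproduct_factor[OF X smJ Rl_coprod[OF E p J] ef] by (elim exE conjE) (rule that)
  have T: "T j \<in> A" and t: "chain_map R (T j) (Real (fibre p E j)) (t j)"
    and h\<kappa>: "homotopic R (T j) (Real E) (\<lambda>n x. h n (\<kappa> j n x)) (\<lambda>n x. enc (dec (t j n x)))"
    if "j \<in> J" for j using bspec[OF Tt that] bspec[OF hk that] by simp_all
  have Qp: "Q \<in> projective_complexes R" and \<kappa>: "\<And>j. j \<in> J \<Longrightarrow> chain_map R (T j) Q (\<kappa> j)"
    using Q by (auto simp: htpy_coproduct_def)
  have dt: "chain_map R (T j) (Sq (fibre p E j)) (\<lambda>n x. dec (t j n x))" if "j \<in> J" for j
    by (rule chain_map_comp[OF t[OF that] dec_chain_map[OF Ej]])
  \<comment> \<open>What is to be chosen for each index: a compressed map and a countable subcomplex containing its image.\<close>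
  define good where "good = (\<lambda>j t1 K. chain_map R (T j) (Sq (fibre p E j)) t1 \<and>
      homotopic R (T j) (Sq (fibre p E j)) (\<lambda>n x. dec (t j n x)) t1 \<and> closed K \<and> countable K \<and>
      (\<forall>n. \<forall>x \<in> carrier (cmodule (T j) n). t1 n x \<in> finsupp R K))"
  have "\<exists>t1 K. good j t1 K" if j: "j \<in> J" for j
  proof -
    obtain t1 S where t1: "countable S" "chain_map R (T j) (Sq (fibre p E j)) t1"
      "homotopic R (T j) (Sq (fibre p E j)) (\<lambda>n x. dec (t j n x)) t1"
      and t1S: "\<forall>n. \<forall>x \<in> carrier (cmodule (T j) n). t1 n x \<in> finsupp R S"
      using comp[unfolded compressible_def, rule_format, OF T[OF j] dt[OF j]]
      by (elim exE conjE) (rule that)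
    obtain K where K: "countable K" "S \<inter> B \<subseteq> K" "closed K"
      by (rule countable_closure[of "S \<inter> B"]) (use t1(1) in auto)
    have "t1 n x \<in> finsupp R K" if x: "x \<in> carrier (cmodule (T j) n)" for n x
    proof -
      have "t1 n x \<in> finsupp R {b \<in> fibre p E j. deg b = n}" using chain_map_closed[OF t1(2) x] by simp
      moreover have "t1 n x \<in> finsupp R S" using t1S x by blast
      ultimately have "t1 n x \<in> finsupp R ({b \<in> fibre p E j. deg b = n} \<inter> S)" by (rule finsupp_Int)
      then show ?thesis
        by (rule finsupp_monoD) (use K(2) EB in auto)
    qed
    then show ?thesis using t1 K unfolding good_def by blast
  qed
  then have "\<forall>j. \<exists>t1 K. j \<in> J \<longrightarrow> good j t1 K" by blast
  then obtain t1 where "\<forall>j. \<exists>K. j \<in> J \<longrightarrow> good j (t1 j) K" using choice[of "\<lambda>j t1. \<exists>K. j \<in> J \<longrightarrow> good j t1 K"] by blast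
  then obtain K where tK: "\<forall>j. j \<in> J \<longrightarrow> good j (t1 j) (K j)" using choice[of "\<lambda>j K. j \<in> J \<longrightarrow> good j (t1 j) K"] by blast
  have t1: "chain_map R (T j) (Sq (fibre p E j)) (t1 j)" "homotopic R (T j) (Sq (fibre p E j)) (\<lambda>n x. dec (t j n x)) (t1 j)"
    and K: "closed (K j)" "countable (K j)"
    and tK': "\<And>n x. x \<in> carrier (cmodule (T j) n) \<Longrightarrow> t1 j n x \<in> finsupp R (K j)" if "j \<in> J" for j
    using tK that unfolding good_def by blast+
  define E' where "E' = {b \<in> E. b \<in> K (p b)}"
  have E'_rel: "rel_closed E' E" unfolding rel_closed_def
  proof (intro conjI ballI)
    show "E' \<subseteq> E" by (auto simp: E'_def)
    fix b assume b: "b \<in> E'"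
    then have bJ: "p b \<in> J" and bE: "b \<in> E" and bK: "b \<in> K (p b)" by (auto simp: E'_def J_def)
    have "D b \<in> finsupp R (K (p b))" using K(1)[OF bJ] bK by (auto simp: closed_in_def)
    moreover have "D b \<in> finsupp R ({c. p c = p b} \<union> - E)" using p bE by (auto simp: splits_by_def)
    ultimately have "D b \<in> finsupp R (K (p b) \<inter> ({c. p c = p b} \<union> - E))" by (rule finsupp_Int)
    then show "D b \<in> finsupp R (E' \<union> - E)" by (rule finsupp_monoD) (auto simp: E'_def)
  qed
  have sub_split: "splits_by p E0" if "rel_closed E0 E" for E0
    unfolding splits_by_def
  proof
    fix b assume b: "b \<in> E0"
    then have "D b \<in> finsupp R ({c. p c = p b} \<union> - E)"
      using p that by (auto simp: splits_by_def rel_closed_def)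
    then show "D b \<in> finsupp R ({c. p c = p b} \<union> - E0)"
      by (rule finsupp_monoD) (use that in \<open>auto simp: rel_closed_def\<close>)
  qed
  have E'lc: "lc E'" by (rule rel_closed_lc(1)[OF E E'_rel])
  have E'p: "splits_by p E'" by (rule sub_split[OF E'_rel])
  have rc': "rel_closed (fibre p E' j) E'" for j by (rule fibre_rel_closed[OF E'p])
  have Ej': "lc (fibre p E' j)" for j by (rule rel_closed_lc(1)[OF E'lc rc'])
  have J': "p ` E' \<subseteq> J" using J by (auto simp: E'_def)
  have RE': "is_complex R (Real E')" by (rule pc[OF Rl_projective[OF E'lc]])
  have t1': "chain_map R (T j) (Sq (fibre p E' j)) (t1 j)" if j: "j \<in> J" for j
  proof (rule chain_map_into_sub[OF _ EjB t1(1)[OF j]])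
    show "rel_closed (fibre p E' j) (fibre p E j)" by (rule fibre_mono_rel_closed[OF p E'_rel])
    fix n x assume x: "x \<in> carrier (cmodule (T j) n)"
    have "t1 j n x \<in> finsupp R {b \<in> fibre p E j. deg b = n}" using chain_map_closed[OF t1(1)[OF j] x] by simp
    from finsupp_Int[OF this tK'[OF j x]] show "t1 j n x \<in> finsupp R (fibre p E' j)"
      by (rule finsupp_monoD) (auto simp: E'_def)
  qed
  have e1: "chain_map R (T j) (Real E') (\<lambda>n x. enc (t1 j n x))" if j: "j \<in> J" for j
    by (rule chain_map_comp[OF chain_map_comp[OF t1'[OF j] chain_map_inclusion[OF rc' loc_closed_subset[OF E'lc]]] enc_chain_map[OF E'lc]])
  obtain h' where h': "chain_map R Q (Real E') h'"
    "\<And>j. j \<in> J \<Longrightarrow> homotopic R (T j) (Real E') (\<lambda>n x. h' n (\<kappa> j n x)) (\<lambda>n x. enc (t1 j n x))"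
    using htpy_coproduct_ex[where f = "\<lambda>j n x. enc (t1 j n x)", OF Q Rl_projective[OF E'lc] e1] by blast
  have inc: "chain_map R (Real E') (Real E) (\<lambda>n u. enc (dec u))" by (rule incl_chain_map[OF E E'_rel])
  have ih': "chain_map R Q (Real E) (\<lambda>n x. enc (dec (h' n x)))" by (rule chain_map_comp[OF h'(1) inc])
  have "homotopic R Q (Real E) h (\<lambda>n x. enc (dec (h' n x)))"
  proof (rule htpy_coproduct_unique[OF Q Rl_projective[OF E] h ih'])
    fix j assume j: "j \<in> J"
    note Tc = A_cplx[OF T[OF j]]
    have ie: "chain_map R (Sq (fibre p E j)) (Real E) (\<lambda>n x. enc x)"
      by (rule chain_map_comp[OF chain_map_inclusion[OF rc EB] enc_chain_map[OF E]])
    have et: "chain_map R (T j) (Real E) (\<lambda>n x. enc (t1 j n x))"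
      by (rule chain_map_comp[OF t1(1)[OF j] ie])
    have "homotopic R (T j) (Real E) (\<lambda>n x. enc (dec (t j n x))) (\<lambda>n x. enc (t1 j n x))"
      by (rule homotopic_comp_left[OF Tc subquot_cplx[OF Ej] RE t1(1)[OF j] ie t1(2)[OF j]])
    then have 1: "homotopic R (T j) (Real E) (\<lambda>n x. h n (\<kappa> j n x)) (\<lambda>n x. enc (t1 j n x))"
      by (rule homotopic_trans[OF Tc RE et h\<kappa>[OF j]])
    have "homotopic R (T j) (Real E) (\<lambda>n x. enc (dec (h' n (\<kappa> j n x)))) (\<lambda>n x. enc (dec (enc (t1 j n x))))"
      by (rule homotopic_comp_left[OF Tc RE' RE e1[OF j] inc h'(2)[OF j]])
    then have 2: "homotopic R (T j) (Real E) (\<lambda>n x. enc (dec (h' n (\<kappa> j n x)))) (\<lambda>n x. enc (t1 j n x))"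
      by (rule homotopic_cong[OF Tc]) (simp_all only: dec_enc'[OF EjB chain_map_closed[OF t1(1)[OF j]]])
    show "homotopic R (T j) (Real E) (\<lambda>n x. h n (\<kappa> j n x)) (\<lambda>n x. enc (dec (h' n (\<kappa> j n x))))"
      by (rule homotopic_trans[OF Tc RE chain_map_comp[OF \<kappa>[OF j] ih'] 1 homotopic_sym[OF Tc RE chain_map_comp[OF \<kappa>[OF j] ih'] et 2]])
  qed
  from homotopic_comp_right[OF g this]
  have s1: "homotopic R X (Real E) (\<lambda>n x. h n (g n x)) (\<lambda>n x. enc (dec (h' n (g n x))))" .
  have f2: "chain_map R X (Real E') (\<lambda>n x. h' n (g n x))" by (rule chain_map_comp[OF g h'(1)])
  obtain I P' \<iota> jj g2 where I: "I \<subseteq> J" "countable I"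
    and P': "htpy_coproduct R I (\<lambda>j. Real (fibre p E' j)) P' \<iota>" and jj: "chain_map R P' (Real E') jj"
    and ji: "\<forall>i \<in> I. homotopic R (Real (fibre p E' i)) (Real E') (\<lambda>n x. jj n (\<iota> i n x)) (\<lambda>n u. enc (dec u))"
    and g2: "chain_map R X P' g2" and s2: "homotopic R X (Real E') (\<lambda>n x. h' n (g n x)) (\<lambda>n x. jj n (g2 n x))"
    using small_factor[OF X smJ Rl_coprod[OF E'lc E'p J'] f2] by (elim exE conjE) (rule that)
  have P'p: "P' \<in> projective_complexes R" and \<iota>: "\<And>i. i \<in> I \<Longrightarrow> chain_map R (Real (fibre p E' i)) P' (\<iota> i)"
    using P' by (auto simp: htpy_coproduct_def)
  define E0 where "E0 = {b \<in> E'. p b \<in> I}"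
  have E0c: "countable E0"
  proof (rule countable_subset)
    show "E0 \<subseteq> (\<Union>i\<in>I. K i)" by (auto simp: E0_def E'_def)
    show "countable (\<Union>i\<in>I. K i)" using I K(2) by auto
  qed
  have E0_rel': "rel_closed E0 E'" unfolding rel_closed_def
  proof (intro conjI ballI)
    fix b assume b: "b \<in> E0"
    then have "D b \<in> finsupp R ({c. p c = p b} \<union> - E')" using E'p by (auto simp: splits_by_def E0_def)
    then show "D b \<in> finsupp R (E0 \<union> - E')" by (rule finsupp_monoD) (use b in \<open>auto simp: E0_def\<close>)
  qed (auto simp: E0_def)
  have E0_rel: "rel_closed E0 E" unfolding rel_closed_def
  proof (intro conjI ballI)
    show "E0 \<subseteq> E" by (auto simp: E0_def E'_def)
    fix b assume b: "b \<in> E0"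
    then have "D b \<in> finsupp R (E0 \<union> - E')" "D b \<in> finsupp R (E' \<union> - E)"
      using E0_rel' E'_rel by (auto simp: rel_closed_def E0_def)
    from finsupp_Int[OF this] show "D b \<in> finsupp R (E0 \<union> - E)" by (rule finsupp_monoD) auto
  qed
  have E0lc: "lc E0" by (rule rel_closed_lc(1)[OF E E0_rel])
  note E0B = loc_closed_subset[OF E0lc]
  have rel0: "rel_closed (fibre p E' i) E0" if i: "i \<in> I" for i unfolding rel_closed_def
  proof (intro conjI ballI)
    show "fibre p E' i \<subseteq> E0" using i by (auto simp: E0_def)
    fix b assume "b \<in> fibre p E' i"
    then have "D b \<in> finsupp R (fibre p E' i \<union> - E')" using rc'[of i] by (auto simp: rel_closed_def)
    then show "D b \<in> finsupp R (fibre p E' i \<union> - E0)" by (rule finsupp_monoD) (auto simp: E0_def)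
  qed
  have i0: "chain_map R (Real (fibre p E' i)) (Real E0) (\<lambda>n u. enc (dec u))" if i: "i \<in> I" for i
    by (rule incl_chain_map[OF E0lc rel0[OF i]])
  obtain u where u: "chain_map R P' (Real E0) u"
    "\<And>i. i \<in> I \<Longrightarrow> homotopic R (Real (fibre p E' i)) (Real E0) (\<lambda>n x. u n (\<iota> i n x)) (\<lambda>n u. enc (dec u))"
    using htpy_coproduct_ex[where f = "\<lambda>j n u. enc (dec u)", OF P' Rl_projective[OF E0lc] i0] by blast
  have inc0: "chain_map R (Real E0) (Real E') (\<lambda>n u. enc (dec u))" by (rule incl_chain_map[OF E'lc E0_rel'])
  have iu: "chain_map R P' (Real E') (\<lambda>n x. enc (dec (u n x)))" by (rule chain_map_comp[OF u(1) inc0])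
  have "homotopic R P' (Real E') jj (\<lambda>n x. enc (dec (u n x)))"
  proof (rule htpy_coproduct_unique[OF P' Rl_projective[OF E'lc] jj iu])
    fix i assume i: "i \<in> I"
    have Rc: "is_complex R (Real (fibre p E' i))" by (rule pc[OF Rl_projective[OF Ej']])
    have inci: "chain_map R (Real (fibre p E' i)) (Real E') (\<lambda>n u. enc (dec u))" by (rule incl_chain_map[OF E'lc rc'])
    have "homotopic R (Real (fibre p E' i)) (Real E') (\<lambda>n x. enc (dec (u n (\<iota> i n x)))) (\<lambda>n x. enc (dec (enc (dec x))))"
      by (rule homotopic_comp_left[OF Rc pc[OF Rl_projective[OF E0lc]] RE' i0[OF i] inc0 u(2)[OF i]])
    then have 2: "homotopic R (Real (fibre p E' i)) (Real E') (\<lambda>n x. enc (dec (u n (\<iota> i n x)))) (\<lambda>n x. enc (dec x))"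
      by (rule homotopic_cong[OF Rc]) (simp_all only: enc_dec[OF Ej'])
    show "homotopic R (Real (fibre p E' i)) (Real E') (\<lambda>n x. jj n (\<iota> i n x)) (\<lambda>n x. enc (dec (u n (\<iota> i n x))))"
      by (rule homotopic_trans[OF Rc RE' chain_map_comp[OF \<iota>[OF i] iu] bspec[OF ji i]
            homotopic_sym[OF Rc RE' chain_map_comp[OF \<iota>[OF i] iu] inci 2]])
  qed
  from homotopic_comp_right[OF g2 this]
  have s3: "homotopic R X (Real E') (\<lambda>n x. jj n (g2 n x)) (\<lambda>n x. enc (dec (u n (g2 n x))))" .
  have ug: "chain_map R X (Real E0) (\<lambda>n x. u n (g2 n x))" by (rule chain_map_comp[OF g2 u(1)])
  have c3: "chain_map R X (Real E') (\<lambda>n x. enc (dec (u n (g2 n x))))" by (rule chain_map_comp[OF ug inc0])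
  have s23: "homotopic R X (Real E') (\<lambda>n x. h' n (g n x)) (\<lambda>n x. enc (dec (u n (g2 n x))))"
    by (rule homotopic_trans[OF Xc RE' c3 s2 s3])
  have s4: "homotopic R X (Real E) (\<lambda>n x. enc (dec (h' n (g n x)))) (\<lambda>n x. enc (dec (enc (dec (u n (g2 n x))))))"
    by (rule homotopic_comp_left[OF Xc RE' RE c3 inc s23])
  have c4: "chain_map R X (Real E) (\<lambda>n x. enc (dec (enc (dec (u n (g2 n x))))))" by (rule chain_map_comp[OF c3 inc])
  have s5: "homotopic R X (Real E) (\<lambda>n x. enc (f n x)) (\<lambda>n x. enc (dec (enc (dec (u n (g2 n x))))))"
    by (rule homotopic_trans[OF Xc RE c4 fg homotopic_trans[OF Xc RE c4 s1 s4]])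
  define f' where "f' = (\<lambda>n x. dec (u n (g2 n x)))"
  have f'0: "chain_map R X (Sq E0) f'" unfolding f'_def by (rule chain_map_comp[OF ug dec_chain_map[OF E0lc]])
  have f': "chain_map R X (Sq E) f'" using chain_map_comp[OF f'0 chain_map_inclusion[OF E0_rel EB]] .
  have "homotopic R X (Sq E) (\<lambda>n x. dec (enc (f n x))) (\<lambda>n x. dec (enc (dec (enc (f' n x)))))"
    unfolding f'_def by (rule homotopic_comp_left[OF Xc RE subquot_cplx[OF E] c4 dec_chain_map[OF E] s5])
  then have "homotopic R X (Sq E) f f'"
    by (rule homotopic_cong[OF Xc]) (simp_all only: dec_enc'[OF EB chain_map_closed[OF f]] dec_enc'[OF EB chain_map_closed[OF f']])
  moreover have "f' n x \<in> finsupp R E0" if x: "x \<in> carrier (cmodule X n)" for n x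
    using chain_map_closed[OF f'0 x] unfolding subquot_simps by (rule finsupp_monoD) auto
  ultimately show "\<exists>f' S. countable S \<and> chain_map R X (Sq E) f' \<and> homotopic R X (Sq E) f f' \<and>
      (\<forall>n. \<forall>x\<in>carrier (cmodule X n). f' n x \<in> finsupp R S)"
    using E0c f' by (intro exI[of _ f'] exI[of _ E0] conjI allI ballI)
qed

end

context compact_based
begin

section \<open>Compressibility of filtered complexes\<close>

lemma hcompressible_compressible: "hcompressible A E \<Longrightarrow> compressible A E"
  unfolding hcompressible_def by (drule spec[of _ "{}"]) (simp add: closed_in_def)

lemma compressible_countable: "lc E \<Longrightarrow> countable E \<Longrightarrow> compressible A E"
  by (rule hcompressible_compressible[OF hcompressible_countable[OF A_cplx]])

text \<open>
  The index set can be replaced by its image under an injection into the universe.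
\<close>

lemma compressible_coproduct:
  fixes p :: "'k \<Rightarrow> 'j"
  assumes E: "lc E" and p: "splits_by p E" and comp: "\<And>j. compressible A (fibre p E j)"
  shows "compressible A E"
proof -
  have "small (p ` E)" by (rule small_image[OF small_subset[OF loc_closed_subset[OF E] smB]])
  then have "|p ` E| \<le>o |U|" by (rule ordLess_imp_ordLeq)
  then have "\<exists>f. inj_on f (p ` E) \<and> f ` p ` E \<subseteq> U" by (simp only: card_of_ordLeq)
  then obtain code :: "'j \<Rightarrow> 'u" where code: "inj_on code (p ` E)" by blast
  have q: "splits_by (\<lambda>b. code (p b)) E"
    unfolding splits_by_def
  proof
    fix b assume "b \<in> E"
    then have "D b \<in> finsupp R ({c. p c = p b} \<union> - E)" using p by (auto simp: splits_by_def)
    then show "D b \<in> finsupp R ({c. code (p c) = code (p b)} \<union> - E)" by (rule finsupp_monoD) auto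
  qed
  have "compressible A (fibre (\<lambda>b. code (p b)) E u)" for u
  proof (cases "\<exists>b \<in> E. code (p b) = u")
    case True
    then obtain b where "b \<in> E" "code (p b) = u" by blast
    then have "fibre (\<lambda>b. code (p b)) E u = fibre p E (p b)"
      using code by (auto dest: inj_onD)
    then show ?thesis using comp by simp
  next
    case False
    then have e: "fibre (\<lambda>b. code (p b)) E u = {}" by auto
    have "lc {}" by (rule closed_lc) (simp add: closed_in_def)
    then show ?thesis unfolding e by (rule compressible_countable) simp
  qed
  then show ?thesis by (rule compressible_coproduct_small_index[OF E q])
qed

lemma hcompressible_coproduct:
  fixes p :: "'k \<Rightarrow> 'j"
  assumes E: "lc E" and p: "splits_by p E" and comp: "\<And>j. hcompressible A (fibre p E j)"
  shows "hcompressible A E"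
  unfolding hcompressible_def
proof (intro allI impI)
  fix K assume K: "closed K" "countable K"
  show "compressible A (E - K)"
  proof (rule compressible_coproduct[OF loc_closed_Diff[OF E K(1)]])
    show "splits_by p (E - K)" unfolding splits_by_def
    proof
      fix b assume "b \<in> E - K"
      then have "D b \<in> finsupp R ({c. p c = p b} \<union> - E)" using p by (auto simp: splits_by_def)
      then show "D b \<in> finsupp R ({c. p c = p b} \<union> - (E - K))" by (rule finsupp_monoD) auto
    qed
    have "fibre p (E - K) j = fibre p E j - K" for j by auto
    then show "compressible A (fibre p (E - K) j)" for j
      using comp[of j] K by (simp add: hcompressible_def)
  qed
qed

text \<open>
  Induction over the levels of \<open>\<rho>\<close>: each level is the coproduct of the complexes on the fibres of \<open>p\<close>, and adding a level is an extension.
\<close>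

lemma hcompressible_filtered:
  fixes p :: "'k \<Rightarrow> 'j" and \<rho> :: "'k \<Rightarrow> nat"
  assumes E: "lc E" and bound: "\<And>b. b \<in> E \<Longrightarrow> \<rho> b \<le> N"
    and DE: "\<And>b. b \<in> E \<Longrightarrow> D b \<in> finsupp R ({c. \<rho> c < \<rho> b \<or> \<rho> c = \<rho> b \<and> p c = p b} \<union> - E)"
    and levels: "\<And>m j. lc {b \<in> E. \<rho> b = m \<and> p b = j} \<Longrightarrow> hcompressible A {b \<in> E. \<rho> b = m \<and> p b = j}"
  shows "hcompressible A E"
proof -
  \<comment> \<open>Strict inequality, so that the induction starts at the empty complex.\<close>
  define F where "F n = {b \<in> E. \<rho> b < n}" for n
  have F_rel: "rel_closed (F m) (F n)" if "m \<le> n" for m n unfolding rel_closed_def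
  proof (intro conjI ballI)
    show "F m \<subseteq> F n" using that by (auto simp: F_def)
    fix b assume b: "b \<in> F m"
    then have "D b \<in> finsupp R ({c. \<rho> c < \<rho> b \<or> \<rho> c = \<rho> b \<and> p c = p b} \<union> - E)" using DE by (auto simp: F_def)
    then show "D b \<in> finsupp R (F m \<union> - F n)" by (rule finsupp_monoD) (use b in \<open>auto simp: F_def\<close>)
  qed
  have FN: "F n = E" if "N < n" for n using bound that by (force simp: F_def)
  have Flc: "lc (F n)" for n
    using rel_closed_lc(1)[of "F (max n (Suc N))" "F n"] F_rel[of n "max n (Suc N)"] FN[of "max n (Suc N)"] E by simp
  have "hcompressible A (F n)" for n
  proof (induction n)
    case 0
    have "F 0 = {}" by (simp add: F_def)
    then show ?case using hcompressible_countable[OF A_cplx Flc[of 0]] by simp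
  next
    case (Suc n)
    have rel: "rel_closed (F n) (F (Suc n))" by (rule F_rel) simp
    define G where "G = F (Suc n) - F n"
    have G: "G = {b \<in> E. \<rho> b = n}" by (auto simp: G_def F_def)
    have Glc: "lc G" unfolding G_def by (rule rel_closed_lc(2)[OF Flc rel])
    have Gp: "splits_by p G" unfolding splits_by_def
    proof
      fix b assume b: "b \<in> G"
      then have "D b \<in> finsupp R ({c. \<rho> c < \<rho> b \<or> \<rho> c = \<rho> b \<and> p c = p b} \<union> - E)" using DE by (auto simp: G)
      then show "D b \<in> finsupp R ({c. p c = p b} \<union> - G)" by (rule finsupp_monoD) (use b in \<open>auto simp: G\<close>)
    qed
    have "hcompressible A (fibre p G j)" for j
    proof -
      have "fibre p G j = {b \<in> E. \<rho> b = n \<and> p b = j}" by (auto simp: G)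
      then show ?thesis
        using levels[of n j] rel_closed_lc(1)[OF Glc fibre_rel_closed[OF Gp], of j] by simp
    qed
    then have h2: "hcompressible A (F (Suc n) - F n)"
      unfolding G_def[symmetric] by (rule hcompressible_coproduct[OF Glc Gp])
    show ?case by (rule hcompressible_extension[OF A_cplx Flc rel Suc h2])
  qed
  from this[of "Suc N"] show ?thesis using FN[of "Suc N"] by simp
qed

text \<open>
  The telescope is an extension of two coproducts indexed by the stage \<open>k\<close>; each summand has a finite filtration by \<open>\<rho>\<close>
  whose levels are coproducts of countable complexes indexed by \<open>l\<close>.  So the previous lemma applies twice.
\<close>

lemma telescope_shape_compressible:
  fixes e :: "'k \<Rightarrow> bool" and k \<rho> :: "'k \<Rightarrow> nat" and l :: "'k \<Rightarrow> 'j"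
  assumes DB: "\<And>b. b \<in> B \<Longrightarrow> D b \<in> finsupp R {c. e b \<and> \<not> e c \<or> e c = e b \<and> k c = k b \<and>
      (\<rho> c < \<rho> b \<or> \<rho> c = \<rho> b \<and> l c = l b)}"
    and bound: "\<And>b. b \<in> B \<Longrightarrow> \<rho> b \<le> k b"
    and fibres: "\<And>x y z w. countable {b \<in> B. e b = x \<and> k b = y \<and> \<rho> b = z \<and> l b = w}"
  shows "compressible A B"
proof -
  define \<epsilon> where "\<epsilon> b = (if e b then 1 else 0 :: nat)" for b
  have "hcompressible A B"
  proof (rule hcompressible_filtered[where \<rho> = \<epsilon> and p = k and N = 1])
    show "lc B" by (rule closed_lc[OF B_closed])
    show "\<epsilon> b \<le> 1" for b by (simp add: \<epsilon>_def)
    show "D b \<in> finsupp R ({c. \<epsilon> c < \<epsilon> b \<or> \<epsilon> c = \<epsilon> b \<and> k c = k b} \<union> - B)" if "b \<in> B" for b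
      using DB[OF that] by (rule finsupp_monoD) (auto simp: \<epsilon>_def)
    fix x y assume lcE: "lc {b \<in> B. \<epsilon> b = x \<and> k b = y}"
    show "hcompressible A {b \<in> B. \<epsilon> b = x \<and> k b = y}"
    proof (rule hcompressible_filtered[OF lcE, where \<rho> = \<rho> and p = l and N = y])
      show "\<rho> b \<le> y" if "b \<in> {b \<in> B. \<epsilon> b = x \<and> k b = y}" for b using that bound by auto
      show "D b \<in> finsupp R ({c. \<rho> c < \<rho> b \<or> \<rho> c = \<rho> b \<and> l c = l b} \<union> - {b \<in> B. \<epsilon> b = x \<and> k b = y})"
        if b: "b \<in> {b \<in> B. \<epsilon> b = x \<and> k b = y}" for b
        by (rule finsupp_monoD[OF DB]) (use b in \<open>auto simp: \<epsilon>_def split: if_splits\<close>)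
      fix z w assume lcF: "lc {b \<in> {b \<in> B. \<epsilon> b = x \<and> k b = y}. \<rho> b = z \<and> l b = w}"
      have cnt: "countable {b \<in> {b \<in> B. \<epsilon> b = x \<and> k b = y}. \<rho> b = z \<and> l b = w}"
        by (rule countable_subset[OF _ fibres[of "x = 1" y z w]]) (auto simp: \<epsilon>_def)
      show "hcompressible A {b \<in> {b \<in> B. \<epsilon> b = x \<and> k b = y}. \<rho> b = z \<and> l b = w}"
        by (rule hcompressible_countable[OF A_cplx lcF cnt])
    qed
  qed
  then show ?thesis by (rule hcompressible_compressible)
qed

end

text \<open>
  Cover the basis by countable subcomplexes \<open>cov i\<close> containing \<open>i\<close>, well-order the basis, and let \<open>r b\<close> be the least \<open>i\<close> with \<open>b\<close> in \<open>cov i\<close>.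
  If \<open>c\<close> occurs in the differential of \<open>b\<close>, it lies in \<open>cov (r b)\<close>, so \<open>r c\<close> is at most \<open>r b\<close>.
\<close>

lemma (in based_cplx) covering:
  obtains cov r W where "covered_cplx R B deg D cov r W"
proof -
  have "\<exists>C. closed C \<and> countable C \<and> i \<in> C" if "i \<in> B" for i
    using countable_closure[of "{i}"] that by auto
  then obtain cov where cov: "\<And>i. i \<in> B \<Longrightarrow> closed (cov i) \<and> countable (cov i) \<and> i \<in> cov i" by metis
  obtain ro :: "'k rel" where ro: "Well_order ro" "Field ro = UNIV"
    using well_ordering[where 'a = 'k] by (elim exE conjE) (rule that)
  define W where "W = ro - Relation.Id"
  have W: "wf W" "trans W"
    using ro by (simp_all add: W_def well_order_on_def linear_order_on_def partial_order_on_def preorder_on_def trans_diff_Id)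
  have tot: "(a, b) \<in> W \<or> a = b \<or> (b, a) \<in> W" for a b
    using ro by (auto simp: W_def well_order_on_def linear_order_on_def total_on_def)
  have "\<exists>z. z \<in> B \<and> b \<in> cov z \<and> (\<forall>y. (y, z) \<in> W \<longrightarrow> \<not> (y \<in> B \<and> b \<in> cov y))" if "b \<in> B" for b
  proof -
    have "b \<in> {z \<in> B. b \<in> cov z}" using that cov by simp
    then obtain z where "z \<in> {z \<in> B. b \<in> cov z}" "\<And>y. (y, z) \<in> W \<Longrightarrow> y \<notin> {z \<in> B. b \<in> cov z}"
      by (rule wfE_min[OF W(1)]) blast
    then show ?thesis by blast
  qed
  then obtain r where r: "\<And>b. b \<in> B \<Longrightarrow> r b \<in> B \<and> b \<in> cov (r b) \<and>
      (\<forall>y. (y, r b) \<in> W \<longrightarrow> \<not> (y \<in> B \<and> b \<in> cov y))" by metis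
  have "covered_cplx R B deg D cov r W"
  proof (unfold_locales)
    fix b c assume b: "b \<in> B" and c: "c \<in> support R (D b)"
    have "D b \<in> finsupp R (cov (r b))" using cov[of "r b"] r[OF b] by (auto simp: closed_in_def)
    then have "c \<in> cov (r b)" using c by (auto simp: finsupp_iff)
    moreover have "c \<in> B" using D_closed[OF b] c by (auto simp: finsupp_iff)
    ultimately show "r c = r b \<or> (r c, r b) \<in> W" using r[of c] r[OF b] tot[of "r c" "r b"] by blast
  qed (use cov r W in auto)
  then show ?thesis by (rule that)
qed

section \<open>Projective complexes are retracts of based complexes\<close>

context compact_class
begin

text \<open>
  The free module on the carrier of \<open>P\<close> maps onto \<open>P\<close>.  The basis elements carry a label \<open>n\<close>, later the degree, to keep the bases of different degrees disjoint.
\<close>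

lemma projective_splitting:
  fixes P :: "('a, 'u) rmodule"
  assumes P: "projective R P"
  obtains \<sigma> where "linear R P (free_mod R ({n} \<times> carrier P)) \<sigma>"
    "\<And>x. x \<in> carrier P \<Longrightarrow> lift R P snd (\<sigma> x) = x"
proof -
  let ?E = "{n} \<times> carrier P"
  have Pm: "right_module R P" and Ps: "|carrier P| <o |U|"
    using P by (auto simp: projective_def small_right_module_def small_sets_def U)
  have smE: "small ?E" by (rule small_inj[OF _ _ Ps, of snd]) (auto simp: inj_on_def)
  have "|finsupp R ?E| \<le>o |U|" by (rule ordLess_imp_ordLeq[OF small_fc[OF smE]])
  then have "\<exists>f. inj_on f (finsupp R ?E) \<and> f ` finsupp R ?E \<subseteq> U" by (simp only: card_of_ordLeq)
  then obtain enc :: "_ \<Rightarrow> 'u" where enc: "inj_on enc (finsupp R ?E)" by blast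
  define dec where "dec = inv_into (finsupp R ?E) enc"
  have inv: "dec (enc x) = x" if "x \<in> finsupp R ?E" for x using that enc by (simp add: dec_def)
  let ?M = "transport_mod enc dec (free_mod R ?E)"
  have M: "right_module R ?M" by (rule transport_mod_module[OF free_mod_module inv])
  have sM: "small_right_module R ?M"
    using M small_image[OF small_fc[OF smE], of enc] by (simp add: small_right_module_def small_sets_def U)
  have l: "linear R (free_mod R ?E) P (lift R P snd)" by (rule lift_lin[OF Pm]) auto
  define g where "g = restrict (\<lambda>u. lift R P snd (dec u)) (carrier ?M)"
  have gl: "linear R ?M P g"
    by (rule lin_cong[OF M lin_comp[OF transport_mod_lin'[OF free_mod_module inv] l]]) (auto simp: g_def)
  then have g: "g \<in> rhom R ?M P" by (simp add: rhom_iff_lin g_def)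
  have "linear R P P (restrict (\<lambda>x. x) (carrier P))"
    by (rule lin_cong[OF Pm, where f = "\<lambda>x. x"]) (auto simp: linear_def)
  then have id: "restrict (\<lambda>x. x) (carrier P) \<in> rhom R P P" by (simp add: rhom_iff_lin)
  have lb: "lift R P snd (basis_vec R (n, x)) = x" if "x \<in> carrier P" for x
    using lift_be[OF Pm, of snd "(n, x)"] that by simp
  have surj: "g ` carrier ?M = carrier P"
  proof
    show "g ` carrier ?M \<subseteq> carrier P" by (rule image_subsetI, rule lin_closed[OF gl])
    show "carrier P \<subseteq> g ` carrier ?M"
    proof
      fix x assume x: "x \<in> carrier P"
      then have b: "basis_vec R (n, x) \<in> finsupp R ?E" by simp
      have "g (enc (basis_vec R (n, x))) = x" using b inv[OF b] lb[OF x] by (simp add: g_def)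
      then show "x \<in> g ` carrier ?M" using b by (metis imageI transport_mod_simps(1))
    qed
  qed
  have "\<exists>h\<in>rhom R P ?M. \<forall>x\<in>carrier P. g (h x) = restrict (\<lambda>x. x) (carrier P) x"
    using P sM surj g id unfolding projective_def by blast
  then obtain h where h: "h \<in> rhom R P ?M" "\<And>x. x \<in> carrier P \<Longrightarrow> g (h x) = x" by auto
  have hl: "linear R P ?M h" using h(1) by (simp add: rhom_iff_lin)
  show ?thesis
  proof (rule that)
    show "linear R P (free_mod R ?E) (\<lambda>x. dec (h x))" by (rule lin_comp[OF hl transport_mod_lin'[OF free_mod_module inv]])
    show "lift R P snd (dec (h x)) = x" if "x \<in> carrier P" for x
      using h(2)[OF that] lin_closed[OF hl that] by (simp add: g_def)
  qed
qed

text \<open>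
  Let \<open>p\<^sub>n\<close> be the surjection from the free module on \<open>X\<^sub>n\<close> and \<open>\<sigma>\<^sub>n\<close> a section of it.  Then \<open>\<sigma> d p\<close> is a differential on the free modules,
  because \<open>\<sigma> d p \<sigma> d p = \<sigma> d d p = 0\<close>, and \<open>\<sigma>\<close>, \<open>p\<close> are chain maps with \<open>p \<sigma> = 1\<close>.
\<close>

lemma projective_complex_retract:
  fixes X :: "('a, 'u) chain_complex"
  assumes X: "X \<in> projective_complexes R"
  obtains B :: "(int \<times> 'u) set" and deg D i p where "small B" "based_complex R B deg D"
    "chain_map R X (subquot R deg D B) i" "chain_map R (subquot R deg D B) X p"
    "\<And>n x. x \<in> carrier (cmodule X n) \<Longrightarrow> p n (i n x) = x"
proof -
  have Xc: "is_complex R X" by (rule projective_complexes_cplx[OF X])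
  have Xp: "projective R (cmodule X n)" for n using X by (auto simp: projective_complexes_def)
  have Xs: "small (carrier (cmodule X n))" for n
    using Xp[of n] by (auto simp: projective_def small_right_module_def small_sets_def U)
  have "\<exists>\<sigma>. linear R (cmodule X n) (free_mod R ({n} \<times> carrier (cmodule X n))) \<sigma> \<and>
      (\<forall>x \<in> carrier (cmodule X n). lift R (cmodule X n) snd (\<sigma> x) = x)" for n
    using projective_splitting[OF Xp[of n], of n] by metis
  then obtain \<sigma> where \<sigma>: "\<And>n. linear R (cmodule X n) (free_mod R ({n} \<times> carrier (cmodule X n))) (\<sigma> n)"
    and p\<sigma>: "\<And>n x. x \<in> carrier (cmodule X n) \<Longrightarrow> lift R (cmodule X n) snd (\<sigma> n x) = x" by metis
  define B where "B = (\<Union>n. {n} \<times> carrier (cmodule X n))"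
  define D where "D b = \<sigma> (fst b + 1) (cdiff X (fst b) (snd b))" for b
  define p where "p = (\<lambda>n. lift R (cmodule X n) (snd :: int \<times> 'u \<Rightarrow> 'u))"
  have Bn: "{b \<in> B. fst b = n} = {n} \<times> carrier (cmodule X n)" for n by (auto simp: B_def)
  have smB: "small B" unfolding B_def
    by (rule small_UN[OF small_countable small_inj[OF _ _ Xs, of snd]]) (auto simp: inj_on_def)
  have p: "linear R (free_mod R ({n} \<times> carrier (cmodule X n))) (cmodule X n) (p n)" for n
    unfolding p_def by (rule lift_lin[OF is_complex_module[OF Xc]]) auto
  have p_be: "p n (basis_vec R (n, x)) = x" if "x \<in> carrier (cmodule X n)" for n x
    unfolding p_def using lift_be[OF is_complex_module[OF Xc], of snd "(n, x)"] that by simp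
  note d = is_complex_diff[OF Xc]
  have s: "linear R (free_mod R ({n} \<times> carrier (cmodule X n))) (free_mod R ({n + 1} \<times> carrier (cmodule X (n + 1))))
      (\<lambda>x. \<sigma> (n + 1) (cdiff X n (p n x)))" for n
    by (rule lin_comp[OF lin_comp[OF p d] \<sigma>])
  have Dc: "D (n, x) \<in> finsupp R ({n + 1} \<times> carrier (cmodule X (n + 1)))" if "x \<in> carrier (cmodule X n)" for n x
    unfolding D_def using lin_closed[OF \<sigma> lin_closed[OF d that]] by simp
  have bd: "flift R D x = \<sigma> (n + 1) (cdiff X n (p n x))" if x: "x \<in> finsupp R ({n} \<times> carrier (cmodule X n))" for n x
  proof (rule lift_eq[OF free_mod_module lin_weaken[OF s] _ x])
    fix b assume "b \<in> {n} \<times> carrier (cmodule X n)"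
    then show "\<sigma> (n + 1) (cdiff X n (p n (basis_vec R b))) = D b" using p_be by (auto simp: D_def)
  qed simp
  have based: "based_complex R B fst D" unfolding based_complex_def
  proof (intro ballI conjI)
    fix b assume "b \<in> B"
    then obtain n x where b: "b = (n, x)" and x: "x \<in> carrier (cmodule X n)" by (auto simp: B_def)
    show "D b \<in> finsupp R {c \<in> B. fst c = fst b + 1}" unfolding Bn using Dc[OF x] b by simp
    have dx: "cdiff X n x \<in> carrier (cmodule X (n + 1))" by (rule lin_closed[OF d x])
    have "flift R D (D b) = \<sigma> (n + 1 + 1) (cdiff X (n + 1) (p (n + 1) (\<sigma> (n + 1) (cdiff X n x))))"
      using bd[OF Dc[OF x]] b by (simp add: D_def)
    also have "\<dots> = \<sigma> (n + 1 + 1) \<zero>\<^bsub>cmodule X (n + 1 + 1)\<^esub>"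
      using p\<sigma>[OF dx] is_complex_sq[OF Xc x] by (simp add: p_def)
    also have "\<dots> = fzero R" using lin_zero[OF is_complex_module[OF Xc] free_mod_module \<sigma>] by simp
    finally show "flift R D (D b) = fzero R" .
  qed
  interpret based_cplx R B fst D by standard (rule based)
  have res: "res R B (flift R D x) = \<sigma> (n + 1) (cdiff X n (p n x))"
    if x: "x \<in> finsupp R ({n} \<times> carrier (cmodule X n))" for n x
    unfolding bd[OF x]
    by (rule res_ident[OF finsupp_monoD[OF lin_closed[OF s x]]]) (auto simp: B_def)
  show ?thesis
  proof (rule that[OF smB based])
    show "chain_map R X (subquot R fst D B) \<sigma>" unfolding chain_map_def subquot_simps Bn
    proof (intro allI conjI ballI \<sigma>)
      fix n x assume x: "x \<in> carrier (cmodule X n)"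
      show "\<sigma> (n + 1) (cdiff X n x) = res R B (flift R D (\<sigma> n x))"
        unfolding res[OF lin_closed[OF \<sigma> x]] using p\<sigma>[OF x] by (simp add: p_def)
    qed
    show "chain_map R (subquot R fst D B) X p" unfolding chain_map_def subquot_simps Bn
    proof (intro allI conjI ballI p)
      fix n x assume x: "x \<in> finsupp R ({n} \<times> carrier (cmodule X n))"
      show "p (n + 1) (res R B (flift R D x)) = cdiff X n (p n x)"
        unfolding res[OF x] using p\<sigma>[OF lin_closed[OF d lin_closed[OF p x]]] by (simp add: p_def)
    qed
    show "p n (\<sigma> n x) = x" if "x \<in> carrier (cmodule X n)" for n x
      using p\<sigma>[OF that] by (simp add: p_def)
  qed
qed

section \<open>Compact objects are retracts of countable based complexes\<close>

text \<open>
  The composite of the three embeddings into the telescope is homotopic to a map into a countable subcomplex \<open>C\<close>, and the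
  retraction of the telescope restricts to \<open>C\<close>.
\<close>

lemma countable_retract:
  assumes X: "X \<in> A"
  obtains C :: "(((int \<times> 'u) \<times> (int \<times> 'u) list) \<times> nat \<times> bool) set" and deg D i p
  where "countable C" "based_complex R C deg D"
    "chain_map R X (subquot R deg D C) i" "chain_map R (subquot R deg D C) X p"
    "homotopic R X X (\<lambda>n x. p n (i n x)) (\<lambda>n x. x)"
proof -
  have Xc: "is_complex R X" by (rule A_cplx[OF X])
  obtain B :: "(int \<times> 'u) set" and deg D i0 p0 where smB: "small B" and based: "based_complex R B deg D"
    and i0: "chain_map R X (subquot R deg D B) i0" and p0: "chain_map R (subquot R deg D B) X p0"
    and pi0: "\<And>n x. x \<in> carrier (cmodule X n) \<Longrightarrow> p0 n (i0 n x) = x"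
    using projective_complex_retract[OF A_proj[OF X]] by metis
  interpret F: based_cplx R B deg D by standard (rule based)
  obtain cov r W where cc: "covered_cplx R B deg D cov r W" by (rule F.covering)
  interpret F: covered_cplx R B deg D cov r W by (rule cc)
  interpret Z: based_cplx R F.Z F.degZ F.DZ by standard (rule F.Z_based)
  interpret Z: filtered_cplx R F.Z F.degZ F.DZ "\<lambda>z. length (snd z)"
    by standard (rule finsupp_monoD[OF F.DZ_near], auto)
  have smT: "small Z.T"
  proof -
    have "small F.Z" by (rule small_subset[OF F.Z_subset small_Times[OF smB small_lists[OF smB]]])
    moreover have "small (UNIV :: (nat \<times> bool) set)" by (rule small_countable) simp
    ultimately have "small (F.Z \<times> (UNIV :: (nat \<times> bool) set))" by (rule small_Times)
    then show ?thesis by (rule small_subset[rotated]) (auto simp: Z.T_def)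
  qed
  interpret T: compact_based R A U Z.T Z.degT Z.tel_diff
    by standard (rule smT)
  have comp: "Z.T.compressible A Z.T"
  proof (rule T.telescope_shape_compressible[where e = "\<lambda>b. snd (snd b)" and k = "\<lambda>b. fst (snd b)"
        and \<rho> = "\<lambda>b. length (snd (fst b))" and l = "\<lambda>b. snd (fst b)"])
    fix b assume b: "b \<in> Z.T"
    show "length (snd (fst b)) \<le> fst (snd b)" using b by (auto simp: Z.T_def)
    have "fst b \<in> F.Z" using b by (auto simp: Z.T_def)
    then have "support R (F.DZ (fst b)) \<subseteq> {q \<in> F.Z. snd q = snd (fst b) \<or> length (snd q) < length (snd (fst b))}"
      using F.DZ_near[of "fst b"] by (simp add: finsupp_iff)
    then show "Z.tel_diff b \<in> finsupp R {c. snd (snd b) \<and> \<not> snd (snd c) \<or> snd (snd c) = snd (snd b) \<and>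
        fst (snd c) = fst (snd b) \<and> (length (snd (fst c)) < length (snd (fst b)) \<or>
          length (snd (fst c)) = length (snd (fst b)) \<and> snd (fst c) = snd (fst b))}"
      by (intro finsupp_monoD[OF Z.TD_near[OF b]]) (auto simp: Z.nearT_def)
  next
    fix x y z w
    have "{b \<in> Z.T. snd (snd b) = x \<and> fst (snd b) = y \<and> length (snd (fst b)) = z \<and> snd (fst b) = w}
        \<subseteq> (\<lambda>q. (q, y, x)) ` {q \<in> F.Z. snd q = w}"
      by (auto simp: Z.T_def image_iff)
    then show "countable {b \<in> Z.T. snd (snd b) = x \<and> fst (snd b) = y \<and> length (snd (fst b)) = z \<and> snd (fst b) = w}"
      by (rule countable_subset) (rule countable_image[OF F.Z_fibre_countable])
  qed
  define i1 where "i1 = (\<lambda>n x. Z.s (F.\<sigma> (i0 n x)))"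
  define p1 where "p1 = (\<lambda>n x. p0 n (F.\<delta> (Z.\<pi> x)))"
  have i1: "chain_map R X (subquot R Z.degT Z.tel_diff Z.T) i1" unfolding i1_def
    by (rule chain_map_comp[OF chain_map_comp[OF i0 dgmap_chain_map[OF based F.Z_based F.\<sigma>_based_map]]
          dgmap_chain_map[OF F.Z_based Z.telescope_based Z.s_based_map]])
  have p1: "chain_map R (subquot R Z.degT Z.tel_diff Z.T) X p1" unfolding p1_def
    by (rule chain_map_comp[OF chain_map_comp[OF dgmap_chain_map[OF Z.telescope_based F.Z_based Z.\<pi>_based_map]
          dgmap_chain_map[OF F.Z_based based F.\<delta>_based_map]] p0])
  have pi1: "p1 n (i1 n x) = x" if x: "x \<in> carrier (cmodule X n)" for n x
  proof -
    have 1: "i0 n x \<in> finsupp R B" using chain_map_closed[OF i0 x] unfolding subquot_simps by (rule finsupp_monoD) auto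
    show ?thesis unfolding i1_def p1_def
      using Z.\<pi>_s[OF lin_closed[OF F.\<sigma>_lin 1]] F.\<delta>_\<sigma>[OF 1] pi0[OF x] by simp
  qed
  obtain i2 S where S: "countable S" and i2: "chain_map R X (subquot R Z.degT Z.tel_diff Z.T) i2"
    and i12: "homotopic R X (subquot R Z.degT Z.tel_diff Z.T) i1 i2"
    and i2S: "\<forall>n. \<forall>x \<in> carrier (cmodule X n). i2 n x \<in> finsupp R S"
    using comp[unfolded Z.T.compressible_def, rule_format, OF X i1] by (elim exE conjE) (rule that)
  have "countable (S \<inter> Z.T)" "S \<inter> Z.T \<subseteq> Z.T" using S by auto
  then obtain C where C: "countable C" "S \<inter> Z.T \<subseteq> C" "Z.T.closed C" by (rule Z.T.countable_closure)
  have Clc: "Z.T.lc C" by (rule Z.T.closed_lc[OF C(3)])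
  note CT = loc_closed_subset[OF Clc]
  have Tlc: "Z.T.lc Z.T" by (rule Z.T.closed_lc[OF Z.T.B_closed])
  have Crel: "Z.T.rel_closed C Z.T"
    using C(3) CT unfolding Z.T.rel_closed_def closed_in_def by (auto elim!: finsupp_monoD)
  have i3: "chain_map R X (subquot R Z.degT Z.tel_diff C) i2"
  proof (rule Z.T.chain_map_into_sub[OF Crel order_refl i2])
    fix n x assume x: "x \<in> carrier (cmodule X n)"
    have "i2 n x \<in> finsupp R {b \<in> Z.T. Z.degT b = n}" using chain_map_closed[OF i2 x] by simp
    from finsupp_Int[OF this bspec[OF spec[OF i2S] x]] show "i2 n x \<in> finsupp R C"
      by (rule finsupp_monoD) (use C(2) in auto)
  qed
  have p3: "chain_map R (subquot R Z.degT Z.tel_diff C) X p1"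
    using chain_map_comp[OF Z.T.chain_map_inclusion[OF Crel order_refl] p1] .
  have Cb: "based_complex R C Z.degT Z.tel_diff"
    unfolding based_complex_def
  proof (intro ballI conjI)
    fix b assume b: "b \<in> C"
    then have bT: "b \<in> Z.T" using CT by auto
    have "Z.tel_diff b \<in> finsupp R C" using C(3) b by (auto simp: closed_in_def)
    from finsupp_Int[OF this Z.T.D_deg[OF bT]] show "Z.tel_diff b \<in> finsupp R {c \<in> C. Z.degT c = Z.degT b + 1}"
      by (rule finsupp_monoD) auto
    show "flift R Z.tel_diff (Z.tel_diff b) = fzero R"
      using Z.T.bd_bd[of "basis_vec R b"] bT by (simp add: Z.T.bd_be)
  qed
  have "homotopic R X X (\<lambda>n x. p1 n (i1 n x)) (\<lambda>n x. p1 n (i2 n x))"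
    by (rule homotopic_comp_left[OF Xc Z.T.subquot_cplx[OF Tlc] Xc i2 p1 i12])
  then have "homotopic R X X (\<lambda>n x. x) (\<lambda>n x. p1 n (i2 n x))"
    by (rule homotopic_cong[OF Xc]) (simp_all only: pi1)
  from homotopic_sym[OF Xc Xc chain_map_id[OF Xc] chain_map_comp[OF i3 p3] this]
  show ?thesis by (rule that[OF C(1) Cb i3 p3])
qed

end

section \<open>Counting\<close>

text \<open>
  A presentation of \<open>X\<close> as a retract of a based complex whose basis consists of natural numbers.  The requirement on
  \<open>D\<close> outside \<open>B\<close> makes \<open>D\<close> a matrix over \<open>R\<close>, so that it can be encoded as a whole.
\<close>

definition nat_retract :: "('r, 'b) ring_scheme \<Rightarrow> ('r, 'u) chain_complex \<Rightarrow>
    nat set \<times> (nat \<Rightarrow> int) \<times> (nat \<Rightarrow> nat \<Rightarrow> 'r) \<times> (int \<Rightarrow> 'u \<Rightarrow> nat \<Rightarrow> 'r) \<times> (int \<Rightarrow> (nat \<Rightarrow> 'r) \<Rightarrow> 'u) \<Rightarrow> bool" where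
  "nat_retract R X = (\<lambda>(B, deg, D, i, p). based_complex R B deg D \<and> (\<forall>n. D n \<in> finsupp R UNIV) \<and>
     chain_map R X (subquot R deg D B) i \<and> chain_map R (subquot R deg D B) X p \<and> homotopic R X X (\<lambda>n x. p n (i n x)) (\<lambda>n x. x))"

context ring
begin

text \<open>
  Transport along an injection of the basis into the natural numbers.
\<close>

lemma countable_relabel:
  fixes C :: "'k set"
  assumes based: "based_complex R C deg D" and C: "countable C"
  obtains B :: "nat set" and deg' D' u v where "based_complex R B deg' D'" "\<And>n. D' n \<in> finsupp R UNIV"
    "based_map R C deg D B deg' D' u" "based_map R B deg' D' C deg D v" "\<And>x. x \<in> finsupp R C \<Longrightarrow> v (u x) = x"
proof -
  interpret X: based_cplx R C deg D by standard (rule based)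
  obtain code :: "'k \<Rightarrow> nat" where code: "inj_on code C" using C by (auto simp: countable_def)
  define B where "B = code ` C"
  define dc where "dc = inv_into C code"
  have dc: "dc (code c) = c" if "c \<in> C" for c using code that by (simp add: dc_def)
  have dcB: "dc n \<in> C" "code (dc n) = n" if "n \<in> B" for n using that dc by (auto simp: B_def)
  have codeB: "code c \<in> B" if "c \<in> C" for c using that by (auto simp: B_def)
  define u where "u = flift R (\<lambda>c. basis_vec R (code c))"
  define v where "v = flift R (\<lambda>n. basis_vec R (dc n))"
  define D' where "D' n = (if n \<in> B then u (D (dc n)) else fzero R)" for n
  define deg' where "deg' n = deg (dc n)" for n
  have u: "linear R (free_mod R C) (free_mod R B) u" unfolding u_def by (rule flift_lin) (simp add: codeB)
  have v: "linear R (free_mod R B) (free_mod R C) v" unfolding v_def by (rule flift_lin) (simp add: dcB)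
  have u_be: "u (basis_vec R c) = basis_vec R (code c)" for c
    unfolding u_def by (rule flift_be[where E = UNIV]) simp
  have v_be: "v (basis_vec R n) = basis_vec R (dc n)" for n
    unfolding v_def by (rule flift_be[where E = UNIV]) simp
  have vu: "v (u x) = x" if "x \<in> finsupp R C" for x
    by (rule lin_ext[OF free_mod_module lin_comp[OF u v] _ _ that]) (auto simp: linear_def u_be v_be dc)
  have D'B: "D' n \<in> finsupp R B" for n
    using lin_closed[OF u X.D_closed[OF dcB(1)]] by (simp add: D'_def)
  have ud: "linear R (free_mod R {c \<in> C. deg c = m}) (free_mod R {n \<in> B. deg' n = m}) u" for m
    unfolding u_def by (rule flift_lin) (simp add: codeB deg'_def dc)
  have bd'_be: "flift R D' (basis_vec R n) = D' n" for n by (rule flift_be[OF D'B])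
  have bd': "linear R (free_mod R B) (free_mod R B) (flift R D')" by (rule flift_lin) (rule D'B)
  have comm: "flift R D' (u x) = u (X.bd x)" if "x \<in> finsupp R C" for x
  proof (rule lin_ext[OF free_mod_module lin_comp[OF u bd'] lin_comp[OF X.bd_lin u] _ that])
    show "flift R D' (u (basis_vec R c)) = u (X.bd (basis_vec R c))" if "c \<in> C" for c
      using that by (simp add: u_be bd'_be D'_def codeB dc X.bd_be)
  qed
  have based': "based_complex R B deg' D'" unfolding based_complex_def
  proof (intro ballI conjI)
    fix n assume n: "n \<in> B"
    note c = dcB(1)[OF n]
    show "D' n \<in> finsupp R {m \<in> B. deg' m = deg' n + 1}"
      using lin_closed[OF ud X.D_deg[OF c]] n by (simp add: D'_def deg'_def)
    have "flift R D' (D' n) = u (X.bd (D (dc n)))"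
      using comm[OF X.D_closed[OF c]] n by (simp add: D'_def)
    also have "X.bd (D (dc n)) = fzero R"
      using based c by (simp add: based_complex_def)
    also have "u (fzero R) = fzero R" using lin_zero[OF free_mod_module free_mod_module u] by simp
    finally show "flift R D' (D' n) = fzero R" .
  qed
  show ?thesis
  proof (rule that[OF based' _ _ _ vu])
    show "D' n \<in> finsupp R UNIV" for n by (rule finsupp_monoD[OF D'B]) simp
    show "based_map R C deg D B deg' D' u" unfolding based_map_def
    proof (intro conjI ballI u)
      fix c assume c: "c \<in> C"
      show "u (basis_vec R c) \<in> finsupp R {n \<in> B. deg' n = deg c}" using c by (simp add: u_be codeB deg'_def dc)
      show "u (X.bd (basis_vec R c)) = flift R D' (u (basis_vec R c))" using comm[of "basis_vec R c"] c by simp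
    qed
    show "based_map R B deg' D' C deg D v" unfolding based_map_def
    proof (intro conjI ballI v)
      fix n assume n: "n \<in> B"
      show "v (basis_vec R n) \<in> finsupp R {c \<in> C. deg c = deg' n}" using dcB(1)[OF n] by (simp add: v_be deg'_def)
      have "v (flift R D' (basis_vec R n)) = v (u (D (dc n)))" using n by (simp add: bd'_be D'_def)
      also have "\<dots> = X.bd (v (basis_vec R n))"
        using vu[OF X.D_closed[OF dcB(1)[OF n]]] dcB(1)[OF n] by (simp add: v_be X.bd_be)
      finally show "v (flift R D' (basis_vec R n)) = X.bd (v (basis_vec R n))" .
    qed
  qed
qed

end

lemma (in compact_class) ex_nat_retract:
  assumes X: "X \<in> A" shows "\<exists>q. nat_retract R X q"
proof -
  have Xc: "is_complex R X" by (rule A_cplx[OF X])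
  obtain C :: "(((int \<times> 'u) \<times> (int \<times> 'u) list) \<times> nat \<times> bool) set" and deg D i p
    where C: "countable C" and Cb: "based_complex R C deg D"
    and i: "chain_map R X (subquot R deg D C) i" and p: "chain_map R (subquot R deg D C) X p"
    and pi: "homotopic R X X (\<lambda>n x. p n (i n x)) (\<lambda>n x. x)"
    by (rule countable_retract[OF X])
  obtain B :: "nat set" and deg' D' u v where B: "based_complex R B deg' D'" "\<And>n. D' n \<in> finsupp R UNIV"
    and u: "based_map R C deg D B deg' D' u" and v: "based_map R B deg' D' C deg D v"
    and vu: "\<And>x. x \<in> finsupp R C \<Longrightarrow> v (u x) = x"
    by (rule countable_relabel[OF Cb C]) blast
  have i': "chain_map R X (subquot R deg' D' B) (\<lambda>n x. u (i n x))" by (rule chain_map_comp[OF i dgmap_chain_map[OF Cb B(1) u]])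
  have p': "chain_map R (subquot R deg' D' B) X (\<lambda>n x. p n (v x))" by (rule chain_map_comp[OF dgmap_chain_map[OF B(1) Cb v] p])
  have "i n x \<in> finsupp R C" if "x \<in> carrier (cmodule X n)" for n x
    using chain_map_closed[OF i that] unfolding subquot_simps by (rule finsupp_monoD) auto
  then have "homotopic R X X (\<lambda>n x. p n (v (u (i n x)))) (\<lambda>n x. x)"
    using vu by (intro homotopic_cong[OF Xc pi]) simp_all
  then have "nat_retract R X (B, deg', D', (\<lambda>n x. u (i n x)), (\<lambda>n x. p n (v x)))"
    using B i' p' by (simp add: nat_retract_def)
  then show ?thesis by blast
qed

text \<open>
  Two sets of elements of countable types, packed into one set of natural numbers.
\<close>

definition pair_code :: "'s::countable set \<times> 't::countable set \<Rightarrow> nat set" where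
  "pair_code = (\<lambda>(S, T). to_nat ` (S <+> T))"

lemma pair_code_eq: "pair_code (S, T) = pair_code (S', T') \<longleftrightarrow> S = S' \<and> T = T'"
proof
  assume "pair_code (S, T) = pair_code (S', T')"
  then have "to_nat ` (S <+> T) = to_nat ` (S' <+> T')" by (simp only: pair_code_def prod.case)
  then have eq: "S <+> T = S' <+> T'" by (rule inj_image_eq_iff[OF inj_to_nat, THEN iffD1])
  have "S = {x. Inl x \<in> S <+> T}" "T = {y. Inr y \<in> S <+> T}" for S T by auto
  then show "S = S' \<and> T = T'" using eq by metis
qed simp

definition matrix_code :: "('r \<Rightarrow> nat set) \<Rightarrow> (nat \<Rightarrow> nat \<Rightarrow> 'r) \<Rightarrow> (nat \<times> nat \<times> nat) set" where
  "matrix_code \<rho> M = {(a, b, k). k \<in> \<rho> (M a b)}"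

lemma matrix_code_inj:
  assumes "inj_on \<rho> (carrier R)" "\<And>a b. M a b \<in> carrier R" "\<And>a b. M' a b \<in> carrier R"
    and "matrix_code \<rho> M = matrix_code \<rho> M'"
  shows "M = M'"
proof (intro ext)
  fix a b
  have "\<rho> (M a b) = \<rho> (M' a b)"
    using assms(4) by (auto simp: matrix_code_def set_eq_iff)
  then show "M a b = M' a b" using assms(1-3) by (auto dest: inj_onD)
qed

lemma K_isomorphic_iff:
  fixes X Y :: "('r, 'u) chain_complex"
  assumes X: "X \<in> projective_complexes R" and Y: "Y \<in> projective_complexes R"
  shows "isomorphic (K_Proj R) X Y \<longleftrightarrow> (\<exists>f g. chain_map R X Y f \<and> chain_map R Y X g \<and>
     homotopic R X X (\<lambda>n x. g n (f n x)) (\<lambda>n x. x) \<and> homotopic R Y Y (\<lambda>n x. f n (g n x)) (\<lambda>n x. x))"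
proof -
  note Xc = projective_complexes_cplx[OF X] and Yc = projective_complexes_cplx[OF Y]
  have eq: "Comp (K_Proj R) X Y X (htpy_class R Y X g) (htpy_class R X Y f) = Id (K_Proj R) X \<longleftrightarrow>
      homotopic R X X (\<lambda>n x. g n (f n x)) (\<lambda>n x. x)" if "chain_map R X Y f" "chain_map R Y X g" "is_complex R X" "is_complex R Y"
    for X Y :: "('r, 'u) chain_complex" and f g
    unfolding Comp_cls[OF that(3,4,3,1,2)] Id_cls
    by (rule htpy_class_eq_iff[OF that(3,3) chain_map_comp[OF that(1,2)] chain_map_id[OF that(3)]])
  show ?thesis
  proof
    assume "isomorphic (K_Proj R) X Y"
    then obtain F G where F: "F \<in> Hom (K_Proj R) X Y" and G: "G \<in> Hom (K_Proj R) Y X"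
      and FG: "Comp (K_Proj R) X Y X G F = Id (K_Proj R) X" "Comp (K_Proj R) Y X Y F G = Id (K_Proj R) Y"
      unfolding isomorphic_def by blast
    obtain f where f: "chain_map R X Y f" "F = htpy_class R X Y f" using Hom_cases[OF Xc Yc F] by blast
    obtain g where g: "chain_map R Y X g" "G = htpy_class R Y X g" using Hom_cases[OF Yc Xc G] by blast
    show "\<exists>f g. chain_map R X Y f \<and> chain_map R Y X g \<and>
     homotopic R X X (\<lambda>n x. g n (f n x)) (\<lambda>n x. x) \<and> homotopic R Y Y (\<lambda>n x. f n (g n x)) (\<lambda>n x. x)"
      using FG f g eq[OF f(1) g(1) Xc Yc] eq[OF g(1) f(1) Yc Xc] by (intro exI[of _ f] exI[of _ g]) simp
  next
    assume "\<exists>f g. chain_map R X Y f \<and> chain_map R Y X g \<and>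
     homotopic R X X (\<lambda>n x. g n (f n x)) (\<lambda>n x. x) \<and> homotopic R Y Y (\<lambda>n x. f n (g n x)) (\<lambda>n x. x)"
    then obtain f g where f: "chain_map R X Y f" and g: "chain_map R Y X g"
      and fg: "homotopic R X X (\<lambda>n x. g n (f n x)) (\<lambda>n x. x)" "homotopic R Y Y (\<lambda>n x. f n (g n x)) (\<lambda>n x. x)"
      by blast
    have "Comp (K_Proj R) X Y X (htpy_class R Y X g) (htpy_class R X Y f) = Id (K_Proj R) X"
      using eq[OF f g Xc Yc] fg(1) by simp
    moreover have "Comp (K_Proj R) Y X Y (htpy_class R X Y f) (htpy_class R Y X g) = Id (K_Proj R) Y"
      using eq[OF g f Yc Xc] fg(2) by simp
    ultimately show "isomorphic (K_Proj R) X Y"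
      unfolding isomorphic_def using htpy_class_in_Hom[OF Xc Yc f] htpy_class_in_Hom[OF Yc Xc g] by blast
  qed
qed

lemma iso_representatives_exist:
  assumes refl: "\<And>X. X \<in> Obj C \<Longrightarrow> isomorphic C X X"
    and sym: "\<And>X Y. X \<in> Obj C \<Longrightarrow> Y \<in> Obj C \<Longrightarrow> isomorphic C X Y \<Longrightarrow> isomorphic C Y X"
    and trans: "\<And>X Y Z. X \<in> Obj C \<Longrightarrow> Y \<in> Obj C \<Longrightarrow> Z \<in> Obj C \<Longrightarrow>
      isomorphic C X Y \<Longrightarrow> isomorphic C Y Z \<Longrightarrow> isomorphic C X Z"
  shows "\<exists>A. iso_representatives C A"
proof -
  define r where "r X = (SOME Y. Y \<in> Obj C \<and> isomorphic C X Y)" for X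
  have r: "r X \<in> Obj C" "isomorphic C X (r X)" if "X \<in> Obj C" for X
    using someI_ex[of "\<lambda>Y. Y \<in> Obj C \<and> isomorphic C X Y"] refl that unfolding r_def by blast+
  have req: "r X = r Y" if "X \<in> Obj C" "Y \<in> Obj C" "isomorphic C X Y" for X Y
  proof -
    have "(Z \<in> Obj C \<and> isomorphic C X Z) \<longleftrightarrow> (Z \<in> Obj C \<and> isomorphic C Y Z)" for Z
      using that sym trans by meson
    then show ?thesis by (simp add: r_def)
  qed
  have "iso_representatives C (r ` Obj C)" unfolding iso_representatives_def
  proof (intro conjI ballI)
    show "r ` Obj C \<subseteq> Obj C" using r by blast
    fix X assume X: "X \<in> Obj C"
    show "\<exists>!Y. Y \<in> r ` Obj C \<and> isomorphic C X Y"
    proof (rule ex1I[of _ "r X"])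
      fix Y assume "Y \<in> r ` Obj C \<and> isomorphic C X Y"
      then obtain Z where Z: "Z \<in> Obj C" "Y = r Z" "isomorphic C X (r Z)" by blast
      then have "isomorphic C X Z"
        using trans[OF X r(1)[OF Z(1)] Z(1)] sym[OF Z(1) r(1)[OF Z(1)] r(2)[OF Z(1)]] by blast
      then show "Y = r X" using req[OF X Z(1)] Z(2) by simp
    qed (use X r in blast)
  qed
  then show ?thesis by blast
qed

lemma K_isomorphic_refl:
  "X \<in> projective_complexes R \<Longrightarrow> isomorphic (K_Proj R) X X"
  unfolding K_isomorphic_iff
  by (intro exI[of _ "\<lambda>n x. x"] conjI chain_map_id homotopic_refl projective_complexes_cplx)

lemma K_isomorphic_sym:
  "isomorphic (K_Proj R) X Y \<Longrightarrow> isomorphic (K_Proj R) Y X"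
  unfolding isomorphic_def by blast

lemma K_isomorphic_trans:
  assumes X: "X \<in> projective_complexes R" and Y: "Y \<in> projective_complexes R" and Z: "Z \<in> projective_complexes R"
    and XY: "isomorphic (K_Proj R) X Y" and YZ: "isomorphic (K_Proj R) Y Z"
  shows "isomorphic (K_Proj R) X Z"
proof -
  note Xc = projective_complexes_cplx[OF X] and Yc = projective_complexes_cplx[OF Y]
    and Zc = projective_complexes_cplx[OF Z]
  obtain f g where f: "chain_map R X Y f" and g: "chain_map R Y X g"
    and fg: "homotopic R X X (\<lambda>n x. g n (f n x)) (\<lambda>n x. x)" "homotopic R Y Y (\<lambda>n x. f n (g n x)) (\<lambda>n x. x)"
    using XY unfolding K_isomorphic_iff[OF X Y] by blast
  obtain f' g' where f': "chain_map R Y Z f'" and g': "chain_map R Z Y g'"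
    and fg': "homotopic R Y Y (\<lambda>n x. g' n (f' n x)) (\<lambda>n x. x)" "homotopic R Z Z (\<lambda>n x. f' n (g' n x)) (\<lambda>n x. x)"
    using YZ unfolding K_isomorphic_iff[OF Y Z] by blast
  have "homotopic R X X (\<lambda>n x. g n (g' n (f' n (f n x)))) (\<lambda>n x. g n (f n x))"
    by (rule homotopic_comp_left[OF Xc Yc Xc f g homotopic_comp_right[OF f fg'(1)]])
  then have 1: "homotopic R X X (\<lambda>n x. g n (g' n (f' n (f n x)))) (\<lambda>n x. x)"
    using fg(1) by (rule homotopic_trans[OF Xc Xc chain_map_id[OF Xc]])
  have "homotopic R Z Z (\<lambda>n x. f' n (f n (g n (g' n x)))) (\<lambda>n x. f' n (g' n x))"
    by (rule homotopic_comp_left[OF Zc Yc Zc g' f' homotopic_comp_right[OF g' fg(2)]])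
  then have 2: "homotopic R Z Z (\<lambda>n x. f' n (f n (g n (g' n x)))) (\<lambda>n x. x)"
    using fg'(2) by (rule homotopic_trans[OF Zc Zc chain_map_id[OF Zc]])
  show ?thesis unfolding K_isomorphic_iff[OF X Z]
    using chain_map_comp[OF f f'] chain_map_comp[OF g' g] 1 2
    by (intro exI[of _ "\<lambda>n x. f' n (f n x)"] exI[of _ "\<lambda>n x. g n (g' n x)"] conjI)
qed

context ring
begin

text \<open>
  If \<open>i p = i' p'\<close>, then \<open>p' i\<close> and \<open>p i'\<close> are mutually inverse: \<open>p i' p' i = p i p i\<close>, which is homotopic to the identity.
\<close>

lemma retracts_isomorphic:
  assumes X: "X \<in> projective_complexes R" and Y: "Y \<in> projective_complexes R"
    and qX: "nat_retract R X (B, deg, D, i, p)" and qY: "nat_retract R Y (B, deg, D, i', p')"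
    and eq: "\<And>b. b \<in> B \<Longrightarrow> i (deg b) (p (deg b) (basis_vec R b)) = i' (deg b) (p' (deg b) (basis_vec R b))"
  shows "isomorphic (K_Proj R) X Y"
proof -
  note Xc = projective_complexes_cplx[OF X] and Yc = projective_complexes_cplx[OF Y]
  let ?S = "subquot R deg D B"
  have i: "chain_map R X ?S i" and p: "chain_map R ?S X p" and pi: "homotopic R X X (\<lambda>n x. p n (i n x)) (\<lambda>n x. x)"
    using qX by (auto simp: nat_retract_def)
  have i': "chain_map R Y ?S i'" and p': "chain_map R ?S Y p'" and pi': "homotopic R Y Y (\<lambda>n x. p' n (i' n x)) (\<lambda>n x. x)"
    using qY by (auto simp: nat_retract_def)
  have ip: "i n (p n x) = i' n (p' n x)" if "x \<in> carrier (cmodule ?S n)" for n x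
    using that unfolding subquot_simps
    by (rule lin_ext[OF free_mod_module chain_map_lin[OF chain_map_comp[OF p i], unfolded subquot_simps]
          chain_map_lin[OF chain_map_comp[OF p' i'], unfolded subquot_simps], rotated]) (use eq in auto)
  have "homotopic R X X (\<lambda>n x. p n (i n (p n (i n x)))) (\<lambda>n x. p n (i n x))"
    using homotopic_comp_right[OF chain_map_comp[OF i p] pi] .
  then have "homotopic R X X (\<lambda>n x. p n (i n (p n (i n x)))) (\<lambda>n x. x)"
    using pi by (rule homotopic_trans[OF Xc Xc chain_map_id[OF Xc]])
  then have 1: "homotopic R X X (\<lambda>n x. p n (i' n (p' n (i n x)))) (\<lambda>n x. x)"
    by (rule homotopic_cong[OF Xc]) (use ip chain_map_closed[OF i] in auto)
  have "homotopic R Y Y (\<lambda>n x. p' n (i' n (p' n (i' n x)))) (\<lambda>n x. p' n (i' n x))"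
    using homotopic_comp_right[OF chain_map_comp[OF i' p'] pi'] .
  then have "homotopic R Y Y (\<lambda>n x. p' n (i' n (p' n (i' n x)))) (\<lambda>n x. x)"
    using pi' by (rule homotopic_trans[OF Yc Yc chain_map_id[OF Yc]])
  then have 2: "homotopic R Y Y (\<lambda>n x. p' n (i n (p n (i' n x)))) (\<lambda>n x. x)"
    by (rule homotopic_cong[OF Yc]) (use ip chain_map_closed[OF i'] in auto)
  show ?thesis unfolding K_isomorphic_iff[OF X Y]
    using chain_map_comp[OF i p'] chain_map_comp[OF i' p] 1 2
    by (intro exI[of _ "\<lambda>n x. p' n (i n x)"] exI[of _ "\<lambda>n x. p n (i' n x)"] conjI)
qed

text \<open>
  A map \<open>f\<close> is homotopic to \<open>p' (i' f p) i\<close>, so it is determined by \<open>i' f p\<close>, a map between the free complexes.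
\<close>

lemma retract_maps_eq:
  assumes X: "X \<in> projective_complexes R" and Y: "Y \<in> projective_complexes R"
    and qX: "nat_retract R X (B, deg, D, i, p)" and qY: "nat_retract R Y (B', deg', D', i', p')"
    and f: "chain_map R X Y f" and g: "chain_map R X Y g"
    and eq: "\<And>b. b \<in> B \<Longrightarrow> i' (deg b) (f (deg b) (p (deg b) (basis_vec R b))) = i' (deg b) (g (deg b) (p (deg b) (basis_vec R b)))"
  shows "homotopic R X Y f g"
proof -
  note Xc = projective_complexes_cplx[OF X] and Yc = projective_complexes_cplx[OF Y]
  let ?S = "subquot R deg D B" and ?S' = "subquot R deg' D' B'"
  have i: "chain_map R X ?S i" and p: "chain_map R ?S X p" and pi: "homotopic R X X (\<lambda>n x. p n (i n x)) (\<lambda>n x. x)"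
    using qX by (auto simp: nat_retract_def)
  have i': "chain_map R Y ?S' i'" and p': "chain_map R ?S' Y p'" and pi': "homotopic R Y Y (\<lambda>n x. p' n (i' n x)) (\<lambda>n x. x)"
    using qY by (auto simp: nat_retract_def)
  have e: "i' n (f n (p n x)) = i' n (g n (p n x))" if "x \<in> carrier (cmodule ?S n)" for n x
    using that unfolding subquot_simps
    by (rule lin_ext[OF free_mod_module chain_map_lin[OF chain_map_comp[OF chain_map_comp[OF p f] i'], unfolded subquot_simps]
          chain_map_lin[OF chain_map_comp[OF chain_map_comp[OF p g] i'], unfolded subquot_simps], rotated]) (use eq in auto)
  have c: "chain_map R X Y (\<lambda>n x. p' n (i' n (a n (p n (i n x)))))" if "chain_map R X Y a" for a
    by (rule chain_map_comp[OF chain_map_comp[OF chain_map_comp[OF chain_map_comp[OF i p] that] i'] p'])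
  have key: "homotopic R X Y (\<lambda>n x. p' n (i' n (a n (p n (i n x))))) a" if a: "chain_map R X Y a" for a
  proof (rule homotopic_trans[OF Xc Yc a])
    show "homotopic R X Y (\<lambda>n x. p' n (i' n (a n (p n (i n x))))) (\<lambda>n x. a n (p n (i n x)))"
      using homotopic_comp_right[OF chain_map_comp[OF chain_map_comp[OF i p] a] pi'] .
    show "homotopic R X Y (\<lambda>n x. a n (p n (i n x))) a"
      using homotopic_comp_left[OF Xc Xc Yc chain_map_id[OF Xc] a pi] .
  qed
  have "homotopic R X Y (\<lambda>n x. p' n (i' n (f n (p n (i n x))))) g"
    by (rule homotopic_cong[OF Xc key[OF g]]) (use e chain_map_closed[OF i] in auto)
  from homotopic_trans[OF Xc Yc g homotopic_sym[OF Xc Yc c[OF f] f key[OF f]] this] show ?thesis .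
qed

end

lemma card_le_aleph1:
  fixes code :: "'s \<Rightarrow> nat set"
  assumes "continuum_hypothesis" "inj_on code S" shows "|S| \<le>o aleph1"
proof -
  have "|S| \<le>o |UNIV :: nat set set|" using assms(2) card_of_ordLeq[of S "UNIV :: nat set set"] by blast
  then show ?thesis using assms(1) unfolding continuum_hypothesis_def by (rule ordLeq_ordIso_trans)
qed

theorem proposition4p2p1:
  fixes R :: "('r, 'b) ring_scheme"
  assumes "regularCard |UNIV :: 'u set|" and "aleph1 <o |UNIV :: 'u set|"
    and "ring R" and "|carrier R| \<le>o aleph1"
    and "continuum_hypothesis"
  shows "cat_card (compact_part (small_sets :: 'u set set) aleph1
           (K_Proj R :: (('r, 'u) chain_complex, 'u graded_map set) cat)) \<le>o aleph1"
proof -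
  define A where "A = compact_objects (small_sets :: 'u set set) aleph1
    (K_Proj R :: (('r, 'u) chain_complex, 'u graded_map set) cat)"
  interpret compact_class R A UNIV
  proof (intro compact_class.intro compact_class_axioms.intro)
    show "alpha_small (small_sets :: 'u set set) aleph1 (K_Proj R) S" if "S \<in> A" for S
      using that unfolding A_def by (rule compact_objects_alpha_small)
    show "coproduct_factoring (small_sets :: 'u set set) (K_Proj R) A"
      unfolding A_def by (rule compact_objects_factoring)
  qed (use assms in simp_all)
  define C where "C = compact_part (small_sets :: 'u set set) aleph1
    (K_Proj R :: (('r, 'u) chain_complex, 'u graded_map set) cat)"
  have Obj: "Obj C = A" and Hom: "Hom C = Hom (K_Proj R)"
    by (simp_all add: C_def A_def compact_part_def full_subcat_def)
  have iso: "isomorphic C X Y \<longleftrightarrow> isomorphic (K_Proj R) X Y" for X Y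
    by (simp add: C_def compact_part_def full_subcat_def isomorphic_def)
  define reps where "reps = (SOME A. iso_representatives C A)"
  have "\<exists>A. iso_representatives C A"
  proof (rule iso_representatives_exist, unfold Obj iso)
    show "isomorphic (K_Proj R) X X" if "X \<in> A" for X by (rule K_isomorphic_refl[OF A_proj[OF that]])
    show "isomorphic (K_Proj R) Y X" if "isomorphic (K_Proj R) X Y" for X Y by (rule K_isomorphic_sym[OF that])
    show "isomorphic (K_Proj R) X Z"
      if "X \<in> A" "Y \<in> A" "Z \<in> A" "isomorphic (K_Proj R) X Y" "isomorphic (K_Proj R) Y Z" for X Y Z
      by (rule K_isomorphic_trans[OF A_proj[OF that(1)] A_proj[OF that(2)] A_proj[OF that(3)] that(4,5)])
  qed
  then have reps: "iso_representatives C reps" unfolding reps_def by (rule someI_ex)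
  have repsA: "reps \<subseteq> A" using reps by (simp add: iso_representatives_def Obj)
  have reps_eq: "X = Y" if "X \<in> reps" "Y \<in> reps" "isomorphic (K_Proj R) X Y" for X Y
    using reps that repsA K_isomorphic_refl[OF A_proj[of X]] unfolding iso_representatives_def Obj iso by blast
  define q where "q X = (SOME q. nat_retract R X q)" for X :: "('r, 'u) chain_complex"
  have q: "nat_retract R X (q X)" if "X \<in> A" for X
    unfolding q_def by (rule someI_ex[OF ex_nat_retract[OF that]])
  define qB where "qB X = fst (q X)" for X
  define qdeg where "qdeg X = fst (snd (q X))" for X
  define qD where "qD X = fst (snd (snd (q X)))" for X
  define qi where "qi X = fst (snd (snd (snd (q X))))" for X
  define qp where "qp X = snd (snd (snd (snd (q X))))" for X
  have q': "nat_retract R X (qB X, qdeg X, qD X, qi X, qp X)" if "X \<in> A" for X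
    using q[OF that] by (simp add: qB_def qdeg_def qD_def qi_def qp_def)
  have qi: "chain_map R X (subquot R (qdeg X) (qD X) (qB X)) (qi X)" and qp: "chain_map R (subquot R (qdeg X) (qD X) (qB X)) X (qp X)"
    and qD: "\<And>n. qD X n \<in> finsupp R UNIV" if "X \<in> A" for X
    using q'[OF that] by (auto simp: nat_retract_def)
  \<comment> \<open>The matrix of \<open>f\<close>, viewed as a map between the free complexes of \<open>X\<close> and \<open>Y\<close>.\<close>
  define mat where "mat X Y f a b = (if a \<in> qB X then qi Y (qdeg X a) (f (qdeg X a) (qp X (qdeg X a) (basis_vec R a))) b else \<zero>\<^bsub>R\<^esub>)"
    for X Y f a b
  have mat: "mat X Y f a b \<in> carrier R" if "X \<in> A" "Y \<in> A" "chain_map R X Y f" for X Y f a b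
  proof (cases "a \<in> qB X")
    case True
    then have "basis_vec R a \<in> carrier (cmodule (subquot R (qdeg X) (qD X) (qB X)) (qdeg X a))" by simp
    from chain_map_closed[OF chain_map_comp[OF chain_map_comp[OF qp[OF that(1)] that(3)] qi[OF that(2)]] this]
    have "qi Y (qdeg X a) (f (qdeg X a) (qp X (qdeg X a) (basis_vec R a))) \<in> finsupp R {b \<in> qB Y. qdeg Y b = qdeg X a}"
      by (simp only: subquot_simps)
    from finsupp_coeff[OF this] True show ?thesis by (simp add: mat_def)
  qed (simp add: mat_def)
  have mat_eq: "qi Y (qdeg X a) (f (qdeg X a) (qp X (qdeg X a) (basis_vec R a))) =
      qi Y' (qdeg X' a) (f' (qdeg X' a) (qp X' (qdeg X' a) (basis_vec R a)))"
    if "mat X Y f = mat X' Y' f'" "a \<in> qB X" "a \<in> qB X'" for X Y f X' Y' f' a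
  proof
    fix b show "qi Y (qdeg X a) (f (qdeg X a) (qp X (qdeg X a) (basis_vec R a))) b =
      qi Y' (qdeg X' a) (f' (qdeg X' a) (qp X' (qdeg X' a) (basis_vec R a))) b"
      using fun_cong[OF fun_cong[OF that(1), of a], of b] that(2,3) by (simp add: mat_def)
  qed
  obtain \<rho> :: "'r \<Rightarrow> nat set" where \<rho>: "inj_on \<rho> (carrier R)"
  proof -
    have "|carrier R| \<le>o |UNIV :: nat set set|"
      using assms(4,5) unfolding continuum_hypothesis_def by (meson ordIso_symmetric ordLeq_ordIso_trans)
    then have "\<exists>f. inj_on f (carrier R) \<and> f ` carrier R \<subseteq> (UNIV :: nat set set)" by (simp only: card_of_ordLeq)
    then show ?thesis using that by blast
  qed
  \<comment> \<open>The free complex of \<open>X\<close> together with the idempotent on it.\<close>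
  define ocode where "ocode X = pair_code (qB X, pair_code (range (\<lambda>n. (n, qdeg X n)),
      pair_code (matrix_code \<rho> (qD X), matrix_code \<rho> (mat X X (\<lambda>n x. x)))))" for X
  have ocode: "X = Y" if X: "X \<in> reps" and Y: "Y \<in> reps" and eq: "ocode X = ocode Y" for X Y
  proof (rule reps_eq[OF X Y])
    have XA: "X \<in> A" and YA: "Y \<in> A" using X Y repsA by auto
    have B: "qB Y = qB X" and dg: "range (\<lambda>n. (n, qdeg X n)) = range (\<lambda>n. (n, qdeg Y n))"
      and Dc: "matrix_code \<rho> (qD X) = matrix_code \<rho> (qD Y)"
      and mc: "matrix_code \<rho> (mat X X (\<lambda>n x. x)) = matrix_code \<rho> (mat Y Y (\<lambda>n x. x))"
      using eq by (simp_all add: ocode_def pair_code_eq)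
    have dg: "qdeg Y = qdeg X"
    proof
      fix n have "(n, qdeg X n) \<in> range (\<lambda>n. (n, qdeg Y n))" using dg by blast
      then show "qdeg Y n = qdeg X n" by auto
    qed
    have D: "qD Y = qD X"
      by (rule matrix_code_inj[OF \<rho> finsupp_coeff[OF qD[OF YA]] finsupp_coeff[OF qD[OF XA]] Dc[symmetric]])
    have idX: "chain_map R Z Z (\<lambda>n x. x)" if "Z \<in> A" for Z by (rule chain_map_id[OF A_cplx[OF that]])
    have m: "mat X X (\<lambda>n x. x) = mat Y Y (\<lambda>n x. x)"
      by (rule matrix_code_inj[OF \<rho> mat[OF XA XA idX[OF XA]] mat[OF YA YA idX[OF YA]] mc])
    show "isomorphic (K_Proj R) X Y"
    proof (rule retracts_isomorphic[OF A_proj[OF XA] A_proj[OF YA] q'[OF XA]])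
      show "nat_retract R Y (qB X, qdeg X, qD X, qi Y, qp Y)" using q'[OF YA] unfolding B dg D .
      show "qi X (qdeg X b) (qp X (qdeg X b) (basis_vec R b)) = qi Y (qdeg X b) (qp Y (qdeg X b) (basis_vec R b))"
        if "b \<in> qB X" for b
        using mat_eq[OF m that] that unfolding B dg by simp
    qed
  qed
  define rep where "rep X Y F = (SOME f. chain_map R X Y f \<and> F = htpy_class R X Y f)" for X Y and F :: "'u graded_map set"
  have rep: "chain_map R X Y (rep X Y F)" "F = htpy_class R X Y (rep X Y F)"
    if "X \<in> A" "Y \<in> A" "F \<in> Hom (K_Proj R) X Y" for X Y F
  proof -
    have "\<exists>f. chain_map R X Y f \<and> F = htpy_class R X Y f"
      using Hom_cases[OF A_cplx[OF that(1)] A_cplx[OF that(2)] that(3)] by metis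
    from someI_ex[OF this] show "chain_map R X Y (rep X Y F)" "F = htpy_class R X Y (rep X Y F)"
      unfolding rep_def by blast+
  qed
  define code where "code = (\<lambda>((X, Y), F). pair_code (ocode X, pair_code (ocode Y, matrix_code \<rho> (mat X Y (rep X Y F)))))"
  have "inj_on code (SIGMA p : reps \<times> reps. Hom C (fst p) (snd p))"
  proof (rule inj_onI)
    fix s t assume s: "s \<in> (SIGMA p : reps \<times> reps. Hom C (fst p) (snd p))"
      and t: "t \<in> (SIGMA p : reps \<times> reps. Hom C (fst p) (snd p))" and eq: "code s = code t"
    obtain X Y F where sX: "s = ((X, Y), F)" and X: "X \<in> reps" and Y: "Y \<in> reps" and F: "F \<in> Hom (K_Proj R) X Y"
      using s by (auto simp: Hom)
    obtain X' Y' F' where tX: "t = ((X', Y'), F')" and X': "X' \<in> reps" and Y': "Y' \<in> reps"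
      and F': "F' \<in> Hom (K_Proj R) X' Y'"
      using t by (auto simp: Hom)
    have XA: "X \<in> A" and YA: "Y \<in> A" using X Y repsA by auto
    have "ocode X = ocode X'" "ocode Y = ocode Y'"
      and mc: "matrix_code \<rho> (mat X Y (rep X Y F)) = matrix_code \<rho> (mat X' Y' (rep X' Y' F'))"
      using eq by (simp_all add: code_def sX tX pair_code_eq)
    then have XX: "X' = X" and YY: "Y' = Y" using ocode X X' Y Y' by blast+
    note F' = F'[unfolded XX YY]
    note f = rep[OF XA YA F] and f' = rep[OF XA YA F']
    have m: "mat X Y (rep X Y F) = mat X Y (rep X Y F')"
      by (rule matrix_code_inj[OF \<rho> mat[OF XA YA f(1)] mat[OF XA YA f'(1)] mc[unfolded XX YY]])
    have "homotopic R X Y (rep X Y F) (rep X Y F')"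
      by (rule retract_maps_eq[OF A_proj[OF XA] A_proj[OF YA] q'[OF XA] q'[OF YA] f(1) f'(1)])
        (rule mat_eq[OF m])
    then have "F = F'"
      using htpy_class_eq_iff[OF A_cplx[OF XA] A_cplx[OF YA] f(1) f'(1)] f(2) f'(2) by metis
    then show "s = t" by (simp add: sX tX XX YY)
  qed
  from card_le_aleph1[OF assms(5) this]
  show ?thesis unfolding cat_card_def Let_def C_def[symmetric] reps_def[symmetric] .
qed

end
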